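(* Let $h:[2,\infty)\to[2,\infty)$ be an increasing function with $h(N)\nearrow\infty$ as $N\to\infty$, such that $$\lim_{N\to\infty}\frac{h(N)}{\log N}=0\qquad\text{and}\qquad\lim_{N\to\infty}\frac{h\big((\log N)^4\big)}{h(N)}=0.$$ Then there is a constant $C>0$ depending only on $h$ such that for every $N\ge2$ and every set $\Omega\subset\mathbb R^2$ with $\#(\Omega)=N$, $$\|H_\Omega\|_{L^2(\mathbb R^3)\to L^2(\mathbb R^3)}\le C\,N^{1/4}h(N).$$
   Context: For $v\in\mathbb R^2$ write $\langle v,1\rangle=(v_1,v_2,1)\in\mathbb R^3$. The directional Hilbert transform on $\mathbb R^3$ is $H_vf(x)=\mathrm{p.v.}\,\frac1\pi\int_{\mathbb R}f(x-t\langle v,1\rangle)\frac{dt}{t}$, bounded on $L^2(\mathbb R^3)$. For finite $\Omega\subset\mathbb R^2$, $H_\Omega f(x)=\sup_{v\in\Omega}|H_vf(x)|$, and $\|H_\Omega\|_{L^2(\mathbb R^3)\to L^2(\mathbb R^3)}$ is its operator norm on $L^2(\mathbb R^3)$. *)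

theory Defs
  imports "HOL-Analysis.Analysis"
begin

definition lift :: "real ^ 2 \<Rightarrow> real ^ 3" where
  "lift v = vector [v $ 1, v $ 2, 1]"

(* The p.v. limit exists for almost every x when f is in L^2(R^3).
   Where it does not exist, Lim is an unspecified complex number. *)
definition directional_Hilbert :: "real ^ 2 \<Rightarrow> (real ^ 3 \<Rightarrow> complex) \<Rightarrow> real ^ 3 \<Rightarrow> complex" where
  "directional_Hilbert v f x =
     Lim (at_right 0)
       (\<lambda>\<epsilon>. 1 / pi * (CLINT t:{t. \<epsilon> < \<bar>t\<bar>}|lebesgue. f (x - t *\<^sub>R lift v) / of_real t))"

(* The supremum is meant for finite nonempty sets of directions, where it is a maximum. *)
definition maximal_Hilbert :: "(real ^ 2) set \<Rightarrow> (real ^ 3 \<Rightarrow> complex) \<Rightarrow> real ^ 3 \<Rightarrow> real" where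
  "maximal_Hilbert \<Omega> f x = (SUP v\<in>\<Omega>. cmod (directional_Hilbert v f x))"

definition L2_norm :: "(real ^ 3 \<Rightarrow> 'b::real_normed_vector) \<Rightarrow> ennreal" where
  "L2_norm g =
     (let I = (\<integral>\<^sup>+ x. ennreal ((norm (g x))\<^sup>2) \<partial>lebesgue)
      in if I = \<infinity> then \<infinity> else ennreal (sqrt (enn2real I)))"

(* Members are functions rather than classes modulo null sets. *)
definition L2_space :: "(real ^ 3 \<Rightarrow> complex) set" where
  "L2_space = {f \<in> borel_measurable lebesgue. L2_norm f < \<infinity>}"

(* For T (absolutely) homogeneous, not necessarily linear; the value is infinite
   if T is unbounded. *)
definition L2_operator_norm ::
    "((real ^ 3 \<Rightarrow> complex) \<Rightarrow> real ^ 3 \<Rightarrow> 'b::real_normed_vector) \<Rightarrow> ennreal" where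
  "L2_operator_norm T = (SUP f\<in>{f \<in> L2_space. L2_norm f \<le> 1}. L2_norm (T f))"

end

(*
The multiplier of H_v is -i sgn(xi . (v,1)), so for a test function f one has
||H_u f - H_v f||^2 = 4 mu {xi. xi . (u,1) and xi . (v,1) have opposite signs}, where mu is the
normalised density |f^|^2 of total mass ||f||^2 on the dual space; only "<=" is needed. The right-hand
side is a pseudometric 4 d(u,v) on the points of the projective plane which counts the lines xi that
separate u from v. Two lines meet in one point, and the pairs of lines that meet within distance s of
a point have mass at least s^2; balls around far apart points are disjoint, so n points always contain
a pair at distance O(mu / sqrt n). Greedily matching such pairs gives a matching of Omega of total
length O(sqrt N ||f||^2), whence
||sup_Omega H_v f|| <= ||sup_R H_v f|| + O(N^(1/4)) ||f|| for a set R of about N/2 representatives.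
Iterating, the losses form a geometric series and the sum is O(N^(1/4)), which is at most
O(N^(1/4) h(N)) since h >= 2. The matching is allowed to depend on f.

The principal values converge almost everywhere by a Cotlar inequality on the line, with the L^2
bounds of the truncations taken from Plancherel and the boundedness of the sine integral; Tonelli's
theorem transfers the convergence to R^3.
*)

theory Submission
  imports Defs "HOL-Probability.Probability" "HOL-Real_Asymp.Real_Asymp" "HOL-Analysis.Cross3"
begin

section \<open>Plancherel for compactly supported Lipschitz functions\<close>

text \<open>The test functions are dictated by what is asked of them. They must be dense in L^2,
  have absolutely convergent Fourier integrals, and be mapped to one another by the truncated
  transforms, because Plancherel is applied to these transforms as well. Compactly supported
  Lipschitz functions qualify once \<open>1 / t\<close> is cut off both near 0 and near infinity.
  The exponent is a matter of counting: a close pair among n remaining directions costs O(1 / sqrt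
  n), and these costs sum to O(sqrt N). This bounds a squared norm, hence the fourth root. The
  distance d satisfies the triangle inequality only because planes through the origin are null: a
  plane that contains the middle point could separate the outer two without separating either from
  the middle one. The passage from test functions to L^2 is not uniform in the number of directions.
  This does no harm, since \<Omega> is fixed before the approximating function is chosen, and the
  sum of the errors over all directions can still be made small.\<close>

definition test_fn :: "('a::euclidean_space \<Rightarrow> complex) \<Rightarrow> bool" where
  "test_fn f \<longleftrightarrow> (\<exists>L. L-lipschitz_on UNIV f) \<and> (\<exists>r. \<forall>x. norm x > r \<longrightarrow> f x = 0)"

lemma test_fn_continuous: "test_fn f \<Longrightarrow> continuous_on UNIV f"
  unfolding test_fn_def using lipschitz_on_continuous_on by blast

lemma test_fn_measurable [measurable_dest]: "test_fn f \<Longrightarrow> f \<in> borel_measurable borel"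
  by (intro borel_measurable_continuous_onI test_fn_continuous)

lemma test_fn_bound:
  fixes f :: "'a::euclidean_space \<Rightarrow> complex"
  assumes "test_fn f"
  shows "\<exists>B r. 0 \<le> B \<and> 0 < r \<and> (\<forall>x. norm (f x) \<le> B * indicator (cball 0 r) x)"
proof -
  obtain r where r: "\<And>x. norm x > r \<Longrightarrow> f x = 0"
    using assms unfolding test_fn_def by blast
  have "compact (f ` cball 0 (max r 1))"
    by (intro compact_continuous_image continuous_on_subset[OF test_fn_continuous[OF assms]]) auto
  then have "bounded (f ` cball 0 (max r 1))" by (rule compact_imp_bounded)
  then obtain B where B: "0 < B" "\<forall>y\<in>f ` cball 0 (max r 1). norm y \<le> B"
    using bounded_pos by blast
  have "norm (f x) \<le> B * indicator (cball 0 (max r 1)) x" for x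
    using B r[of x] by (cases "norm x \<le> max r 1") (auto simp: indicator_def)
  then show ?thesis
    using B(1) by (intro exI[of _ B] exI[of _ "max r 1"]) auto
qed

lemma test_fn_integrable:
  fixes f :: "'a::euclidean_space \<Rightarrow> complex"
  assumes "test_fn f"
  shows "integrable lborel f"
proof -
  obtain B r where *: "0 \<le> B" "0 < r" "\<And>x. norm (f x) \<le> B * indicator (cball 0 r) x"
    using test_fn_bound[OF assms] by blast
  have "integrable lborel (\<lambda>x::'a. B * indicator (cball 0 r) x)"
    by (intro integrable_mult_right) (auto simp: integrable_indicator_iff emeasure_lborel_cball_finite[simplified infinity_ennreal_def])
  then show ?thesis
    by (rule Bochner_Integration.integrable_bound)
       (use * test_fn_measurable[OF assms] in auto)
qed

lemma integrable_times_bounded: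
  fixes f g :: "'a \<Rightarrow> 'b::{real_normed_algebra,banach,second_countable_topology}"
  assumes f: "integrable M f" and [measurable]: "g \<in> borel_measurable M" and g: "\<And>x. norm (g x) \<le> B"
  shows "integrable M (\<lambda>x. f x * g x)"
proof -
  have B: "0 \<le> B" using g[of undefined] norm_ge_zero order_trans by blast
  have "integrable M (\<lambda>x. B * norm (f x))" using f by auto
  then show ?thesis
  proof (rule Bochner_Integration.integrable_bound)
    show "(\<lambda>x. f x * g x) \<in> borel_measurable M" using f by measurable
    show "AE x in M. norm (f x * g x) \<le> norm (B * norm (f x))"
    proof (rule AE_I2)
      fix x
      have "norm (f x * g x) \<le> norm (f x) * norm (g x)" by (rule norm_mult_ineq)
      also have "\<dots> \<le> norm (f x) * B" using g by (intro mult_left_mono) auto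
      finally show "norm (f x * g x) \<le> norm (B * norm (f x))" using B by (simp add: mult.commute)
    qed
  qed
qed

lemma test_fn_integrable_square:
  fixes f :: "'a::euclidean_space \<Rightarrow> complex"
  assumes "test_fn f"
  shows "integrable lborel (\<lambda>x. (norm (f x))\<^sup>2)"
proof -
  obtain B r where *: "0 \<le> B" "0 < r" "\<And>x. norm (f x) \<le> B * indicator (cball 0 r) x"
    using test_fn_bound[OF assms] by blast
  have "norm (f x) \<le> B" for x
    using *(1) *(3)[of x] by (cases "x \<in> cball 0 r") auto
  then show ?thesis
    unfolding power2_eq_square using assms test_fn_integrable[OF assms]
    by (intro integrable_times_bounded) auto
qed

lemma integrable_pair_times:
  fixes g :: "'a \<Rightarrow> 'c::{real_normed_field,banach,second_countable_topology}" and h :: "'b \<Rightarrow> 'c"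
  assumes "sigma_finite_measure M" "sigma_finite_measure N"
  assumes g: "integrable M g" and h: "integrable N h"
  shows "integrable (M \<Otimes>\<^sub>M N) (\<lambda>(x, y). g x * h y)"
proof -
  interpret pair_sigma_finite M N using assms by (simp add: pair_sigma_finite_def)
  have [measurable]: "g \<in> borel_measurable M" "h \<in> borel_measurable N" using g h by auto
  show ?thesis
    by (rule Fubini_integrable) (use g h in \<open>auto simp: norm_mult\<close>)
qed

lemma cis_measurable [measurable]: "cis \<in> borel_measurable borel"
  by (intro borel_measurable_continuous_onI continuous_intros)

section \<open>The Gaussian and its Fourier transform\<close>

definition gauss :: "'a::real_normed_vector \<Rightarrow> real" where
  "gauss x = exp (- (norm x)\<^sup>2 / 2)"

lemma gauss_pos: "gauss x > 0" by (simp add: gauss_def)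
lemma abs_gauss [simp]: "\<bar>gauss x\<bar> = gauss x" by (simp add: gauss_def)
lemma gauss_0 [simp]: "gauss 0 = 1" by (simp add: gauss_def)

lemma gauss_measurable [measurable]: "gauss \<in> borel_measurable borel"
  unfolding gauss_def by measurable

text \<open>This is the characteristic function of the standard normal distribution, with the
  normalising factor \<open>sqrt (2 * pi)\<close> moved to the other side.\<close>

lemma gauss_real_fourier:
  fixes t :: real
  shows "integrable lborel (\<lambda>x::real. complex_of_real (gauss x) * cis (x * t))" (is ?i)
    and "(\<integral>x. complex_of_real (gauss (x::real)) * cis (x * t) \<partial>lborel) = sqrt (2 * pi) * gauss t" (is ?e)
proof -
  have eq: "complex_of_real (gauss x) * cis (x * t) = sqrt (2*pi) * (std_normal_density x *\<^sub>R iexp (t * x))" for x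
    by (simp add: gauss_def std_normal_density_def cis_conv_exp scaleR_conv_of_real mult.commute field_simps)
  have "integrable lborel std_normal_density" by (rule integrable_normal_density) simp
  then have i: "integrable lborel (\<lambda>x. std_normal_density x *\<^sub>R iexp (t * x))"
    by (rule Bochner_Integration.integrable_bound) auto
  show ?i unfolding eq by (rule integrable_mult_right[OF i])
  have "(CLINT x|density lborel std_normal_density. iexp (t * x)) = exp (- (t^2) / 2)"
    using fun_cong[OF char_std_normal_distribution, of t] unfolding char_def by simp
  then have "(\<integral>x. std_normal_density x *\<^sub>R iexp (t * x) \<partial>lborel) = complex_of_real (exp (- (t^2) / 2))"
    by (subst (asm) integral_density) auto
  then have e: "(\<integral>x. std_normal_density x *\<^sub>R iexp (t * x) \<partial>lborel) = complex_of_real (gauss t)"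
    by (simp only: gauss_def real_norm_def power2_abs)
  show ?e unfolding eq integral_mult_right_zero e by simp
qed

text \<open>Lebesgue measure is the image of the product measure over \<open>Basis\<close>, and both
  the Gaussian and the character factor over the coordinates. Integrability is read off at frequency
  0.\<close>

lemma gauss_fourier:
  fixes z :: "'a::euclidean_space"
  shows "integrable lborel (gauss :: 'a \<Rightarrow> real)" (is ?i)
    and "(\<integral>x. complex_of_real (gauss (x::'a)) * cis (x \<bullet> z) \<partial>lborel) = sqrt (2 * pi) ^ DIM('a) * gauss z" (is ?e)
proof -
  interpret product_sigma_finite "\<lambda>_::'a. lborel :: real measure" by standard
  let ?s = "\<lambda>f. \<Sum>b\<in>Basis. f b *\<^sub>R b :: 'a"
  have n: "(norm (?s f))\<^sup>2 = (\<Sum>b\<in>Basis. (f b)\<^sup>2)" for f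
    by (simp add: euclidean_dist_l2[of 0, simplified] L2_set_def sum_nonneg)
  have eq: "complex_of_real (gauss (?s f)) * cis (?s f \<bullet> w) = (\<Prod>b\<in>Basis. complex_of_real (gauss (f b)) * cis (f b * (b \<bullet> w)))" for f w
  proof -
    have "gauss (?s f) = (\<Prod>b\<in>Basis. gauss (f b))"
      unfolding gauss_def n by (simp add: exp_sum[symmetric] sum_negf sum_divide_distrib)
    moreover have "cis (?s f \<bullet> w) = (\<Prod>b\<in>Basis. cis (f b * (b \<bullet> w)))"
      by (simp add: cis_conv_exp inner_sum_left sum_distrib_left exp_sum)
    ultimately show ?thesis by (simp add: prod.distrib)
  qed
  have "integrable lborel (\<lambda>x::'a. complex_of_real (gauss x) * cis (x \<bullet> 0))"
    by (subst lborel_eq, subst integrable_distr_eq)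
       (auto simp only: eq intro!: product_integrable_prod gauss_real_fourier finite_Basis, auto)
  then have "integrable lborel (\<lambda>x::'a. norm (complex_of_real (gauss x) * cis (x \<bullet> 0)))"
    by (rule integrable_norm)
  then show ?i by (simp add: norm_mult abs_of_pos[OF gauss_pos])
  have "(\<integral>x. complex_of_real (gauss (x::'a)) * cis (x \<bullet> z) \<partial>lborel) = (\<Prod>b\<in>Basis. sqrt (2 * pi) * gauss (b \<bullet> z))"
    by (subst lborel_eq, subst integral_distr)
       (simp_all only: eq product_integral_prod[OF finite_Basis gauss_real_fourier(1)] gauss_real_fourier(2), auto)
  also have "\<dots> = complex_of_real (sqrt (2 * pi) ^ DIM('a) * (\<Prod>b\<in>Basis. gauss (b \<bullet> z)))"
    by (simp add: prod.distrib)
  also have "(\<Prod>b\<in>Basis. gauss (b \<bullet> z)) = gauss z"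
  proof -
    have "(norm z)\<^sup>2 = (\<Sum>b\<in>Basis. (b \<bullet> z)\<^sup>2)"
      using euclidean_dist_l2[of 0 z] by (simp add: L2_set_def sum_nonneg inner_commute)
    then show ?thesis
      unfolding gauss_def by (simp add: exp_sum[symmetric] sum_negf sum_divide_distrib)
  qed
  finally show ?e by simp
qed

lemma integral_affine:
  fixes f :: "'a::euclidean_space \<Rightarrow> 'b::{banach,second_countable_topology}"
  assumes [measurable]: "f \<in> borel_measurable borel" and c: "c \<noteq> 0"
  shows "(\<integral>x. f x \<partial>lborel) = \<bar>c\<bar> ^ DIM('a) *\<^sub>R (\<integral>x. f (t + c *\<^sub>R x) \<partial>lborel)"
  by (subst lborel_affine[OF c, of t]) (simp add: integral_density integral_distr)

lemma nn_integral_affine: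
  fixes f :: "'a::euclidean_space \<Rightarrow> ennreal"
  assumes [measurable]: "f \<in> borel_measurable borel" and c: "c \<noteq> 0"
  shows "(\<integral>\<^sup>+x. f x \<partial>lborel) = ennreal (\<bar>c\<bar> ^ DIM('a)) * (\<integral>\<^sup>+x. f (t + c *\<^sub>R x) \<partial>lborel)"
  by (subst lborel_affine[OF c, of t])
     (simp add: nn_integral_density nn_integral_distr nn_integral_cmult ennreal_power)

lemma integrable_affine:
  fixes f :: "'a::euclidean_space \<Rightarrow> 'b::{banach,second_countable_topology}"
  assumes f: "integrable lborel f" and c: "c \<noteq> 0"
  shows "integrable lborel (\<lambda>x. f (t + c *\<^sub>R x))"
proof -
  have [measurable]: "f \<in> borel_measurable borel" using f by simp
  have "ennreal (\<bar>c\<bar> ^ DIM('a)) * (\<integral>\<^sup>+x. norm (f (t + c *\<^sub>R x)) \<partial>lborel) < \<infinity>"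
    using f by (subst nn_integral_affine[OF _ c, symmetric]) (auto simp: integrable_iff_bounded)
  then show ?thesis using c
    by (auto simp: integrable_iff_bounded ennreal_mult_less_top)
qed

section \<open>Plancherel by Gaussian regularisation\<close>

definition fourier :: "('a::euclidean_space \<Rightarrow> complex) \<Rightarrow> 'a \<Rightarrow> complex" where
  "fourier f \<xi> = (\<integral>x. f x * cis (- (x \<bullet> \<xi>)) \<partial>lborel)"

lemma cnj_measurable [measurable]: "cnj \<in> borel_measurable borel"
  by (intro borel_measurable_continuous_onI continuous_intros)

lemma fourier_measurable [measurable]:
  fixes f :: "'a::euclidean_space \<Rightarrow> complex"
  assumes [measurable]: "f \<in> borel_measurable borel"
  shows "fourier f \<in> borel_measurable borel"
  unfolding fourier_def by measurable

lemma integrable_cis: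
  assumes "integrable M f" "g \<in> borel_measurable M"
  shows "integrable M (\<lambda>x. f x * cis (g x))"
  using assms by (intro integrable_times_bounded[where B=1]) auto

lemma fourier_bound: "norm (fourier f \<xi>) \<le> (\<integral>x. norm (f x) \<partial>lborel)"
  unfolding fourier_def by (rule order_trans[OF integral_norm_bound]) (simp add: norm_mult)

text \<open>The Gaussian weight makes all double integrals absolutely convergent, although nothing
  is known yet about the decay of \<open>fourier f\<close>. Fubini then turns the weighted mass into
  a pairing of \<open>f\<close> with its Gaussian mean at scale \<open>d\<close>; the substitution
  \<open>x = y + d *\<^sub>R z\<close> absorbs the powers of \<open>d\<close>.\<close>

lemma fourier_gauss_mass:
  fixes f :: "'a::euclidean_space \<Rightarrow> complex"
  assumes f: "integrable lborel f" and d: "0 < d"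
  defines "c \<equiv> complex_of_real (sqrt (2 * pi) ^ DIM('a))"
  shows "integrable lborel (\<lambda>\<xi>. gauss (d *\<^sub>R \<xi>) * (norm (fourier f \<xi>))\<^sup>2)" (is ?i)
    and "complex_of_real (\<integral>\<xi>. gauss (d *\<^sub>R \<xi>) * (norm (fourier f \<xi>))\<^sup>2 \<partial>lborel) =
      c * (\<integral>y. cnj (f y) * (\<integral>z. f (y + d *\<^sub>R z) * gauss z \<partial>lborel) \<partial>lborel)" (is ?e)
proof -
  have [measurable]: "f \<in> borel_measurable borel" using f by simp
  have gi: "integrable lborel (\<lambda>\<xi>::'a. gauss (d *\<^sub>R \<xi>))"
    using integrable_affine[OF gauss_fourier(1), of d 0] d by simp
  then have gc: "integrable lborel (\<lambda>\<xi>::'a. complex_of_real (gauss (d *\<^sub>R \<xi>)))" by simp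
  have i1: "integrable lborel (\<lambda>\<xi>. complex_of_real (gauss (d *\<^sub>R \<xi>)) * fourier f \<xi>)"
    by (rule integrable_times_bounded[OF gc _ fourier_bound]) simp
  have cn: "cnj (fourier f \<xi>) = (\<integral>y. cnj (f y) * cis (y \<bullet> \<xi>) \<partial>lborel)" for \<xi>
    unfolding fourier_def Bochner_Integration.integral_cnj[symmetric] by (simp add: cis_cnj)
  have FTc: "norm (cnj (fourier f \<xi>)) \<le> (\<integral>x. norm (f x) \<partial>lborel)" for \<xi> using fourier_bound by simp
  have i2: "integrable lborel (\<lambda>\<xi>. complex_of_real (gauss (d *\<^sub>R \<xi>)) * fourier f \<xi> * cnj (fourier f \<xi>))"
    by (rule integrable_times_bounded[OF i1 _ FTc]) simp
  have eq: "complex_of_real (gauss (d *\<^sub>R \<xi>)) * fourier f \<xi> * cnj (fourier f \<xi>)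
      = complex_of_real (gauss (d *\<^sub>R \<xi>) * (norm (fourier f \<xi>))\<^sup>2)" for \<xi>
    by (simp add: complex_norm_square mult.assoc del: of_real_power)
  show ?i using integrable_Re[OF i2] unfolding eq by simp
  have K: "(\<integral>\<xi>. complex_of_real (gauss (d *\<^sub>R \<xi>)) * cis (\<xi> \<bullet> w) \<partial>lborel) = c * gauss (w /\<^sub>R d) / d ^ DIM('a)" for w :: 'a
  proof -
    have "(\<integral>\<xi>. complex_of_real (gauss (\<xi>::'a)) * cis (\<xi> \<bullet> (w /\<^sub>R d)) \<partial>lborel) =
       \<bar>d\<bar> ^ DIM('a) *\<^sub>R (\<integral>\<xi>. complex_of_real (gauss (0 + d *\<^sub>R (\<xi>::'a))) * cis ((0 + d *\<^sub>R \<xi>) \<bullet> (w /\<^sub>R d)) \<partial>lborel)"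
      using d by (intro integral_affine) auto
    also have "(\<integral>\<xi>. complex_of_real (gauss (\<xi>::'a)) * cis (\<xi> \<bullet> (w /\<^sub>R d)) \<partial>lborel) = c * gauss (w /\<^sub>R d)"
      unfolding c_def by (subst gauss_fourier(2)) simp
    finally have *: "c * gauss (w /\<^sub>R d) = \<bar>d\<bar> ^ DIM('a) *\<^sub>R (\<integral>\<xi>. complex_of_real (gauss (0 + d *\<^sub>R (\<xi>::'a))) * cis ((0 + d *\<^sub>R \<xi>) \<bullet> (w /\<^sub>R d)) \<partial>lborel)"
      by simp
    have dd: "inverse d * (d * t) = t" for t using d by simp
    show ?thesis unfolding * using d by (simp add: scaleR_conv_of_real dd)
  qed
  \<comment> \<open>Fourier inversion with a Gaussian weight: the weighted inverse transform is a
    Gaussian mean of \<open>f\<close> around \<open>y\<close>.\<close>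
  have inner: "(\<integral>\<xi>. complex_of_real (gauss (d *\<^sub>R \<xi>)) * fourier f \<xi> * cis (y \<bullet> \<xi>) \<partial>lborel)
      = c * (\<integral>z. f (y + d *\<^sub>R z) * gauss z \<partial>lborel)" for y
  proof -
    have "integrable (lborel \<Otimes>\<^sub>M lborel) (\<lambda>(\<xi>::'a, x). complex_of_real (gauss (d *\<^sub>R \<xi>)) * f x)"
      by (rule integrable_pair_times) (use gc f in \<open>auto simp: lborel.sigma_finite_measure_axioms\<close>)
    then have int: "integrable (lborel \<Otimes>\<^sub>M lborel) (\<lambda>(\<xi>::'a, x). complex_of_real (gauss (d *\<^sub>R \<xi>)) * f x * cis ((y - x) \<bullet> \<xi>))"
      by (rule Bochner_Integration.integrable_bound) (auto simp: norm_mult)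
    have "(\<integral>\<xi>. complex_of_real (gauss (d *\<^sub>R \<xi>)) * fourier f \<xi> * cis (y \<bullet> \<xi>) \<partial>lborel)
       = (\<integral>\<xi>. (\<integral>x. complex_of_real (gauss (d *\<^sub>R \<xi>)) * f x * cis ((y - x) \<bullet> \<xi>) \<partial>lborel) \<partial>lborel)"
    proof (rule Bochner_Integration.integral_cong[OF refl])
      fix \<xi> :: 'a
      have e: "complex_of_real (gauss (d *\<^sub>R \<xi>)) * f x * cis ((y - x) \<bullet> \<xi>) =
          (complex_of_real (gauss (d *\<^sub>R \<xi>)) * cis (y \<bullet> \<xi>)) * (f x * cis (- (x \<bullet> \<xi>)))" for x
        by (simp add: cis_mult inner_diff_left mult_ac)
      show "complex_of_real (gauss (d *\<^sub>R \<xi>)) * fourier f \<xi> * cis (y \<bullet> \<xi>) = (\<integral>x. complex_of_real (gauss (d *\<^sub>R \<xi>)) * f x * cis ((y - x) \<bullet> \<xi>) \<partial>lborel)"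
        unfolding e integral_mult_right_zero by (simp add: fourier_def mult_ac)
    qed
    also have "\<dots> = (\<integral>x. (\<integral>\<xi>. complex_of_real (gauss (d *\<^sub>R \<xi>)) * f x * cis ((y - x) \<bullet> \<xi>) \<partial>lborel) \<partial>lborel)"
      by (rule lborel_pair.Fubini_integral[OF int, symmetric])
    also have "\<dots> = (\<integral>x. f x * (c * gauss ((y - x) /\<^sub>R d) / d ^ DIM('a)) \<partial>lborel)"
    proof (rule Bochner_Integration.integral_cong[OF refl])
      fix x :: 'a
      have e: "complex_of_real (gauss (d *\<^sub>R \<xi>)) * f x * cis ((y - x) \<bullet> \<xi>) = f x * (complex_of_real (gauss (d *\<^sub>R \<xi>)) * cis (\<xi> \<bullet> (y - x)))" for \<xi>
        by (simp add: mult_ac inner_commute)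
      show "(\<integral>\<xi>. complex_of_real (gauss (d *\<^sub>R \<xi>)) * f x * cis ((y - x) \<bullet> \<xi>) \<partial>lborel) = f x * (c * gauss ((y - x) /\<^sub>R d) / d ^ DIM('a))"
        unfolding e integral_mult_right_zero K ..
    qed
    also have "\<dots> = d ^ DIM('a) *\<^sub>R (\<integral>z. f (y + d *\<^sub>R z) * (c * gauss ((y - (y + d *\<^sub>R z)) /\<^sub>R d) / d ^ DIM('a)) \<partial>lborel)"
      using d by (subst integral_affine[where c=d and t=y]) auto
    also have "\<dots> = c * (\<integral>z. f (y + d *\<^sub>R z) * gauss z \<partial>lborel)"
    proof -
      have "gauss ((y - (y + d *\<^sub>R z)) /\<^sub>R d) = gauss z" for z
        using d by (simp add: gauss_def)
      then have e: "f (y + d *\<^sub>R z) * (c * gauss ((y - (y + d *\<^sub>R z)) /\<^sub>R d) / d ^ DIM('a)) = (c / d ^ DIM('a)) * (f (y + d *\<^sub>R z) * gauss z)" for z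
        by (simp add: mult_ac)
      show ?thesis unfolding e integral_mult_right_zero using d by (simp add: scaleR_conv_of_real)
    qed
    finally show ?thesis .
  qed
  have "complex_of_real (\<integral>\<xi>. gauss (d *\<^sub>R \<xi>) * (norm (fourier f \<xi>))\<^sup>2 \<partial>lborel)
     = (\<integral>\<xi>. complex_of_real (gauss (d *\<^sub>R \<xi>)) * fourier f \<xi> * cnj (fourier f \<xi>) \<partial>lborel)"
    unfolding eq integral_complex_of_real ..
  also have "\<dots> = (\<integral>\<xi>. (\<integral>y. complex_of_real (gauss (d *\<^sub>R \<xi>)) * fourier f \<xi> * cnj (f y) * cis (y \<bullet> \<xi>) \<partial>lborel) \<partial>lborel)"
    by (simp add: cn mult.assoc)
  also have "\<dots> = (\<integral>y. (\<integral>\<xi>. complex_of_real (gauss (d *\<^sub>R \<xi>)) * fourier f \<xi> * cnj (f y) * cis (y \<bullet> \<xi>) \<partial>lborel) \<partial>lborel)"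
  proof (rule lborel_pair.Fubini_integral[symmetric])
    have "integrable (lborel \<Otimes>\<^sub>M lborel) (\<lambda>(\<xi>::'a, y). (complex_of_real (gauss (d *\<^sub>R \<xi>)) * fourier f \<xi>) * cnj (f y))"
      by (rule integrable_pair_times) (use i1 f in \<open>auto simp: lborel.sigma_finite_measure_axioms\<close>)
    then show "integrable (lborel \<Otimes>\<^sub>M lborel) (\<lambda>(\<xi>::'a, y). complex_of_real (gauss (d *\<^sub>R \<xi>)) * fourier f \<xi> * cnj (f y) * cis (y \<bullet> \<xi>))"
      by (rule Bochner_Integration.integrable_bound) (auto simp: norm_mult)
  qed
  also have "\<dots> = (\<integral>y. c * (cnj (f y) * (\<integral>z. f (y + d *\<^sub>R z) * gauss z \<partial>lborel)) \<partial>lborel)"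
  proof (rule Bochner_Integration.integral_cong[OF refl])
    fix y :: 'a
    have e: "complex_of_real (gauss (d *\<^sub>R \<xi>)) * fourier f \<xi> * cnj (f y) * cis (y \<bullet> \<xi>) = cnj (f y) * (complex_of_real (gauss (d *\<^sub>R \<xi>)) * fourier f \<xi> * cis (y \<bullet> \<xi>))" for \<xi>
      by (simp add: mult_ac)
    show "(\<integral>\<xi>. complex_of_real (gauss (d *\<^sub>R \<xi>)) * fourier f \<xi> * cnj (f y) * cis (y \<bullet> \<xi>) \<partial>lborel) = c * (cnj (f y) * (\<integral>z. f (y + d *\<^sub>R z) * gauss z \<partial>lborel))"
      unfolding e integral_mult_right_zero inner by (simp only: mult_ac)
  qed
  also have "\<dots> = c * (\<integral>y. cnj (f y) * (\<integral>z. f (y + d *\<^sub>R z) * gauss z \<partial>lborel) \<partial>lborel)"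
    by simp
  finally show ?e .
qed


text \<open>The scale in \<open>fourier_gauss_mass\<close> is sent to 0. The constant is the square
  of \<open>sqrt (2 * pi) ^ DIM('a)\<close>: one factor stands in front of the pairing, the other is
  the total mass of \<open>gauss\<close>.\<close>

lemma Plancherel:
  fixes f :: "'a::euclidean_space \<Rightarrow> complex"
  assumes t: "test_fn f"
  shows "(\<integral>\<^sup>+\<xi>. ennreal ((norm (fourier f \<xi>))\<^sup>2) \<partial>lborel) =
    ennreal ((2 * pi) ^ DIM('a) * (\<integral>x. (norm (f x))\<^sup>2 \<partial>lborel))"
proof -
  have [measurable]: "f \<in> borel_measurable borel" by (rule test_fn_measurable[OF t])
  have f: "integrable lborel f" by (rule test_fn_integrable[OF t])
  obtain B where B: "\<And>x. norm (f x) \<le> B"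
  proof -
    obtain B r where *: "0 \<le> B" "0 < r" "\<And>x. norm (f x) \<le> B * indicator (cball 0 r) x"
      using test_fn_bound[OF t] by blast
    have "norm (f x) \<le> B" for x
      using *(1) *(3)[of x] by (cases "x \<in> cball 0 r") auto
    then show thesis by (rule that)
  qed
  have B0: "0 \<le> B" using B[of 0] norm_ge_zero order_trans by blast
  define d where "d k = inverse (real (Suc k))" for k
  have d: "d k > 0" for k by (simp add: d_def)
  have d0: "d \<longlonglongrightarrow> 0" unfolding d_def by (rule LIMSEQ_inverse_real_of_nat)
  let ?c = "complex_of_real (sqrt (2 * pi) ^ DIM('a))"
  let ?J = "\<lambda>k. \<integral>\<xi>. gauss (d k *\<^sub>R \<xi>) * (norm (fourier f \<xi>))\<^sup>2 \<partial>lborel"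
  have g1: "complex_integrable lborel (\<lambda>z::'a. complex_of_real (gauss z))"
    using gauss_fourier(1)[where 'a='a] by simp
  have gm: "(\<integral>z. complex_of_real (gauss (z::'a)) \<partial>lborel) = ?c"
    using gauss_fourier(2)[of "0::'a"] by simp
  have lim1: "(\<lambda>k. \<integral>z. f (y + d k *\<^sub>R z) * gauss z \<partial>lborel) \<longlonglongrightarrow> (\<integral>z. f y * gauss (z::'a) \<partial>lborel)" for y
  proof (rule integral_dominated_convergence[where w="\<lambda>z. B * gauss (z::'a)"])
    have "isCont f y"
      using test_fn_continuous[OF t] by (simp add: continuous_on_eq_continuous_at)
    moreover have "(\<lambda>k. y + d k *\<^sub>R z) \<longlonglongrightarrow> y + 0 *\<^sub>R z" for z
      by (intro tendsto_intros d0)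
    ultimately show "AE z in lborel. (\<lambda>k. f (y + d k *\<^sub>R z) * complex_of_real (gauss z)) \<longlonglongrightarrow> f y * complex_of_real (gauss z)"
      by (intro AE_I2 tendsto_intros isCont_tendsto_compose[where g=f]) auto
    show "AE z in lborel. norm (f (y + d k *\<^sub>R z) * complex_of_real (gauss z)) \<le> B * gauss z" for k
      by (intro AE_I2) (auto simp: norm_mult intro!: mult_right_mono B less_imp_le[OF gauss_pos])
  qed (use gauss_fourier(1)[where 'a='a] in auto)
  have lim2: "(\<lambda>k. \<integral>y. cnj (f y) * (\<integral>z. f (y + d k *\<^sub>R z) * gauss z \<partial>lborel) \<partial>lborel)
      \<longlonglongrightarrow> (\<integral>y. cnj (f y) * (\<integral>z. f y * gauss (z::'a) \<partial>lborel) \<partial>lborel)"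
  proof (rule integral_dominated_convergence[where w="\<lambda>y. norm (f y) * (B * (\<integral>z. gauss (z::'a) \<partial>lborel))"])
    show "AE y in lborel. (\<lambda>k. cnj (f y) * (\<integral>z. f (y + d k *\<^sub>R z) * gauss z \<partial>lborel))
          \<longlonglongrightarrow> cnj (f y) * (\<integral>z. f y * gauss (z::'a) \<partial>lborel)"
      by (intro AE_I2 tendsto_intros lim1)
    show "AE y in lborel. norm (cnj (f y) * (\<integral>z. f (y + d k *\<^sub>R z) * gauss z \<partial>lborel)) \<le>
          norm (f y) * (B * (\<integral>z. gauss (z::'a) \<partial>lborel))" for k
    proof (rule AE_I2)
      fix y
      have "norm (\<integral>z. f (y + d k *\<^sub>R z) * gauss z \<partial>lborel) \<le> (\<integral>z. norm (f (y + d k *\<^sub>R z) * gauss z) \<partial>lborel)"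
        by (rule integral_norm_bound)
      also have "\<dots> \<le> (\<integral>z. B * gauss (z::'a) \<partial>lborel)"
      proof (rule Bochner_Integration.integral_mono_AE')
        show "integrable lborel (\<lambda>z::'a. B * gauss z)" using gauss_fourier(1)[where 'a='a] by simp
        show "AE z in lborel. norm (f (y + d k *\<^sub>R z) * complex_of_real (gauss z)) \<le> B * gauss z"
          by (intro AE_I2) (auto simp: norm_mult intro!: mult_right_mono B less_imp_le[OF gauss_pos])
        show "AE z in lborel. 0 \<le> B * gauss (z::'a)"
          using B0 by (simp add: less_imp_le[OF gauss_pos])
      qed
      finally have *: "norm (\<integral>z. f (y + d k *\<^sub>R z) * gauss z \<partial>lborel) \<le> B * (\<integral>z. gauss (z::'a) \<partial>lborel)"
        by simp
      show "norm (cnj (f y) * (\<integral>z. f (y + d k *\<^sub>R z) * gauss z \<partial>lborel)) \<le>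
          norm (f y) * (B * (\<integral>z. gauss (z::'a) \<partial>lborel))"
        unfolding norm_mult complex_mod_cnj by (rule mult_left_mono[OF *]) simp
    qed
    show "integrable lborel (\<lambda>y. norm (f y) * (B * (\<integral>z. gauss (z::'a) \<partial>lborel)))"
      using f by (intro integrable_mult_left integrable_norm)
  qed auto
  have eqL: "(\<integral>y. cnj (f y) * (\<integral>z. f y * gauss (z::'a) \<partial>lborel) \<partial>lborel) = complex_of_real (\<integral>x. (norm (f x))\<^sup>2 \<partial>lborel) * ?c"
  proof -
    have e: "cnj (f y) * (\<integral>z. f y * gauss (z::'a) \<partial>lborel) = complex_of_real ((norm (f y))\<^sup>2) * ?c" for y
    proof -
      have "complex_of_real ((norm (f y))\<^sup>2) = f y * cnj (f y)"
        by (rule complex_norm_square)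
      then show ?thesis unfolding integral_mult_right_zero gm by (simp only: mult_ac)
    qed
    show ?thesis unfolding e integral_mult_left_zero integral_complex_of_real ..
  qed
  have "(\<lambda>k. complex_of_real (?J k)) \<longlonglongrightarrow> ?c * (complex_of_real (\<integral>x. (norm (f x))\<^sup>2 \<partial>lborel) * ?c)"
    unfolding fourier_gauss_mass(2)[OF f d] eqL[symmetric] by (rule tendsto_mult[OF tendsto_const lim2])
  also have "?c * (complex_of_real (\<integral>x. (norm (f x))\<^sup>2 \<partial>lborel) * ?c) = complex_of_real ((2 * pi) ^ DIM('a) * (\<integral>x. (norm (f x))\<^sup>2 \<partial>lborel))"
  proof -
    have "sqrt (2 * pi) ^ DIM('a) * sqrt (2 * pi) ^ DIM('a) = (2 * pi) ^ DIM('a)"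
      unfolding power_mult_distrib[symmetric] by simp
    then have *: "?c * ?c = complex_of_real ((2 * pi) ^ DIM('a))" unfolding of_real_mult[symmetric] by (rule arg_cong)
    have "?c * (u * ?c) = (?c * ?c) * u" for u by (simp only: mult_ac)
    then show ?thesis unfolding * of_real_mult[of "(2 * pi) ^ DIM('a)"] .
  qed
  finally have "?J \<longlonglongrightarrow> (2 * pi) ^ DIM('a) * (\<integral>x. (norm (f x))\<^sup>2 \<partial>lborel)"
    by (simp only: tendsto_of_real_iff)
  then have L1: "(\<lambda>k. ennreal (?J k)) \<longlonglongrightarrow> ennreal ((2 * pi) ^ DIM('a) * (\<integral>x. (norm (f x))\<^sup>2 \<partial>lborel))"
    by (rule tendsto_ennrealI)
  have nn: "ennreal (?J k) = (\<integral>\<^sup>+\<xi>. ennreal (gauss (d k *\<^sub>R \<xi>) * (norm (fourier f \<xi>))\<^sup>2) \<partial>lborel)" for k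
    by (rule nn_integral_eq_integral[symmetric, OF fourier_gauss_mass(1)[OF f d]])
       (auto intro!: mult_nonneg_nonneg less_imp_le[OF gauss_pos])
  \<comment> \<open>The weights increase to 1. Monotone convergence identifies the limit with the
    unweighted integral without knowing beforehand that the latter is finite.\<close>
  have "(\<lambda>k. \<integral>\<^sup>+\<xi>. ennreal (gauss (d k *\<^sub>R \<xi>) * (norm (fourier f \<xi>))\<^sup>2) \<partial>lborel)
     \<longlonglongrightarrow> (\<integral>\<^sup>+\<xi>. ennreal ((norm (fourier f \<xi>))\<^sup>2) \<partial>lborel)"
  proof (rule nn_integral_LIMSEQ)
    show "mono (\<lambda>k \<xi>. ennreal (gauss (d k *\<^sub>R \<xi>) * (norm (fourier f \<xi>))\<^sup>2))"
    proof (rule monoI, rule le_funI)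
      fix m n :: nat and \<xi> :: 'a assume "m \<le> n"
      then have "d n \<le> d m" by (simp add: d_def)
      then have "norm (d n *\<^sub>R \<xi>) \<le> norm (d m *\<^sub>R \<xi>)"
        using d[of m] d[of n] by (simp add: mult_right_mono)
      then have "(norm (d n *\<^sub>R \<xi>))\<^sup>2 \<le> (norm (d m *\<^sub>R \<xi>))\<^sup>2" by (rule power_mono) simp
      then have "gauss (d m *\<^sub>R \<xi>) \<le> gauss (d n *\<^sub>R \<xi>)" unfolding gauss_def by simp
      then show "ennreal (gauss (d m *\<^sub>R \<xi>) * (norm (fourier f \<xi>))\<^sup>2) \<le> ennreal (gauss (d n *\<^sub>R \<xi>) * (norm (fourier f \<xi>))\<^sup>2)"
        by (intro ennreal_leI mult_right_mono) auto
    qed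
    show "(\<lambda>k. ennreal (gauss (d k *\<^sub>R \<xi>) * (norm (fourier f \<xi>))\<^sup>2)) \<longlonglongrightarrow> ennreal ((norm (fourier f \<xi>))\<^sup>2)" for \<xi>
    proof -
      have "(\<lambda>k. exp (- (norm (d k *\<^sub>R \<xi>))\<^sup>2 / 2) * (norm (fourier f \<xi>))\<^sup>2) \<longlonglongrightarrow> exp (- (norm (0 *\<^sub>R \<xi>))\<^sup>2 / 2) * (norm (fourier f \<xi>))\<^sup>2"
        by (intro tendsto_intros d0)  simp
      then show ?thesis unfolding gauss_def by (intro tendsto_ennrealI) simp
    qed
  qed simp
  with L1 show ?thesis unfolding nn by (rule LIMSEQ_unique[rotated])
qed

section \<open>Truncated directional Hilbert transforms and their multipliers\<close>

text \<open>The strict inequality matches the truncation in \<open>directional_Hilbert\<close>, and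
  it makes the kernel continuous from the right in \<open>\<epsilon>\<close> at every
  \<open>t\<close>.\<close>

definition tail_kernel :: "real \<Rightarrow> real \<Rightarrow> real" where
  "tail_kernel \<epsilon> t = (if \<epsilon> < \<bar>t\<bar> then 1 / t else 0)"

definition tail_hilbert :: "'a::euclidean_space \<Rightarrow> real \<Rightarrow> ('a \<Rightarrow> complex) \<Rightarrow> 'a \<Rightarrow> complex" where
  "tail_hilbert e \<epsilon> f x = (\<integral>t. tail_kernel \<epsilon> t *\<^sub>R f (x - t *\<^sub>R e) \<partial>lborel)"

text \<open>For \<open>0 < a\<close> and \<open>a \<le> b\<close> the kernel is bounded and lives on
  \<open>a < \<bar>t\<bar> \<le> b\<close>. So it is integrable, unlike the tail kernel, and it
  moves supports by a bounded amount.\<close>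

definition band_hilbert :: "'a::euclidean_space \<Rightarrow> real \<Rightarrow> real \<Rightarrow> ('a \<Rightarrow> complex) \<Rightarrow> 'a \<Rightarrow> complex" where
  "band_hilbert e a b f x = (\<integral>t. (tail_kernel a t - tail_kernel b t) *\<^sub>R f (x - t *\<^sub>R e) \<partial>lborel)"

definition sq_norm :: "('a::euclidean_space \<Rightarrow> complex) \<Rightarrow> ennreal" where
  "sq_norm f = (\<integral>\<^sup>+x. ennreal ((norm (f x))\<^sup>2) \<partial>lborel)"

lemma tail_kernel_measurable [measurable]: "tail_kernel \<epsilon> \<in> borel_measurable borel"
  unfolding tail_kernel_def by measurable

lemma tail_kernel_diff:
  assumes "a \<le> b"
  shows "tail_kernel a t - tail_kernel b t = (if a < \<bar>t\<bar> \<and> \<bar>t\<bar> \<le> b then 1 / t else 0)"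
  using assms by (auto simp: tail_kernel_def)

lemma tail_kernel_uminus: "tail_kernel \<epsilon> (- t) = - tail_kernel \<epsilon> t"
  by (simp add: tail_kernel_def)

lemma tail_kernel_diff_integrable:
  assumes "0 < a" "a \<le> b"
  shows "integrable lborel (\<lambda>t. tail_kernel a t - tail_kernel b t)"
proof -
  have "integrable lborel (\<lambda>t::real. (1 / a) * indicator {-b..b} t)"
    using assms by (intro integrable_mult_right) (auto simp: integrable_indicator_iff emeasure_lborel_Icc_eq)
  then show ?thesis
  proof (rule Bochner_Integration.integrable_bound)
    have "\<bar>1 / t\<bar> \<le> 1 / a" if "a < \<bar>t\<bar>" for t
      using that assms(1) unfolding abs_divide by (intro frac_le) auto
    then show "AE t in lborel. norm (tail_kernel a t - tail_kernel b t) \<le> norm (1 / a * indicator {-b..b} t)"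
      unfolding tail_kernel_diff[OF assms(2)] using assms
      by (intro AE_I2) (auto simp: indicator_def simp del: abs_divide)
  qed measurable
qed

lemma tail_kernel_diff_integral: "(\<integral>t. tail_kernel a t - tail_kernel b t \<partial>lborel) = 0"
proof -
  have "(\<integral>t. tail_kernel a t - tail_kernel b t \<partial>lborel) = (\<integral>t. - (tail_kernel a t - tail_kernel b t) \<partial>lborel)"
    by (subst lborel_integral_real_affine[where c="-1" and t=0]) (auto simp: tail_kernel_uminus)
  then show ?thesis by (simp only: Bochner_Integration.integral_minus)
qed

lemma integrable_scaleR_bounded:
  fixes f :: "'a \<Rightarrow> 'b::{banach,second_countable_topology}"
  assumes k: "integrable M k" and [measurable]: "f \<in> borel_measurable M" and B: "\<And>x. norm (f x) \<le> B"
  shows "integrable M (\<lambda>x. k x *\<^sub>R f x)"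
proof -
  have B0: "0 \<le> B" using B[of undefined] norm_ge_zero order_trans by blast
  have "integrable M (\<lambda>x. \<bar>k x\<bar> * B)" using k by auto
  then show ?thesis
  proof (rule Bochner_Integration.integrable_bound)
    show "(\<lambda>x. k x *\<^sub>R f x) \<in> borel_measurable M" using k by measurable
    show "AE x in M. norm (k x *\<^sub>R f x) \<le> norm (\<bar>k x\<bar> * B)"
      using B B0 by (intro AE_I2) (auto simp: abs_mult intro!: mult_left_mono)
  qed
qed

section \<open>Closure properties of the test functions\<close>

lemma test_fnI:
  fixes f :: "'a::euclidean_space \<Rightarrow> complex"
  assumes "0 \<le> L" "\<And>x y. norm (f x - f y) \<le> L * norm (x - y)" "\<And>x. r < norm x \<Longrightarrow> f x = 0"
  shows "test_fn f"
  unfolding test_fn_def using assms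
  by (auto simp: lipschitz_on_def dist_norm)

lemma test_fnE:
  fixes f :: "'a::euclidean_space \<Rightarrow> complex"
  assumes "test_fn f"
  obtains L r B where "0 \<le> L" "0 < r" "0 \<le> B" "\<And>x y. norm (f x - f y) \<le> L * norm (x - y)"
    "\<And>x. r < norm x \<Longrightarrow> f x = 0" "\<And>x. norm (f x) \<le> B"
proof -
  obtain L where L: "L-lipschitz_on UNIV f" using assms unfolding test_fn_def by blast
  obtain B r where Br: "0 \<le> B" "0 < r" "\<And>x. norm (f x) \<le> B * indicator (cball 0 r) x"
    using test_fn_bound[OF assms] by blast
  show thesis
  proof (rule that[of L r B])
    show "0 \<le> L" using L by (rule lipschitz_on_nonneg)
    show "norm (f x - f y) \<le> L * norm (x - y)" for x y
      using lipschitz_onD[OF L, of x y] by (simp add: dist_norm)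
    show "f x = 0" if "r < norm x" for x using Br(3)[of x] that by (simp add: indicator_def)
    show "norm (f x) \<le> B" for x using Br(1) Br(3)[of x] by (cases "x \<in> cball 0 r") auto
  qed (use Br in auto)
qed

lemma test_fn_diff:
  fixes f g :: "'a::euclidean_space \<Rightarrow> complex"
  assumes "test_fn f" "test_fn g"
  shows "test_fn (\<lambda>x. f x - g x)"
proof -
  obtain L r B where f: "0 \<le> L" "0 < r" "\<And>x y. norm (f x - f y) \<le> L * norm (x - y)" "\<And>x. r < norm x \<Longrightarrow> f x = 0"
    using test_fnE[OF assms(1)] by metis
  obtain L' r' B' where g: "0 \<le> L'" "0 < r'" "\<And>x y. norm (g x - g y) \<le> L' * norm (x - y)" "\<And>x. r' < norm x \<Longrightarrow> g x = 0"
    using test_fnE[OF assms(2)] by metis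
  show ?thesis
  proof (rule test_fnI[of "L + L'" _ "max r r'"])
    fix x y
    have "norm (f x - g x - (f y - g y)) \<le> norm (f x - f y) + norm (g x - g y)" by norm
    also have "\<dots> \<le> (L + L') * norm (x - y)" using f(3)[of x y] g(3)[of x y] by (simp add: algebra_simps)
    finally show "norm (f x - g x - (f y - g y)) \<le> (L + L') * norm (x - y)" .
  qed (use f g in auto)
qed

lemma test_fn_cmult:
  fixes f :: "'a::euclidean_space \<Rightarrow> complex"
  assumes "test_fn f"
  shows "test_fn (\<lambda>x. c * f x)"
proof -
  obtain L r B where f: "0 \<le> L" "0 < r" "\<And>x y. norm (f x - f y) \<le> L * norm (x - y)" "\<And>x. r < norm x \<Longrightarrow> f x = 0"
    using test_fnE[OF assms(1)] by metis
  show ?thesis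
  proof (rule test_fnI[of "norm c * L" _ r])
    fix x y
    have "norm (c * f x - c * f y) = norm c * norm (f x - f y)" by (simp flip: norm_mult right_diff_distrib)
    also have "\<dots> \<le> norm c * (L * norm (x - y))" by (intro mult_left_mono f) auto
    finally show "norm (c * f x - c * f y) \<le> norm c * L * norm (x - y)" by simp
  qed (use f in auto)
qed

lemma test_fn_zero: "test_fn (\<lambda>x. 0)"
  by (rule test_fnI[of 0 _ 0]) auto

lemma test_fn_add:
  assumes "test_fn f" "test_fn g"
  shows "test_fn (\<lambda>x. f x + g x)"
  using test_fn_diff[OF assms(1) test_fn_cmult[OF assms(2), of "-1"]] by simp

text \<open>The Lipschitz constant is multiplied by the L^1 norm of the kernel, and the radius of
  the support grows by \<open>b * norm e\<close>. This closure is what lets Plancherel be applied to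
  the transform itself.\<close>

lemma band_hilbert_test_fn:
  fixes f :: "'a::euclidean_space \<Rightarrow> complex"
  assumes f: "test_fn f" and ab: "0 < a" "a \<le> b"
  shows "test_fn (band_hilbert e a b f)"
proof -
  obtain L r B where *: "0 \<le> L" "0 < r" "0 \<le> B" "\<And>x y. norm (f x - f y) \<le> L * norm (x - y)"
    "\<And>x. r < norm x \<Longrightarrow> f x = 0" "\<And>x. norm (f x) \<le> B"
    using test_fnE[OF f] by metis
  have [measurable]: "f \<in> borel_measurable borel" by (rule test_fn_measurable[OF f])
  note k = tail_kernel_diff_integrable[OF ab]
  have i: "integrable lborel (\<lambda>t. (tail_kernel a t - tail_kernel b t) *\<^sub>R f (x - t *\<^sub>R e))" for x
    by (rule integrable_scaleR_bounded[OF k _ *(6)]) measurable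
  let ?K = "\<integral>t. \<bar>tail_kernel a t - tail_kernel b t\<bar> \<partial>lborel"
  show ?thesis
  proof (rule test_fnI[of "?K * L" _ "r + b * norm e"])
    show "0 \<le> ?K * L" using *(1) by simp
    fix x y
    have "norm (band_hilbert e a b f x - band_hilbert e a b f y) = norm (\<integral>t. (tail_kernel a t - tail_kernel b t) *\<^sub>R (f (x - t *\<^sub>R e) - f (y - t *\<^sub>R e)) \<partial>lborel)"
      unfolding band_hilbert_def by (subst Bochner_Integration.integral_diff[OF i i, symmetric]) (simp add: scaleR_diff_right)
    also have "\<dots> \<le> (\<integral>t. norm ((tail_kernel a t - tail_kernel b t) *\<^sub>R (f (x - t *\<^sub>R e) - f (y - t *\<^sub>R e))) \<partial>lborel)"
      by (rule integral_norm_bound)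
    also have "\<dots> \<le> (\<integral>t. \<bar>tail_kernel a t - tail_kernel b t\<bar> * (L * norm (x - y)) \<partial>lborel)"
    proof (rule integral_mono')
      show "integrable lborel (\<lambda>t. \<bar>tail_kernel a t - tail_kernel b t\<bar> * (L * norm (x - y)))" using k by (intro integrable_mult_left integrable_abs)
      show "norm ((tail_kernel a t - tail_kernel b t) *\<^sub>R (f (x - t *\<^sub>R e) - f (y - t *\<^sub>R e))) \<le> \<bar>tail_kernel a t - tail_kernel b t\<bar> * (L * norm (x - y))" for t
        using *(4)[of "x - t *\<^sub>R e" "y - t *\<^sub>R e"] by (auto intro!: mult_left_mono)
    qed (use *(1) in auto)
    also have "\<dots> = ?K * L * norm (x - y)" by simp
    finally show "norm (band_hilbert e a b f x - band_hilbert e a b f y) \<le> ?K * L * norm (x - y)" .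
  next
    fix x :: 'a assume x: "r + b * norm e < norm x"
    have z: "(tail_kernel a t - tail_kernel b t) *\<^sub>R f (x - t *\<^sub>R e) = 0" for t
    proof (cases "\<bar>t\<bar> \<le> b")
      case True
      then have "norm (t *\<^sub>R e) \<le> b * norm e" by (simp add: mult_right_mono)
      moreover have "norm x \<le> norm (x - t *\<^sub>R e) + norm (t *\<^sub>R e)"
        using norm_triangle_ineq[of "x - t *\<^sub>R e" "t *\<^sub>R e"] by simp
      ultimately show ?thesis using x *(5) by simp
    qed (auto simp: tail_kernel_diff[OF ab(2)])
    show "band_hilbert e a b f x = 0" unfolding band_hilbert_def z by simp
  qed
qed

section \<open>The multiplier of a band and the sine integral\<close>

definition band_multiplier :: "real \<Rightarrow> real \<Rightarrow> real \<Rightarrow> complex" where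
  "band_multiplier a b \<tau> = (\<integral>t. (tail_kernel a t - tail_kernel b t) *\<^sub>R cis (- (t * \<tau>)) \<partial>lborel)"

lemma integral_translate:
  fixes h :: "'a::euclidean_space \<Rightarrow> 'b::{banach,second_countable_topology}"
  assumes "h \<in> borel_measurable borel"
  shows "(\<integral>x. h (x - s) \<partial>lborel) = (\<integral>x. h x \<partial>lborel)"
  using integral_affine[OF assms, of 1 "- s"] by simp

text \<open>Translation by \<open>t *\<^sub>R e\<close> multiplies the Fourier transform by
  \<open>cis (- (t * (\<xi> \<bullet> e)))\<close>, so the multiplier sees \<open>\<xi>\<close> only
  through \<open>\<xi> \<bullet> e\<close>.\<close>

lemma fourier_band_hilbert:
  fixes f :: "'a::euclidean_space \<Rightarrow> complex"
  assumes f: "test_fn f" and ab: "0 < a" "a \<le> b"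
  shows "fourier (band_hilbert e a b f) \<xi> = band_multiplier a b (\<xi> \<bullet> e) * fourier f \<xi>"
proof -
  have [measurable]: "f \<in> borel_measurable borel" by (rule test_fn_measurable[OF f])
  note k = tail_kernel_diff_integrable[OF ab]
  have fi: "integrable lborel (\<lambda>x. f (x - s))" for s
    using integrable_affine[OF test_fn_integrable[OF f], of 1 "- s"] by simp
  have int: "integrable (lborel \<Otimes>\<^sub>M lborel) (\<lambda>(t, x). (tail_kernel a t - tail_kernel b t) *\<^sub>R (f (x - t *\<^sub>R e) * cis (- (x \<bullet> \<xi>))))"
  proof (rule lborel_pair.Fubini_integrable)
    have "(\<integral>x. norm (f (x - t *\<^sub>R e)) \<partial>lborel) = (\<integral>x. norm (f x) \<partial>lborel)" for t
      by (rule integral_translate) measurable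
    then show "integrable lborel (\<lambda>t. \<integral>x. norm (case (t, x) of (t, x) \<Rightarrow> (tail_kernel a t - tail_kernel b t) *\<^sub>R (f (x - t *\<^sub>R e) * cis (- (x \<bullet> \<xi>)))) \<partial>lborel)"
      using k by (simp add: norm_mult)
    show "AE t in lborel. integrable lborel (\<lambda>x. case (t, x) of (t, x) \<Rightarrow> (tail_kernel a t - tail_kernel b t) *\<^sub>R (f (x - t *\<^sub>R e) * cis (- (x \<bullet> \<xi>))))"
      by (intro AE_I2) (auto intro!: integrable_scaleR_right integrable_cis fi)
  qed measurable
  have "fourier (band_hilbert e a b f) \<xi> = (\<integral>x. (\<integral>t. (tail_kernel a t - tail_kernel b t) *\<^sub>R (f (x - t *\<^sub>R e) * cis (- (x \<bullet> \<xi>))) \<partial>lborel) \<partial>lborel)"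
    unfolding fourier_def band_hilbert_def integral_mult_left_zero[symmetric] by simp
  also have "\<dots> = (\<integral>t. (\<integral>x. (tail_kernel a t - tail_kernel b t) *\<^sub>R (f (x - t *\<^sub>R e) * cis (- (x \<bullet> \<xi>))) \<partial>lborel) \<partial>lborel)"
    by (rule lborel_pair.Fubini_integral[OF int])
  also have "\<dots> = (\<integral>t. ((tail_kernel a t - tail_kernel b t) *\<^sub>R cis (- (t * (\<xi> \<bullet> e)))) * fourier f \<xi> \<partial>lborel)"
  proof (rule Bochner_Integration.integral_cong[OF refl])
    fix t
    have e: "f (x - t *\<^sub>R e) * cis (- (x \<bullet> \<xi>)) = cis (- (t * (\<xi> \<bullet> e))) * (f (x - t *\<^sub>R e) * cis (- ((x - t *\<^sub>R e) \<bullet> \<xi>)))" for x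
    proof -
      have "cis (- (x \<bullet> \<xi>)) = cis (- (t * (\<xi> \<bullet> e))) * cis (- ((x - t *\<^sub>R e) \<bullet> \<xi>))"
        unfolding cis_mult by (rule arg_cong[of _ _ cis]) (simp add: inner_diff_left inner_commute[of e \<xi>])
      then show ?thesis by (simp only: mult_ac)
    qed
    have "(\<integral>x. f (x - t *\<^sub>R e) * cis (- ((x - t *\<^sub>R e) \<bullet> \<xi>)) \<partial>lborel) = fourier f \<xi>"
      unfolding fourier_def by (rule integral_translate) measurable
    then show "(\<integral>x. (tail_kernel a t - tail_kernel b t) *\<^sub>R (f (x - t *\<^sub>R e) * cis (- (x \<bullet> \<xi>))) \<partial>lborel) = ((tail_kernel a t - tail_kernel b t) *\<^sub>R cis (- (t * (\<xi> \<bullet> e)))) * fourier f \<xi>"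
      unfolding integral_scaleR_right e integral_mult_right_zero by simp
  qed
  also have "\<dots> = band_multiplier a b (\<xi> \<bullet> e) * fourier f \<xi>"
    unfolding band_multiplier_def integral_mult_left_zero ..
  finally show ?thesis .
qed

text \<open>Against an odd kernel only the sine part of the character survives. Both half-lines
  contribute equally, whence the factor 2, and scaling by \<open>\<bar>\<tau>\<bar>\<close> turns
  the remaining integral into values of \<open>Si\<close>.\<close>

lemma band_multiplier_eq_Si:
  assumes ab: "0 < a" "a \<le> b"
  shows "band_multiplier a b \<tau> = - (2 * \<i> * complex_of_real (sgn \<tau> * (Si (b * \<bar>\<tau>\<bar>) - Si (a * \<bar>\<tau>\<bar>))))"
proof -
  note k = tail_kernel_diff_integrable[OF ab]
  have i: "complex_integrable lborel (\<lambda>t. (tail_kernel a t - tail_kernel b t) *\<^sub>R cis (g t))" if "g \<in> borel_measurable borel" for g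
    by (rule integrable_scaleR_bounded[OF k, where B=1]) (use that in auto)
  have "band_multiplier a b \<tau> = (\<integral>t. (tail_kernel a (- t) - tail_kernel b (- t)) *\<^sub>R cis (- (- t * \<tau>)) \<partial>lborel)"
    unfolding band_multiplier_def by (subst lborel_integral_real_affine[where c="-1" and t=0]) auto
  also have "\<dots> = (\<integral>t. - ((tail_kernel a t - tail_kernel b t) *\<^sub>R cis (t * \<tau>)) \<partial>lborel)"
    by (intro Bochner_Integration.integral_cong refl) (simp add: tail_kernel_uminus algebra_simps)
  finally have m2: "band_multiplier a b \<tau> = - (\<integral>t. (tail_kernel a t - tail_kernel b t) *\<^sub>R cis (t * \<tau>) \<partial>lborel)" by simp
  have "2 * band_multiplier a b \<tau> = (\<integral>t. (tail_kernel a t - tail_kernel b t) *\<^sub>R cis (- (t * \<tau>)) \<partial>lborel) - (\<integral>t. (tail_kernel a t - tail_kernel b t) *\<^sub>R cis (t * \<tau>) \<partial>lborel)"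
    using m2 unfolding band_multiplier_def by simp
  also have "\<dots> = (\<integral>t. (tail_kernel a t - tail_kernel b t) *\<^sub>R cis (- (t * \<tau>)) - (tail_kernel a t - tail_kernel b t) *\<^sub>R cis (t * \<tau>) \<partial>lborel)"
    by (rule Bochner_Integration.integral_diff[OF i i, symmetric]) measurable
  also have "\<dots> = (\<integral>t. - (2 * \<i>) * complex_of_real ((tail_kernel a t - tail_kernel b t) * sin (t * \<tau>)) \<partial>lborel)"
    by (intro Bochner_Integration.integral_cong refl) (simp add: complex_eq_iff)
  also have "\<dots> = - (2 * \<i>) * complex_of_real (\<integral>t. (tail_kernel a t - tail_kernel b t) * sin (t * \<tau>) \<partial>lborel)"
    unfolding integral_mult_right_zero integral_complex_of_real ..
  finally have m3: "band_multiplier a b \<tau> = - \<i> * complex_of_real (\<integral>t. (tail_kernel a t - tail_kernel b t) * sin (t * \<tau>) \<partial>lborel)" by simp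
  define q where "q t = (tail_kernel a t - tail_kernel b t) * sin (t * \<tau>)" for t
  have [measurable]: "q \<in> borel_measurable borel" unfolding q_def by measurable
  have qi: "integrable lborel q"
    using integrable_scaleR_bounded[OF k, of "\<lambda>t. sin (t * \<tau>)" 1] unfolding q_def by simp
  have ii: "integrable lborel (\<lambda>t. indicator A t * q t)" if "A \<in> sets borel" for A :: "real set"
    using integrable_mult_indicator[OF _ qi, of A] that by simp
  have q0: "q t = indicator {0<..} t * q t + indicator {..<0} t * q t" for t
    using ab by (cases t "0::real" rule: linorder_cases) (auto simp: q_def tail_kernel_def)
  have neg: "(\<integral>t. indicator {..<0} t * q t \<partial>lborel) = (\<integral>t. indicator {0<..} t * q t \<partial>lborel)"
    by (subst lborel_integral_real_affine[where c="-1" and t=0])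
       (auto simp: q_def tail_kernel_uminus indicator_def algebra_simps intro!: Bochner_Integration.integral_cong)
  have "(\<integral>t. q t \<partial>lborel) = (\<integral>t. indicator {0<..} t * q t + indicator {..<0} t * q t \<partial>lborel)"
    using q0 by (intro Bochner_Integration.integral_cong) auto
  also have "\<dots> = 2 * (\<integral>t. indicator {0<..} t * q t \<partial>lborel)"
    by (subst Bochner_Integration.integral_add[OF ii ii]) (auto simp: neg)
  also have "(\<integral>t. indicator {0<..} t * q t \<partial>lborel) = (LBINT t:{a<..b}. sin (t * \<tau>) / t)"
    unfolding set_lebesgue_integral_def q_def tail_kernel_diff[OF ab(2)]
    using ab by (intro Bochner_Integration.integral_cong) (auto simp: indicator_def)
  also have "\<dots> = (LBINT t=a..b. sin (t * \<tau>) / t)"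
    using ab by (simp add: interval_integral_Ioc)
  also have "\<dots> = (LBINT t=0..b. sin (t * \<tau>) / t) - (LBINT t=0..a. sin (t * \<tau>) / t)"
  proof -
    have "(LBINT t=ereal 0..ereal a. sin (t * \<tau>) / t) + (LBINT t=ereal a..ereal b. sin (t * \<tau>) / t) = (LBINT t=ereal 0..ereal b. sin (t * \<tau>) / t)"
      using ab by (intro interval_integral_sum) (simp add: integrable_sinc' min_def max_def)
    then show ?thesis by (simp add: zero_ereal_def)
  qed
  also have "\<dots> = sgn \<tau> * (Si (b * \<bar>\<tau>\<bar>) - Si (a * \<bar>\<tau>\<bar>))"
    using ab by (simp add: LBINT_I0c_sin_scale_divide right_diff_distrib)
  finally show ?thesis unfolding m3 q_def by simp
qed

text \<open>Uniformity in \<open>a\<close> and \<open>b\<close> is the point: all L^2 bounds for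
  truncations inherit their constant from here.\<close>

lemma band_multiplier_bounded: "\<exists>B\<ge>0. \<forall>a b \<tau>. 0 < a \<longrightarrow> a \<le> b \<longrightarrow> norm (band_multiplier a b \<tau>) \<le> B"
proof -
  obtain B where B: "\<And>T. \<bar>Si T\<bar> \<le> B" using bounded_Si by blast
  have "norm (band_multiplier a b \<tau>) \<le> 4 * B" if "0 < a" "a \<le> b" for a b \<tau>
  proof -
    have "norm (band_multiplier a b \<tau>) = 2 * (\<bar>sgn \<tau>\<bar> * \<bar>Si (b * \<bar>\<tau>\<bar>) - Si (a * \<bar>\<tau>\<bar>)\<bar>)"
      unfolding band_multiplier_eq_Si[OF that] norm_minus_cancel norm_mult norm_of_real abs_mult by simp
    also have "\<dots> \<le> 2 * (1 * (B + B))"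
      using B[of "b * \<bar>\<tau>\<bar>"] B[of "a * \<bar>\<tau>\<bar>"] by (intro mult_left_mono mult_mono) (auto simp: abs_sgn_eq)
    finally show ?thesis by simp
  qed
  moreover have "0 \<le> 4 * B" using B[of 0] by simp
  ultimately show ?thesis by blast
qed

text \<open>\<open>Si\<close> tends to \<open>pi / 2\<close> at infinity and vanishes at 0. As the
  transforms here carry no factor \<open>1 / pi\<close>, the limit is \<open>pi\<close> times the
  classical multiplier.\<close>

lemma band_multiplier_tendsto:
  "(\<lambda>n. band_multiplier (1 / real (Suc n)) (real (Suc n)) \<tau>) \<longlonglongrightarrow> - (\<i> * pi * complex_of_real (sgn \<tau>))"
proof -
  have n: "0 < 1 / real (Suc n)" "1 / real (Suc n) \<le> real (Suc n)" for n
    by (simp_all add: field_simps)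
  show ?thesis
  proof (cases "\<tau> = 0")
    case True
    then show ?thesis unfolding band_multiplier_eq_Si[OF n] by simp
  next
    case False
    have top: "filterlim (\<lambda>n. real (Suc n) * \<bar>\<tau>\<bar>) at_top sequentially"
      using False by real_asymp
    have "(\<lambda>n. 1 / real (Suc n) * \<bar>\<tau>\<bar>) \<longlonglongrightarrow> 0" by real_asymp
    then have "(\<lambda>n. Si (1 / real (Suc n) * \<bar>\<tau>\<bar>)) \<longlonglongrightarrow> Si 0" by (rule isCont_tendsto_compose[OF isCont_Si])
    moreover have "Si 0 = 0" unfolding Si_def by (simp flip: zero_ereal_def)
    ultimately have "(\<lambda>n. - (2 * \<i> * complex_of_real (sgn \<tau> * (Si (real (Suc n) * \<bar>\<tau>\<bar>) - Si (1 / real (Suc n) * \<bar>\<tau>\<bar>)))))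
      \<longlonglongrightarrow> - (2 * \<i> * complex_of_real (sgn \<tau> * (pi / 2 - 0)))"
      by (intro tendsto_intros filterlim_compose[OF Si_at_top top]) simp
    then show ?thesis unfolding band_multiplier_eq_Si[OF n] by (simp add: mult_ac)
  qed
qed

section \<open>Density of the test functions\<close>

lemma norm_square_add_le: "ennreal ((norm (a + b :: 'a::real_normed_vector))\<^sup>2) \<le> 2 * ennreal ((norm a)\<^sup>2) + 2 * ennreal ((norm b)\<^sup>2)"
proof -
  have "(norm (a + b))\<^sup>2 \<le> (norm a + norm b)\<^sup>2" by (intro power_mono norm_triangle_ineq) simp
  also have "\<dots> \<le> 2 * (norm a)\<^sup>2 + 2 * (norm b)\<^sup>2"
    using sum_squares_bound[of "norm a" "norm b"] by (simp add: power2_sum)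
  finally have "ennreal ((norm (a + b))\<^sup>2) \<le> ennreal (2 * (norm a)\<^sup>2 + 2 * (norm b)\<^sup>2)" by (rule ennreal_leI)
  then show ?thesis by (simp add: ennreal_mult)
qed

lemma sq_norm_add_le:
  fixes f g :: "'a::euclidean_space \<Rightarrow> complex"
  assumes [measurable]: "f \<in> borel_measurable borel" "g \<in> borel_measurable borel"
  shows "sq_norm (\<lambda>x. f x + g x) \<le> 2 * sq_norm f + 2 * sq_norm g"
proof -
  have "sq_norm (\<lambda>x. f x + g x) \<le> (\<integral>\<^sup>+x. 2 * ennreal ((norm (f x))\<^sup>2) + 2 * ennreal ((norm (g x))\<^sup>2) \<partial>lborel)"
    unfolding sq_norm_def by (intro nn_integral_mono norm_square_add_le)
  then show ?thesis unfolding sq_norm_def by (simp add: nn_integral_add nn_integral_cmult)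
qed

lemma sq_norm_uminus: "sq_norm (\<lambda>x. - f x) = sq_norm f" by (simp add: sq_norm_def)

lemma sq_norm_diff_le:
  fixes f g :: "'a::euclidean_space \<Rightarrow> complex"
  assumes [measurable]: "f \<in> borel_measurable borel" "g \<in> borel_measurable borel"
  shows "sq_norm (\<lambda>x. f x - g x) \<le> 2 * sq_norm f + 2 * sq_norm g"
  using sq_norm_add_le[of f "\<lambda>x. - g x"] by (simp add: sq_norm_uminus)

lemma sq_norm_test_fn:
  assumes "test_fn f"
  shows "sq_norm f = ennreal (\<integral>x. (norm (f x))\<^sup>2 \<partial>lborel)"
  unfolding sq_norm_def by (rule nn_integral_eq_integral[OF test_fn_integrable_square[OF assms]]) simp

lemma sq_norm_test_fn_finite: "test_fn f \<Longrightarrow> sq_norm f < \<infinity>"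
  by (simp add: sq_norm_test_fn)

lemma Plancherel_sq_norm:
  fixes f :: "'a::euclidean_space \<Rightarrow> complex"
  assumes "test_fn f"
  shows "(\<integral>\<^sup>+\<xi>. ennreal ((norm (fourier f \<xi>))\<^sup>2) \<partial>lborel) = ennreal ((2 * pi) ^ DIM('a)) * sq_norm f"
  unfolding Plancherel[OF assms] sq_norm_test_fn[OF assms] by (rule ennreal_mult) auto

lemma ennreal_four_quarters:
  assumes "0 \<le> e"
  shows "2 * ennreal (e / 4) + 2 * ennreal (e / 4) = ennreal e"
proof -
  have "2 * ennreal (e / 4) = ennreal (2 * (e / 4))"
    using assms by (subst ennreal_mult) auto
  then show ?thesis using assms by (simp flip: ennreal_plus)
qed

definition approximable :: "('a::euclidean_space \<Rightarrow> complex) \<Rightarrow> bool" where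
  "approximable f \<longleftrightarrow> (\<forall>e>0. \<exists>g. test_fn g \<and> sq_norm (\<lambda>x. f x - g x) \<le> ennreal e)"

lemma approximable_add:
  fixes f g :: "'a::euclidean_space \<Rightarrow> complex"
  assumes "approximable f" "approximable g"
    and [measurable]: "f \<in> borel_measurable borel" "g \<in> borel_measurable borel"
  shows "approximable (\<lambda>x. f x + g x)"
  unfolding approximable_def
proof (intro allI impI)
  fix e :: real assume "0 < e"
  then have "0 < e / 4" by simp
  then obtain u v where u: "test_fn u" "sq_norm (\<lambda>x. f x - u x) \<le> ennreal (e / 4)"
    and v: "test_fn v" "sq_norm (\<lambda>x. g x - v x) \<le> ennreal (e / 4)"
    using assms(1,2) unfolding approximable_def by meson
  have [measurable]: "u \<in> borel_measurable borel" "v \<in> borel_measurable borel"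
    using u v test_fn_measurable by auto
  have "sq_norm (\<lambda>x. f x + g x - (u x + v x)) = sq_norm (\<lambda>x. (f x - u x) + (g x - v x))"
    by (simp add: algebra_simps)
  also have "\<dots> \<le> 2 * sq_norm (\<lambda>x. f x - u x) + 2 * sq_norm (\<lambda>x. g x - v x)" by (rule sq_norm_add_le) auto
  also have "\<dots> \<le> 2 * ennreal (e / 4) + 2 * ennreal (e / 4)"
    by (intro add_mono mult_left_mono u v) auto
  also have "\<dots> = ennreal e" using \<open>0 < e\<close> by (intro ennreal_four_quarters) simp
  finally have "sq_norm (\<lambda>x. f x + g x - (u x + v x)) \<le> ennreal e" .
  then show "\<exists>g'. test_fn g' \<and> sq_norm (\<lambda>x. f x + g x - g' x) \<le> ennreal e"
    using test_fn_add[OF u(1) v(1)] by blast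
qed

lemma approximable_cmult:
  fixes f :: "'a::euclidean_space \<Rightarrow> complex"
  assumes "approximable f" and [measurable]: "f \<in> borel_measurable borel"
  shows "approximable (\<lambda>x. c * f x)"
  unfolding approximable_def
proof (intro allI impI)
  fix e :: real assume "0 < e"
  define k where "k = (norm c)\<^sup>2 + 1"
  have k: "0 < k" "(norm c)\<^sup>2 \<le> k" by (auto simp: k_def add_nonneg_pos)
  then have "0 < e / k" using \<open>0 < e\<close> by simp
  then obtain u where u: "test_fn u" "sq_norm (\<lambda>x. f x - u x) \<le> ennreal (e / k)"
    using assms(1) unfolding approximable_def by meson
  have [measurable]: "u \<in> borel_measurable borel" using u test_fn_measurable by auto
  have "sq_norm (\<lambda>x. c * f x - c * u x) = (\<integral>\<^sup>+x. ennreal ((norm c)\<^sup>2) * ennreal ((norm (f x - u x))\<^sup>2) \<partial>lborel)"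
    unfolding sq_norm_def
    by (intro nn_integral_cong) (simp add: norm_mult power_mult_distrib flip: right_diff_distrib ennreal_mult)
  also have "\<dots> = ennreal ((norm c)\<^sup>2) * sq_norm (\<lambda>x. f x - u x)"
    unfolding sq_norm_def by (rule nn_integral_cmult) measurable
  also have "\<dots> \<le> ennreal k * ennreal (e / k)" by (intro mult_mono u ennreal_leI k) auto
  also have "\<dots> = ennreal e" using k \<open>0 < e\<close> by (simp flip: ennreal_mult)
  finally show "\<exists>g'. test_fn g' \<and> sq_norm (\<lambda>x. c * f x - g' x) \<le> ennreal e"
    using test_fn_cmult[OF u(1)] by blast
qed

lemma approximable_zero: "approximable (\<lambda>x. 0)"
  unfolding approximable_def using test_fn_zero by (auto simp: sq_norm_def)

text \<open>Squeeze \<open>A\<close> between a compact \<open>T\<close> and an open \<open>U\<close>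
  of nearly the same measure. \<open>T\<close> keeps a distance \<open>d > 0\<close> from the
  complement of \<open>U\<close>, so the ramp \<open>1 - infdist x T / d\<close>, cut off at 0, is
  Lipschitz, equals 1 on \<open>T\<close> and vanishes off \<open>U\<close>.\<close>

lemma approximable_indicator_bounded:
  fixes A :: "'a::euclidean_space set"
  assumes A: "A \<in> sets borel" "bounded A"
  shows "approximable (\<lambda>x. indicator A x)"
  unfolding approximable_def
proof (intro allI impI)
  fix e :: real assume e: "0 < e"
  obtain U where U: "open U" "A \<subseteq> U" "emeasure lborel (U - A) < ennreal (e / 2)"
    using outer_regular_lborel[OF A(1), of "e / 2"] e by auto
  have "A \<in> sets lebesgue" using A by simp
  then obtain T where T: "closed T" "T \<subseteq> A" "A - T \<in> lmeasurable" "emeasure lebesgue (A - T) < ennreal (e / 2)"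
    using sets_lebesgue_inner_closed[of A "e / 2"] e by auto
  have cT: "compact T" using T A bounded_subset by (auto simp: compact_eq_bounded_closed)
  have UT: "emeasure lborel (U - T) \<le> ennreal e"
  proof -
    have "emeasure lborel (U - T) \<le> emeasure lborel ((U - A) \<union> (A - T))"
      using A U T by (intro emeasure_mono) auto
    also have "\<dots> \<le> emeasure lborel (U - A) + emeasure lborel (A - T)"
      using A U T by (intro emeasure_subadditive) auto
    also have "emeasure lborel (A - T) = emeasure lebesgue (A - T)"
      using A T by (simp add: emeasure_completion)
    also have "emeasure lborel (U - A) + emeasure lebesgue (A - T) \<le> ennreal (e / 2) + ennreal (e / 2)"
      using U T by (intro add_mono) auto
    also have "\<dots> = ennreal e" using e by (subst ennreal_plus[symmetric]) auto
    finally show ?thesis .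
  qed
  have bound: "sq_norm (\<lambda>x. indicator A x - \<phi> x) \<le> ennreal e"
    if \<phi>: "\<And>x. norm (\<phi> x) \<le> 1" "\<And>x. x \<in> T \<Longrightarrow> \<phi> x = 1" "\<And>x. x \<notin> U \<Longrightarrow> \<phi> x = 0" "\<And>x. \<phi> x = complex_of_real (Re (\<phi> x))" "\<And>x. 0 \<le> Re (\<phi> x)" for \<phi>
  proof -
    have "sq_norm (\<lambda>x. indicator A x - \<phi> x) \<le> (\<integral>\<^sup>+x. indicator (U - T) x \<partial>lborel)"
      unfolding sq_norm_def
    proof (rule nn_integral_mono)
      fix x
      have r: "Re (\<phi> x) \<le> 1" using complex_Re_le_cmod[of "\<phi> x"] \<phi>(1)[of x] by linarith
      have "norm (indicator A x - \<phi> x) = \<bar>indicator A x - Re (\<phi> x)\<bar>"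
      proof -
        have "indicator A x - \<phi> x = complex_of_real (indicator A x - Re (\<phi> x))"
          by (subst \<phi>(4)) (simp add: indicator_def)
        then show ?thesis by (simp only: norm_of_real)
      qed
      then have "norm (indicator A x - \<phi> x) \<le> 1" using r \<phi>(5)[of x] by (simp add: indicator_def)
      then have "(norm (indicator A x - \<phi> x))\<^sup>2 \<le> 1" by (simp add: power_le_one)
      moreover have "x \<in> U - T \<or> indicator A x - \<phi> x = 0" using \<phi>(2,3)[of x] T(2) U(2) by (auto simp: indicator_def)
      ultimately show "ennreal ((norm (indicator A x - \<phi> x))\<^sup>2) \<le> indicator (U - T) x"
        by (auto simp: indicator_def)
    qed
    also have "\<dots> = emeasure lborel (U - T)" using U T by simp
    finally show ?thesis using UT by simp
  qed
  show "\<exists>g. test_fn g \<and> sq_norm (\<lambda>x. indicator A x - g x) \<le> ennreal e"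
  \<comment> \<open>\<open>infdist x {}\<close> is 0 by convention, so for empty \<open>T\<close>
    the ramp would be 1 everywhere; the zero function serves instead.\<close>
  proof (cases "T = {}")
    case True
    then show ?thesis using bound[of "\<lambda>x. 0"] test_fn_zero by auto
  next
    case False
    have "\<exists>d>0. \<forall>x\<in>T. \<forall>y\<in>- U. d \<le> dist x y"
      using cT U T by (intro separate_compact_closed) auto
    then obtain d where d: "0 < d" "\<And>x y. x \<in> T \<Longrightarrow> y \<notin> U \<Longrightarrow> d \<le> dist x y" by auto
    define \<phi> where "\<phi> x = max 0 (1 - infdist x T / d)" for x
    have \<phi>0: "\<phi> x = 0" if "d \<le> infdist x T" for x using that d by (simp add: \<phi>_def)
    obtain B where B: "\<And>x. x \<in> T \<Longrightarrow> norm x \<le> B" using cT compact_imp_bounded bounded_iff by metis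
    have far: "\<phi> x = 0" if "B + d < norm x" for x
    proof (rule \<phi>0)
      obtain y where y: "y \<in> T" "infdist x T = dist x y"
        using infdist_attains_inf[OF T(1) False] by blast
      have "norm x \<le> dist x y + norm y" unfolding dist_norm by norm
      then show "d \<le> infdist x T" using B[OF y(1)] that y by simp
    qed
    have lip: "\<bar>\<phi> x - \<phi> y\<bar> \<le> (1 / d) * norm (x - y)" for x y
    proof -
      have "\<bar>\<phi> x - \<phi> y\<bar> \<le> \<bar>infdist x T / d - infdist y T / d\<bar>" unfolding \<phi>_def by linarith
      also have "\<dots> = \<bar>infdist x T - infdist y T\<bar> / d" using d by (simp flip: diff_divide_distrib)
      also have "\<dots> \<le> dist x y / d" using d infdist_triangle_abs by (intro divide_right_mono) auto
      finally show ?thesis by (simp add: dist_norm)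
    qed
    have "test_fn (\<lambda>x. complex_of_real (\<phi> x))"
    proof (rule test_fnI[of "1 / d" _ "B + d"])
      show "cmod (complex_of_real (\<phi> x) - complex_of_real (\<phi> y)) \<le> 1 / d * norm (x - y)" for x y
        unfolding of_real_diff[symmetric] norm_of_real by (rule lip)
    qed (use d far in auto)
    moreover have "sq_norm (\<lambda>x. indicator A x - complex_of_real (\<phi> x)) \<le> ennreal e"
    proof (rule bound)
      show "cmod (complex_of_real (\<phi> x)) \<le> 1" for x using d infdist_nonneg[of x T] by (simp add: \<phi>_def)
      show "complex_of_real (\<phi> x) = 1" if "x \<in> T" for x using that by (simp add: \<phi>_def)
      show "complex_of_real (\<phi> x) = 0" if "x \<notin> U" for x
      proof -
        obtain y where y: "y \<in> T" "infdist x T = dist x y"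
          using infdist_attains_inf[OF T(1) False] by blast
        then show ?thesis using d(2)[OF y(1) that] \<phi>0[of x] by (simp add: dist_commute)
      qed
    qed (auto simp: \<phi>_def)
    ultimately show ?thesis by blast
  qed
qed

lemma approximable_sum:
  fixes f :: "'i \<Rightarrow> 'a::euclidean_space \<Rightarrow> complex"
  assumes "finite I" "\<And>i. i \<in> I \<Longrightarrow> approximable (f i)" "\<And>i. i \<in> I \<Longrightarrow> f i \<in> borel_measurable borel"
  shows "approximable (\<lambda>x. \<Sum>i\<in>I. f i x)"
  using assms
proof (induction I rule: finite_induct)
  case empty
  then show ?case by (simp add: approximable_zero)
next
  case (insert i I)
  have "approximable (\<lambda>x. f i x + (\<Sum>i\<in>I. f i x))"
    using insert by (intro approximable_add) auto
  then show ?case using insert(1,2) by simp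
qed

text \<open>The factor 2 is the one that comes with the approximation of a measurable function by
  simple functions; it yields the integrable majorant
  \<open>9 * ennreal ((norm (f x))\<^sup>2)\<close>.\<close>

lemma approximable_limit:
  fixes f :: "'a::euclidean_space \<Rightarrow> complex"
  assumes [measurable]: "f \<in> borel_measurable borel" "\<And>n::nat. s n \<in> borel_measurable borel" and f: "sq_norm f < \<infinity>"
    and lim: "\<And>x. (\<lambda>n. s n x) \<longlonglongrightarrow> f x" and bound: "\<And>n x. norm (s n x) \<le> 2 * norm (f x)"
    and appr: "\<And>n. approximable (s n)"
  shows "approximable f"
  unfolding approximable_def
proof (intro allI impI)
  fix e :: real assume e: "0 < e"
  have "(\<lambda>n. \<integral>\<^sup>+x. ennreal ((norm (f x - s n x))\<^sup>2) \<partial>lborel) \<longlonglongrightarrow> (\<integral>\<^sup>+x. 0 \<partial>(lborel :: 'a measure))"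
  proof (rule nn_integral_dominated_convergence[where w="\<lambda>x. 9 * ennreal ((norm (f x))\<^sup>2)"])
    show "(\<integral>\<^sup>+x. 9 * ennreal ((norm (f x))\<^sup>2) \<partial>lborel) < \<infinity>"
      using f unfolding sq_norm_def by (simp add: nn_integral_cmult ennreal_mult_less_top)
    show "AE x in lborel. ennreal ((norm (f x - s n x))\<^sup>2) \<le> 9 * ennreal ((norm (f x))\<^sup>2)" for n
    proof (rule AE_I2)
      fix x
      have "norm (f x - s n x) \<le> norm (f x) + norm (s n x)" by (rule norm_triangle_ineq4)
      also have "\<dots> \<le> 3 * norm (f x)" using bound[of n x] by simp
      finally have "(norm (f x - s n x))\<^sup>2 \<le> (3 * norm (f x))\<^sup>2" by (rule power_mono) simp
      then have "ennreal ((norm (f x - s n x))\<^sup>2) \<le> ennreal (9 * (norm (f x))\<^sup>2)"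
        by (intro ennreal_leI) (simp add: power_mult_distrib)
      then show "ennreal ((norm (f x - s n x))\<^sup>2) \<le> 9 * ennreal ((norm (f x))\<^sup>2)" by (simp add: ennreal_mult)
    qed
    show "AE x in lborel. (\<lambda>n. ennreal ((norm (f x - s n x))\<^sup>2)) \<longlonglongrightarrow> 0"
    proof (rule AE_I2)
      fix x
      have "(\<lambda>n. (norm (f x - s n x))\<^sup>2) \<longlonglongrightarrow> (norm (f x - f x))\<^sup>2" by (intro tendsto_intros lim)
      then show "(\<lambda>n. ennreal ((norm (f x - s n x))\<^sup>2)) \<longlonglongrightarrow> 0"
        using tendsto_ennrealI by fastforce
    qed
  qed measurable
  then have "(\<lambda>n. sq_norm (\<lambda>x. f x - s n x)) \<longlonglongrightarrow> 0" unfolding sq_norm_def by simp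
  then have "eventually (\<lambda>n. sq_norm (\<lambda>x. f x - s n x) < ennreal (e / 4)) sequentially"
    using e by (intro order_tendstoD(2)) auto
  then obtain n where n: "sq_norm (\<lambda>x. f x - s n x) < ennreal (e / 4)"
    using eventually_happens'[OF sequentially_bot] by blast
  have "0 < e / 4" using e by simp
  then obtain u where u: "test_fn u" "sq_norm (\<lambda>x. s n x - u x) \<le> ennreal (e / 4)"
    using appr[of n] unfolding approximable_def by meson
  have [measurable]: "u \<in> borel_measurable borel" using u test_fn_measurable by auto
  have "sq_norm (\<lambda>x. f x - u x) = sq_norm (\<lambda>x. (f x - s n x) + (s n x - u x))" by simp
  also have "\<dots> \<le> 2 * sq_norm (\<lambda>x. f x - s n x) + 2 * sq_norm (\<lambda>x. s n x - u x)" by (rule sq_norm_add_le) auto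
  also have "\<dots> \<le> 2 * ennreal (e / 4) + 2 * ennreal (e / 4)"
    using n u by (intro add_mono mult_left_mono) auto
  also have "\<dots> = ennreal e" using e by (intro ennreal_four_quarters) simp
  finally show "\<exists>g. test_fn g \<and> sq_norm (\<lambda>x. f x - g x) \<le> ennreal e" using u by auto
qed

lemma test_fn_dense:
  fixes f :: "'a::euclidean_space \<Rightarrow> complex"
  assumes [measurable]: "f \<in> borel_measurable borel" and f: "sq_norm f < \<infinity>" and e: "0 < e"
  obtains g where "test_fn g" "sq_norm (\<lambda>x. f x - g x) \<le> ennreal e"
proof -
  have "f \<in> borel_measurable (borel :: 'a measure)" by simp
  from borel_measurable_implies_sequence_metric[OF this, of 0] obtain s where
    s: "\<And>i. simple_function borel (s i)" and lim: "\<And>x. (\<lambda>i. s i x) \<longlonglongrightarrow> f x"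
    and bound: "\<And>i x. norm (s i x) \<le> 2 * norm (f x)"
    by auto
  have [measurable]: "s i \<in> borel_measurable borel" for i using s by (rule borel_measurable_simple_function)
  \<comment> \<open>The cut-off to growing balls makes the level sets bounded, as
    \<open>approximable_indicator_bounded\<close> demands.\<close>
  define s' where "s' i x = indicator (cball 0 (real i)) x * s i x" for i x
  have [measurable]: "cball 0 (real i) \<in> sets (borel :: 'a measure)" for i by simp
  have [measurable]: "s' i \<in> borel_measurable borel" for i unfolding s'_def by measurable
  have "approximable f"
  proof (rule approximable_limit[where s=s'])
    show "(\<lambda>n. s' n x) \<longlonglongrightarrow> f x" for x
    proof (rule Lim_transform_eventually[OF lim])
      obtain N where "norm x \<le> real N" using real_arch_simple by blast
      then have "\<forall>n\<ge>N. s n x = s' n x" by (auto simp: s'_def indicator_def)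
      then show "\<forall>\<^sub>F n in sequentially. s n x = s' n x" unfolding eventually_sequentially by blast
    qed
    show "norm (s' n x) \<le> 2 * norm (f x)" for n x
      using bound[of n x] by (simp add: s'_def indicator_def)
    show "approximable (s' n)" for n
    proof -
      have "s' n x = (\<Sum>y\<in>range (s n). y * indicator (s n -` {y} \<inter> cball 0 (real n)) x)" for x
      proof -
        have 1: "s n x = (\<Sum>y\<in>range (s n). indicator (s n -` {y}) x *\<^sub>R y)"
          by (rule simple_function_indicator_representation_banach[OF s, of x n, unfolded space_borel Int_UNIV_right, OF UNIV_I])
        have "s' n x = indicator (cball 0 (real n)) x * (\<Sum>y\<in>range (s n). indicator (s n -` {y}) x *\<^sub>R y)"
          unfolding s'_def by (rule arg_cong[of _ _ "(*) (indicator (cball 0 (real n)) x)", OF 1])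
        also have "\<dots> = (\<Sum>y\<in>range (s n). y * indicator (s n -` {y} \<inter> cball 0 (real n)) x)"
          unfolding sum_distrib_left by (intro sum.cong refl) (auto simp: indicator_def)
        finally show ?thesis .
      qed
      then have s'n: "s' n = (\<lambda>x. \<Sum>y\<in>range (s n). y * indicator (s n -` {y} \<inter> cball 0 (real n)) x)" by (rule ext)
      show ?thesis unfolding s'n
      proof (rule approximable_sum)
        show "finite (range (s n))" using simple_functionD(1)[OF s, of n] by simp
        fix y
        have [measurable]: "s n -` {y} \<inter> cball 0 (real n) \<in> sets borel"
          using measurable_sets[of "s n" borel borel "{y}"] by simp
        show "approximable (\<lambda>x. y * indicator (s n -` {y} \<inter> cball 0 (real n)) x)"
          by (intro approximable_cmult approximable_indicator_bounded) (auto intro: bounded_subset[OF bounded_cball])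
        show "(\<lambda>x. y * indicator (s n -` {y} \<inter> cball 0 (real n)) x) \<in> borel_measurable borel" by measurable
      qed
    qed
  qed (use f in auto)
  then show thesis using e that unfolding approximable_def by blast
qed

section \<open>Uniform square-integral bounds for the truncations\<close>

lemma tail_hilbert_measurable [measurable]:
  assumes [measurable]: "f \<in> borel_measurable borel"
  shows "tail_hilbert e \<epsilon> f \<in> borel_measurable borel"
  unfolding tail_hilbert_def by measurable

lemma band_hilbert_measurable [measurable]:
  assumes [measurable]: "f \<in> borel_measurable borel"
  shows "band_hilbert e a b f \<in> borel_measurable borel"
  unfolding band_hilbert_def by measurable

text \<open>Plancherel on both sides: the constant is the square of the uniform bound of the
  multiplier.\<close>

lemma sq_norm_band_hilbert_test_fn:
  "\<exists>C\<ge>0. \<forall>(e::'a::euclidean_space) a b f. 0 < a \<longrightarrow> a \<le> b \<longrightarrow> test_fn f \<longrightarrow> sq_norm (band_hilbert e a b f) \<le> ennreal C * sq_norm f"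
proof -
  obtain B where B: "0 \<le> B" "\<And>a b \<tau>. 0 < a \<Longrightarrow> a \<le> b \<Longrightarrow> norm (band_multiplier a b \<tau>) \<le> B"
    using band_multiplier_bounded by blast
  have "sq_norm (band_hilbert e a b f) \<le> ennreal (B\<^sup>2) * sq_norm f" if ab: "0 < a" "a \<le> b" and f: "test_fn f" for e :: 'a and a b f
  proof -
    have [measurable]: "f \<in> borel_measurable borel" using f by (rule test_fn_measurable)
    let ?p = "(2 * pi) ^ DIM('a)"
    have "ennreal ?p * sq_norm (band_hilbert e a b f) = (\<integral>\<^sup>+\<xi>. ennreal ((norm (band_multiplier a b (\<xi> \<bullet> e) * fourier f \<xi>))\<^sup>2) \<partial>lborel)"
      unfolding Plancherel_sq_norm[OF band_hilbert_test_fn[OF f ab], symmetric] fourier_band_hilbert[OF f ab] ..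
    also have "\<dots> \<le> (\<integral>\<^sup>+\<xi>. ennreal (B\<^sup>2) * ennreal ((norm (fourier f \<xi>))\<^sup>2) \<partial>lborel)"
    proof (rule nn_integral_mono)
      fix \<xi>
      have "(norm (band_multiplier a b (\<xi> \<bullet> e)))\<^sup>2 \<le> B\<^sup>2" by (intro power_mono B ab) simp
      then have "(norm (band_multiplier a b (\<xi> \<bullet> e) * fourier f \<xi>))\<^sup>2 \<le> B\<^sup>2 * (norm (fourier f \<xi>))\<^sup>2"
        unfolding norm_mult power_mult_distrib by (rule mult_right_mono) simp
      then show "ennreal ((norm (band_multiplier a b (\<xi> \<bullet> e) * fourier f \<xi>))\<^sup>2) \<le> ennreal (B\<^sup>2) * ennreal ((norm (fourier f \<xi>))\<^sup>2)"
        by (simp flip: ennreal_mult add: ennreal_leI)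
    qed
    also have "\<dots> = ennreal ?p * (ennreal (B\<^sup>2) * sq_norm f)"
      by (subst nn_integral_cmult) (auto simp: Plancherel_sq_norm[OF f] mult_ac)
    finally have "ennreal ?p * sq_norm (band_hilbert e a b f) \<le> ennreal ?p * (ennreal (B\<^sup>2) * sq_norm f)" .
    then show ?thesis by (subst (asm) ennreal_mult_le_mult_iff) auto
  qed
  then show ?thesis by (intro exI[of _ "B\<^sup>2"]) auto
qed

section \<open>The band estimate for general square-integrable functions\<close>

lemma nn_integral_translate:
  fixes h :: "'a::euclidean_space \<Rightarrow> ennreal"
  assumes "h \<in> borel_measurable borel"
  shows "(\<integral>\<^sup>+x. h (x - s) \<partial>lborel) = (\<integral>\<^sup>+x. h x \<partial>lborel)"
  using nn_integral_affine[OF assms, of 1 "- s"] by simp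

text \<open>Cauchy-Schwarz, with \<open>\<bar>k t\<bar>\<close> split into two square roots. The L^1
  norm of a band is \<open>2 * ln (b / a)\<close>, which is unbounded, so this estimate only serves
  to control approximation errors.\<close>

lemma sq_norm_abs_convolution_le:
  fixes h :: "'a::euclidean_space \<Rightarrow> complex"
  assumes [measurable]: "h \<in> borel_measurable borel" and k: "integrable lborel k"
  shows "(\<integral>\<^sup>+x. (\<integral>\<^sup>+t. ennreal (norm (k t *\<^sub>R h (x - t *\<^sub>R e))) \<partial>lborel)\<^sup>2 \<partial>lborel) \<le> (\<integral>\<^sup>+t. ennreal \<bar>k t :: real\<bar> \<partial>lborel)\<^sup>2 * sq_norm h"
proof -
  have [measurable]: "k \<in> borel_measurable borel" using k by simp
  let ?K = "\<integral>\<^sup>+t. ennreal \<bar>k t\<bar> \<partial>lborel"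
  have "(\<integral>\<^sup>+t. ennreal (norm (k t *\<^sub>R h (x - t *\<^sub>R e))) \<partial>lborel)\<^sup>2 \<le> ?K * (\<integral>\<^sup>+t. ennreal \<bar>k t\<bar> * ennreal ((norm (h (x - t *\<^sub>R e)))\<^sup>2) \<partial>lborel)" for x
  proof -
    have "(\<integral>\<^sup>+t. ennreal (norm (k t *\<^sub>R h (x - t *\<^sub>R e))) \<partial>lborel) = (\<integral>\<^sup>+t. ennreal (sqrt \<bar>k t\<bar>) * ennreal (sqrt \<bar>k t\<bar> * norm (h (x - t *\<^sub>R e))) \<partial>lborel)"
      by (intro nn_integral_cong) (simp flip: ennreal_mult mult.assoc)
    also have "\<dots>\<^sup>2 \<le> (\<integral>\<^sup>+t. (ennreal (sqrt \<bar>k t\<bar>))\<^sup>2 \<partial>lborel) * (\<integral>\<^sup>+t. (ennreal (sqrt \<bar>k t\<bar> * norm (h (x - t *\<^sub>R e))))\<^sup>2 \<partial>lborel)"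
      by (rule Cauchy_Schwarz_nn_integral) measurable
    also have "(\<integral>\<^sup>+t. (ennreal (sqrt \<bar>k t\<bar>))\<^sup>2 \<partial>lborel) = ?K"
      by (simp add: ennreal_power)
    also have "(\<integral>\<^sup>+t. (ennreal (sqrt \<bar>k t\<bar> * norm (h (x - t *\<^sub>R e))))\<^sup>2 \<partial>lborel) = (\<integral>\<^sup>+t. ennreal \<bar>k t\<bar> * ennreal ((norm (h (x - t *\<^sub>R e)))\<^sup>2) \<partial>lborel)"
      by (simp add: ennreal_power power_mult_distrib ennreal_mult)
    finally show ?thesis .
  qed
  then have "(\<integral>\<^sup>+x. (\<integral>\<^sup>+t. ennreal (norm (k t *\<^sub>R h (x - t *\<^sub>R e))) \<partial>lborel)\<^sup>2 \<partial>lborel)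
     \<le> (\<integral>\<^sup>+x. ?K * (\<integral>\<^sup>+t. ennreal \<bar>k t\<bar> * ennreal ((norm (h (x - t *\<^sub>R e)))\<^sup>2) \<partial>lborel) \<partial>lborel)"
    by (rule nn_integral_mono)
  also have "\<dots> = ?K * (\<integral>\<^sup>+x. (\<integral>\<^sup>+t. ennreal \<bar>k t\<bar> * ennreal ((norm (h (x - t *\<^sub>R e)))\<^sup>2) \<partial>lborel) \<partial>lborel)"
    by (rule nn_integral_cmult) measurable
  also have "(\<integral>\<^sup>+x. (\<integral>\<^sup>+t. ennreal \<bar>k t\<bar> * ennreal ((norm (h (x - t *\<^sub>R e)))\<^sup>2) \<partial>lborel) \<partial>lborel)
     = (\<integral>\<^sup>+t. (\<integral>\<^sup>+x. ennreal \<bar>k t\<bar> * ennreal ((norm (h (x - t *\<^sub>R e)))\<^sup>2) \<partial>lborel) \<partial>lborel)"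
    by (rule lborel_pair.Fubini') measurable
  also have "\<dots> = (\<integral>\<^sup>+t. ennreal \<bar>k t\<bar> * sq_norm h \<partial>lborel)"
  proof (rule nn_integral_cong)
    fix t
    have "(\<integral>\<^sup>+x. ennreal ((norm (h (x - t *\<^sub>R e)))\<^sup>2) \<partial>lborel) = sq_norm h"
      unfolding sq_norm_def by (rule nn_integral_translate) measurable
    then show "(\<integral>\<^sup>+x. ennreal \<bar>k t\<bar> * ennreal ((norm (h (x - t *\<^sub>R e)))\<^sup>2) \<partial>lborel) = ennreal \<bar>k t\<bar> * sq_norm h"
      by (subst nn_integral_cmult) auto
  qed
  also have "\<dots> = ?K * sq_norm h" by (rule nn_integral_multc) measurable
  finally show ?thesis by (simp add: power2_eq_square mult.assoc)
qed

text \<open>The crude constant \<open>K\<close> depends on the band, but it only multiplies the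
  error of an approximation that is chosen after the band. The uniform constant is merely multiplied
  by 4, from two uses of \<open>(u + v)\<^sup>2 \<le> 2 * u\<^sup>2 + 2 * v\<^sup>2\<close>.\<close>

lemma sq_norm_band_hilbert:
  "\<exists>C\<ge>0. \<forall>(e::'a::euclidean_space) a b f. 0 < a \<longrightarrow> a \<le> b \<longrightarrow> f \<in> borel_measurable borel \<longrightarrow> sq_norm f < \<infinity> \<longrightarrow>
     sq_norm (band_hilbert e a b f) \<le> ennreal C * sq_norm f"
proof -
  obtain C where C: "0 \<le> C" "\<And>(e::'a) a b f. 0 < a \<Longrightarrow> a \<le> b \<Longrightarrow> test_fn f \<Longrightarrow> sq_norm (band_hilbert e a b f) \<le> ennreal C * sq_norm f"
    using sq_norm_band_hilbert_test_fn[where 'a='a] by blast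
  have "sq_norm (band_hilbert e a b f) \<le> ennreal (4 * C) * sq_norm f"
    if ab: "0 < a" "a \<le> b" and [measurable]: "f \<in> borel_measurable borel" and f: "sq_norm f < \<infinity>" for e :: 'a and a b f
  proof (rule ennreal_le_epsilon)
    fix \<eta> :: real assume \<eta>: "0 < \<eta>"
    define k where "k t = tail_kernel a t - tail_kernel b t" for t
    have k: "integrable lborel k" using tail_kernel_diff_integrable[OF ab] unfolding k_def .
    then have [measurable]: "k \<in> borel_measurable borel" by simp
    define K where "K = (\<integral>t. \<bar>k t\<bar> \<partial>lborel)"
    have K: "0 \<le> K" "(\<integral>\<^sup>+t. ennreal \<bar>k t\<bar> \<partial>lborel) = ennreal K"
      unfolding K_def using nn_integral_eq_integral[OF integrable_abs[OF k]] by auto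
    \<comment> \<open>\<open>4 * C + 2 * K\<^sup>2\<close> is the total weight with which the error
      \<open>\<eta> / D\<close> enters below; the 1 keeps \<open>D\<close> positive.\<close>
    define D where "D = 4 * C + 2 * K\<^sup>2 + 1"
    have D: "0 < D" using C(1) by (simp add: D_def add_nonneg_pos)
    obtain g where g: "test_fn g" "sq_norm (\<lambda>x. f x - g x) \<le> ennreal (\<eta> / D)"
      using test_fn_dense[of f "\<eta> / D"] f \<eta> D by auto
    have [measurable]: "g \<in> borel_measurable borel" using g by (intro test_fn_measurable)
    let ?E = "\<lambda>x. \<integral>\<^sup>+t. ennreal (norm (k t *\<^sub>R (f (x - t *\<^sub>R e) - g (x - t *\<^sub>R e)))) \<partial>lborel"
    have pt: "ennreal (norm (band_hilbert e a b f x)) \<le> ennreal (norm (band_hilbert e a b g x)) + ?E x" for x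
    proof (cases "integrable lborel (\<lambda>t. k t *\<^sub>R f (x - t *\<^sub>R e))")
      \<comment> \<open>A divergent integral has the value 0, so nothing is to be shown
        there.\<close>
      case False
      then have "band_hilbert e a b f x = 0" unfolding band_hilbert_def k_def by (rule not_integrable_integral_eq)
      then show ?thesis by simp
    next
      case True
      obtain L r B where B: "\<And>x. norm (g x) \<le> B" using test_fnE[OF g(1)] by metis
      have gi: "integrable lborel (\<lambda>t. k t *\<^sub>R g (x - t *\<^sub>R e))"
        by (rule integrable_scaleR_bounded[OF k _ B]) measurable
      have di: "integrable lborel (\<lambda>t. k t *\<^sub>R (f (x - t *\<^sub>R e) - g (x - t *\<^sub>R e)))"
        unfolding scaleR_diff_right by (intro Bochner_Integration.integrable_diff True gi)
      have "band_hilbert e a b f x = band_hilbert e a b g x + (\<integral>t. k t *\<^sub>R (f (x - t *\<^sub>R e) - g (x - t *\<^sub>R e)) \<partial>lborel)"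
        unfolding band_hilbert_def k_def[symmetric] scaleR_diff_right by (simp add: Bochner_Integration.integral_diff[OF True gi])
      then have "norm (band_hilbert e a b f x) \<le> norm (band_hilbert e a b g x) + norm (\<integral>t. k t *\<^sub>R (f (x - t *\<^sub>R e) - g (x - t *\<^sub>R e)) \<partial>lborel)"
        by (simp add: norm_triangle_ineq)
      then have "ennreal (norm (band_hilbert e a b f x)) \<le> ennreal (norm (band_hilbert e a b g x)) + ennreal (norm (\<integral>t. k t *\<^sub>R (f (x - t *\<^sub>R e) - g (x - t *\<^sub>R e)) \<partial>lborel))"
        by (simp flip: ennreal_plus add: ennreal_leI)
      also have "\<dots> \<le> ennreal (norm (band_hilbert e a b g x)) + ?E x"
        by (intro add_left_mono integral_norm_bound_ennreal di)
      finally show ?thesis .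
    qed
    have sq: "(u + v)\<^sup>2 \<le> 2 * u\<^sup>2 + 2 * v\<^sup>2" for u v :: ennreal
    proof (cases u; cases v)
      fix p q assume *: "0 \<le> p" "u = ennreal p" "0 \<le> q" "v = ennreal q"
      have "(p + q)\<^sup>2 \<le> 2 * p\<^sup>2 + 2 * q\<^sup>2" using sum_squares_bound[of p q] by (simp add: power2_sum)
      then have "ennreal ((p + q)\<^sup>2) \<le> ennreal (2 * p\<^sup>2 + 2 * q\<^sup>2)" by (rule ennreal_leI)
      moreover have "ennreal (2 * p\<^sup>2 + 2 * q\<^sup>2) = 2 * u\<^sup>2 + 2 * v\<^sup>2"
        using * by (simp add: ennreal_mult ennreal_power)
      moreover have "(u + v)\<^sup>2 = ennreal ((p + q)\<^sup>2)"
        using * by (simp add: ennreal_power flip: ennreal_plus)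
      ultimately show ?thesis by simp
    qed (auto simp: power2_eq_square ennreal_mult_eq_top_iff)
    have "sq_norm (band_hilbert e a b f) \<le> (\<integral>\<^sup>+x. 2 * ennreal ((norm (band_hilbert e a b g x))\<^sup>2) + 2 * (?E x)\<^sup>2 \<partial>lborel)"
      unfolding sq_norm_def
    proof (rule nn_integral_mono)
      fix x
      have "ennreal ((norm (band_hilbert e a b f x))\<^sup>2) = (ennreal (norm (band_hilbert e a b f x)))\<^sup>2" by (simp add: ennreal_power)
      also have "\<dots> \<le> (ennreal (norm (band_hilbert e a b g x)) + ?E x)\<^sup>2" using pt by (intro power_mono) auto
      also have "\<dots> \<le> 2 * (ennreal (norm (band_hilbert e a b g x)))\<^sup>2 + 2 * (?E x)\<^sup>2" by (rule sq)
      finally show "ennreal ((norm (band_hilbert e a b f x))\<^sup>2) \<le> 2 * ennreal ((norm (band_hilbert e a b g x))\<^sup>2) + 2 * (?E x)\<^sup>2"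
        by (simp add: ennreal_power)
    qed
    also have "\<dots> = 2 * sq_norm (band_hilbert e a b g) + 2 * (\<integral>\<^sup>+x. (?E x)\<^sup>2 \<partial>lborel)"
      unfolding sq_norm_def by (subst nn_integral_add) (auto simp: nn_integral_cmult)
    also have "\<dots> \<le> 2 * (ennreal C * sq_norm g) + 2 * ((ennreal K)\<^sup>2 * sq_norm (\<lambda>x. f x - g x))"
    proof (intro add_mono mult_left_mono C g ab)
      show "(\<integral>\<^sup>+x. (?E x)\<^sup>2 \<partial>lborel) \<le> (ennreal K)\<^sup>2 * sq_norm (\<lambda>x. f x - g x)"
        unfolding K(2)[symmetric] by (rule sq_norm_abs_convolution_le) (use k in auto)
    qed auto
    also have "\<dots> \<le> 2 * (ennreal C * (2 * sq_norm f + 2 * ennreal (\<eta> / D))) + 2 * ((ennreal K)\<^sup>2 * ennreal (\<eta> / D))"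
    proof (intro add_mono mult_left_mono g(2))
      have "sq_norm g = sq_norm (\<lambda>x. f x - (f x - g x))" by simp
      also have "\<dots> \<le> 2 * sq_norm f + 2 * sq_norm (\<lambda>x. f x - g x)" by (rule sq_norm_diff_le) auto
      also have "\<dots> \<le> 2 * sq_norm f + 2 * ennreal (\<eta> / D)" by (intro add_mono mult_left_mono g(2)) auto
      finally show "sq_norm g \<le> 2 * sq_norm f + 2 * ennreal (\<eta> / D)" .
    qed auto
    also have "\<dots> = ennreal (4 * C) * sq_norm f + ennreal ((4 * C + 2 * K\<^sup>2) * (\<eta> / D))"
    proof -
      obtain m where m: "0 \<le> m" "sq_norm f = ennreal m" using f by (cases "sq_norm f") auto
      have "0 \<le> \<eta> / D" using \<eta> D by simp
      then have "2 * (ennreal C * (2 * sq_norm f + 2 * ennreal (\<eta> / D))) + 2 * ((ennreal K)\<^sup>2 * ennreal (\<eta> / D))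
        = ennreal (2 * (C * (2 * m + 2 * (\<eta> / D))) + 2 * (K\<^sup>2 * (\<eta> / D)))"
        using m C(1) K(1) by (simp add: ennreal_mult ennreal_plus ennreal_power del: times_divide_eq_right)
      also have "2 * (C * (2 * m + 2 * (\<eta> / D))) + 2 * (K\<^sup>2 * (\<eta> / D)) = 4 * C * m + (4 * C + 2 * K\<^sup>2) * (\<eta> / D)"
        by (simp add: algebra_simps)
      also have "ennreal \<dots> = ennreal (4 * C) * sq_norm f + ennreal ((4 * C + 2 * K\<^sup>2) * (\<eta> / D))"
        unfolding m using m C(1) \<eta> D
          by (subst ennreal_plus) (auto simp: ennreal_mult intro!: divide_nonneg_pos mult_nonneg_nonneg add_nonneg_nonneg)
      finally show ?thesis .
    qed
    also have "\<dots> \<le> ennreal (4 * C) * sq_norm f + ennreal \<eta>"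
    proof (intro add_left_mono ennreal_leI)
      have "(4 * C + 2 * K\<^sup>2) * (\<eta> / D) \<le> D * (\<eta> / D)" using \<eta> D by (intro mult_right_mono) (auto simp: D_def)
      then show "(4 * C + 2 * K\<^sup>2) * (\<eta> / D) \<le> \<eta>" using D by simp
    qed
    finally show "sq_norm (band_hilbert e a b f) \<le> ennreal (4 * C) * sq_norm f + ennreal \<eta>" .
  qed
  then show ?thesis using C(1) by (intro exI[of _ "4 * C"]) auto
qed

lemma sq_norm_le_liminf:
  assumes [measurable]: "\<And>n::nat. F n \<in> borel_measurable borel" and F: "AE x in lborel. (\<lambda>n. F n x) \<longlonglongrightarrow> G x"
  shows "sq_norm G \<le> liminf (\<lambda>n. sq_norm (F n))"
proof -
  have "sq_norm G = (\<integral>\<^sup>+x. liminf (\<lambda>n. ennreal ((norm (F n x))\<^sup>2)) \<partial>lborel)"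
    unfolding sq_norm_def
  proof (rule nn_integral_cong_AE)
    show "AE x in lborel. ennreal ((norm (G x))\<^sup>2) = liminf (\<lambda>n. ennreal ((norm (F n x))\<^sup>2))"
      using F
    proof eventually_elim
      fix x assume "(\<lambda>n. F n x) \<longlonglongrightarrow> G x"
      then have "(\<lambda>n. ennreal ((norm (F n x))\<^sup>2)) \<longlonglongrightarrow> ennreal ((norm (G x))\<^sup>2)"
        by (intro tendsto_ennrealI tendsto_intros)
      then show "ennreal ((norm (G x))\<^sup>2) = liminf (\<lambda>n. ennreal ((norm (F n x))\<^sup>2))"
        by (rule lim_imp_Liminf[OF sequentially_bot, symmetric])
    qed
  qed
  also have "\<dots> \<le> liminf (\<lambda>n. sq_norm (F n))" unfolding sq_norm_def by (rule nn_integral_liminf) measurable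
  finally show ?thesis .
qed

lemma sq_norm_Fatou:
  assumes "\<And>n::nat. F n \<in> borel_measurable borel" "AE x in lborel. (\<lambda>n. F n x) \<longlonglongrightarrow> G x"
    and le: "\<And>n. sq_norm (F n) \<le> c"
  shows "sq_norm G \<le> c"
proof -
  have "sq_norm G \<le> liminf (\<lambda>n. sq_norm (F n))" by (rule sq_norm_le_liminf[OF assms(1,2)])
  also have "\<dots> \<le> limsup (\<lambda>n. sq_norm (F n))" by (rule Liminf_le_Limsup) simp
  also have "\<dots> \<le> c" using le by (intro Limsup_bounded) auto
  finally show ?thesis .
qed

section \<open>Absolute convergence and limits of the truncations at a point\<close>

lemma tail_kernel_square_finite:
  assumes "0 < \<epsilon>"
  shows "(\<integral>\<^sup>+t. ennreal ((tail_kernel \<epsilon> t)\<^sup>2) \<partial>lborel) < \<infinity>"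
proof -
  \<comment> \<open>For \<open>\<epsilon> < \<bar>t\<bar>\<close> the comparison
    \<open>1 / t\<^sup>2 \<le> ?c / (1 + t\<^sup>2)\<close> amounts to
    \<open>\<epsilon>\<^sup>2 \<le> t\<^sup>2\<close>.\<close>
  let ?c = "1 + 1 / \<epsilon>\<^sup>2"
  have i: "integrable lborel (\<lambda>x::real. inverse (1 + x\<^sup>2))"
    using integrable_inverse_1_plus_square by (simp add: set_integrable_def)
  have "(\<integral>\<^sup>+t. ennreal ((tail_kernel \<epsilon> t)\<^sup>2) \<partial>lborel) \<le> (\<integral>\<^sup>+t. ennreal (?c * inverse (1 + t\<^sup>2)) \<partial>lborel)"
  proof (intro nn_integral_mono ennreal_leI)
    fix t
    show "(tail_kernel \<epsilon> t)\<^sup>2 \<le> ?c * inverse (1 + t\<^sup>2)"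
    proof (cases "\<epsilon> < \<bar>t\<bar>")
      case True
      then have t2: "\<epsilon>\<^sup>2 \<le> t\<^sup>2" using assms by (metis abs_le_square_iff abs_of_pos less_imp_le)
      have p: "0 < \<epsilon>\<^sup>2" "0 < t\<^sup>2" using assms True by auto
      have "1 + t\<^sup>2 \<le> ?c * t\<^sup>2"
        using t2 p by (simp add: field_simps)
      then have "(1 + t\<^sup>2) / ((1 + t\<^sup>2) * t\<^sup>2) \<le> (?c * t\<^sup>2) / ((1 + t\<^sup>2) * t\<^sup>2)"
        using p by (intro divide_right_mono) auto
      moreover have "1 + t\<^sup>2 \<noteq> 0" using p by linarith
      ultimately have "1 / t\<^sup>2 \<le> ?c / (1 + t\<^sup>2)" using p by simp
      then show ?thesis using True by (simp add: tail_kernel_def power_divide divide_inverse power_inverse)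
    next
      case False
      then show ?thesis by (simp add: tail_kernel_def)
    qed
  qed
  also have "\<dots> < \<infinity>"
  proof -
    have "integrable lborel (\<lambda>t::real. ?c * inverse (1 + t\<^sup>2))" using i by simp
    then show ?thesis by (subst nn_integral_eq_integral) auto
  qed
  finally show ?thesis .
qed

lemma tail_kernel_line_integrable:
  fixes h :: "real \<Rightarrow> complex"
  assumes [measurable]: "h \<in> borel_measurable borel" and h: "(\<integral>\<^sup>+t. ennreal ((norm (h t))\<^sup>2) \<partial>lborel) < \<infinity>" and "0 < \<epsilon>"
  shows "integrable lborel (\<lambda>t. tail_kernel \<epsilon> t *\<^sub>R h t)"
proof (rule integrableI_bounded)
  have "(\<integral>\<^sup>+t. ennreal (norm (tail_kernel \<epsilon> t *\<^sub>R h t)) \<partial>lborel) \<le> (\<integral>\<^sup>+t. ennreal ((tail_kernel \<epsilon> t)\<^sup>2) + ennreal ((norm (h t))\<^sup>2) \<partial>lborel)"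
  proof (rule nn_integral_mono)
    fix t
    have "2 * (\<bar>tail_kernel \<epsilon> t\<bar> * norm (h t)) \<le> \<bar>tail_kernel \<epsilon> t\<bar>\<^sup>2 + (norm (h t))\<^sup>2"
      using sum_squares_bound[of "\<bar>tail_kernel \<epsilon> t\<bar>" "norm (h t)"] by (simp add: mult.assoc)
    moreover have "0 \<le> \<bar>tail_kernel \<epsilon> t\<bar> * norm (h t)" by simp
    ultimately have "norm (tail_kernel \<epsilon> t *\<^sub>R h t) \<le> (tail_kernel \<epsilon> t)\<^sup>2 + (norm (h t))\<^sup>2"
      unfolding norm_scaleR power2_abs by linarith
    then show "ennreal (norm (tail_kernel \<epsilon> t *\<^sub>R h t)) \<le> ennreal ((tail_kernel \<epsilon> t)\<^sup>2) + ennreal ((norm (h t))\<^sup>2)"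
      by (simp flip: ennreal_plus add: ennreal_leI)
  qed
  also have "\<dots> < \<infinity>"
    using tail_kernel_square_finite[OF assms(3)] h by (subst nn_integral_add) auto
  finally show "(\<integral>\<^sup>+t. ennreal (norm (tail_kernel \<epsilon> t *\<^sub>R h t)) \<partial>lborel) < \<infinity>" .
qed measurable

text \<open>At such points the truncations are additive in \<open>f\<close>, and bands are
  differences of tails; elsewhere an integral may have its default value 0.\<close>

definition line_integrable :: "'a::euclidean_space \<Rightarrow> ('a \<Rightarrow> complex) \<Rightarrow> 'a \<Rightarrow> bool" where
  "line_integrable e f x \<longleftrightarrow> (\<forall>\<epsilon>>0. integrable lborel (\<lambda>t. tail_kernel \<epsilon> t *\<^sub>R f (x - t *\<^sub>R e)))"

lemma line_integrableI:
  assumes [measurable]: "f \<in> borel_measurable borel" and "(\<integral>\<^sup>+t. ennreal ((norm (f (x - t *\<^sub>R e)))\<^sup>2) \<partial>lborel) < \<infinity>"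
  shows "line_integrable e f x"
  unfolding line_integrable_def using assms by (intro allI impI tail_kernel_line_integrable) auto

lemma line_integrable_real:
  fixes f :: "real \<Rightarrow> complex"
  assumes [measurable]: "f \<in> borel_measurable borel" and "sq_norm f < \<infinity>"
  shows "line_integrable 1 f x"
proof (rule line_integrableI)
  have "(\<integral>\<^sup>+t. ennreal ((norm (f t))\<^sup>2) \<partial>lborel) = (\<integral>\<^sup>+t. ennreal ((norm (f (x - t)))\<^sup>2) \<partial>lborel)"
    by (subst nn_integral_real_affine[where c="-1" and t=x]) auto
  then show "(\<integral>\<^sup>+t. ennreal ((norm (f (x - t *\<^sub>R 1)))\<^sup>2) \<partial>lborel) < \<infinity>"
    using assms unfolding sq_norm_def by simp
qed fact

lemma band_hilbert_eq_tail_hilbert: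
  assumes "line_integrable e f x" "0 < a" "0 < b"
  shows "band_hilbert e a b f x = tail_hilbert e a f x - tail_hilbert e b f x"
  using assms unfolding band_hilbert_def tail_hilbert_def line_integrable_def
  by (subst Bochner_Integration.integral_diff[symmetric]) (auto simp: scaleR_diff_left)

lemma tail_hilbert_diff:
  assumes "line_integrable e f x" "line_integrable e g x" "0 < \<epsilon>"
  shows "tail_hilbert e \<epsilon> (\<lambda>x. f x - g x) x = tail_hilbert e \<epsilon> f x - tail_hilbert e \<epsilon> g x"
  using assms unfolding tail_hilbert_def line_integrable_def
  by (subst Bochner_Integration.integral_diff[symmetric]) (auto simp: scaleR_diff_right)

text \<open>All truncations at \<open>s n \<ge> \<epsilon>\<close> are dominated by the one at
  \<open>\<epsilon>\<close>. The limit at infinity and the limit from the right are both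
  instances.\<close>

lemma tail_hilbert_kernel_limit:
  assumes f: "line_integrable e f x" and [measurable]: "f \<in> borel_measurable borel"
    and \<epsilon>: "0 < \<epsilon>" "\<And>n::nat. \<epsilon> \<le> s n" and lim: "\<And>t. (\<lambda>n. tail_kernel (s n) t) \<longlonglongrightarrow> k t" and [measurable]: "k \<in> borel_measurable borel"
  shows "(\<lambda>n. tail_hilbert e (s n) f x) \<longlonglongrightarrow> (\<integral>t. k t *\<^sub>R f (x - t *\<^sub>R e) \<partial>lborel)"
  unfolding tail_hilbert_def
proof (rule integral_dominated_convergence[where w="\<lambda>t. norm (tail_kernel \<epsilon> t *\<^sub>R f (x - t *\<^sub>R e))"])
  show "integrable lborel (\<lambda>t. norm (tail_kernel \<epsilon> t *\<^sub>R f (x - t *\<^sub>R e)))"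
    using f \<epsilon>(1) unfolding line_integrable_def by (intro integrable_norm) auto
  show "AE t in lborel. norm (tail_kernel (s n) t *\<^sub>R f (x - t *\<^sub>R e)) \<le> norm (tail_kernel \<epsilon> t *\<^sub>R f (x - t *\<^sub>R e))" for n
    using \<epsilon>(2)[of n] by (intro AE_I2) (auto simp: tail_kernel_def)
  show "AE t in lborel. (\<lambda>n. tail_kernel (s n) t *\<^sub>R f (x - t *\<^sub>R e)) \<longlonglongrightarrow> k t *\<^sub>R f (x - t *\<^sub>R e)"
    by (intro AE_I2 tendsto_intros lim)
qed measurable

lemma tail_hilbert_at_top:
  assumes f: "line_integrable e f x" and [measurable]: "f \<in> borel_measurable borel"
    and s: "filterlim s at_top sequentially"
  shows "(\<lambda>n::nat. tail_hilbert e (s n) f x) \<longlonglongrightarrow> 0"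
proof -
  \<comment> \<open>Raising the truncations to at least 1 provides a common majorant and changes
    nothing eventually.\<close>
  have s': "filterlim (\<lambda>n. max 1 (s n)) at_top sequentially"
    by (rule filterlim_at_top_mono[OF s]) auto
  have "(\<lambda>n. tail_hilbert e (max 1 (s n)) f x) \<longlonglongrightarrow> (\<integral>t. 0 *\<^sub>R f (x - t *\<^sub>R e) \<partial>lborel)"
  proof (rule tail_hilbert_kernel_limit[OF f, where \<epsilon>=1])
    show "(\<lambda>n. tail_kernel (max 1 (s n)) t) \<longlonglongrightarrow> 0" for t
    proof (rule tendsto_eventually)
      have "eventually (\<lambda>n. \<bar>t\<bar> \<le> max 1 (s n)) sequentially"
        using s' unfolding filterlim_at_top by blast
      then show "\<forall>\<^sub>F n in sequentially. tail_kernel (max 1 (s n)) t = 0"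
        by eventually_elim (simp add: tail_kernel_def del: max_less_iff_conj)
    qed
  qed auto
  moreover have "eventually (\<lambda>n. tail_hilbert e (max 1 (s n)) f x = tail_hilbert e (s n) f x) sequentially"
  proof -
    have "eventually (\<lambda>n. 1 \<le> s n) sequentially" using s unfolding filterlim_at_top by blast
    then show ?thesis by eventually_elim (simp add: max_def)
  qed
  ultimately show ?thesis using Lim_transform_eventually by simp
qed

lemma tail_hilbert_right_continuous:
  assumes f: "line_integrable e f x" and [measurable]: "f \<in> borel_measurable borel"
    and \<epsilon>: "0 < \<epsilon>" "\<And>n::nat. \<epsilon> < s n" and s: "s \<longlonglongrightarrow> \<epsilon>"
  shows "(\<lambda>n. tail_hilbert e (s n) f x) \<longlonglongrightarrow> tail_hilbert e \<epsilon> f x"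
  unfolding tail_hilbert_def[of e \<epsilon>]
proof (rule tail_hilbert_kernel_limit[OF f _ \<epsilon>(1)])
  show "\<epsilon> \<le> s n" for n using \<epsilon>(2)[of n] by simp
  show "(\<lambda>n. tail_kernel (s n) t) \<longlonglongrightarrow> tail_kernel \<epsilon> t" for t
  proof (rule tendsto_eventually)
    show "\<forall>\<^sub>F n in sequentially. tail_kernel (s n) t = tail_kernel \<epsilon> t"
    proof (cases "\<epsilon> < \<bar>t\<bar>")
      case True
      then have "eventually (\<lambda>n. s n < \<bar>t\<bar>) sequentially" using s by (intro order_tendstoD)
      then show ?thesis by eventually_elim (use True in \<open>simp add: tail_kernel_def\<close>)
    next
      case False
      then have "\<not> s n < \<bar>t\<bar>" for n using \<epsilon>(2)[of n] by simp
      then show ?thesis using False by (simp add: tail_kernel_def)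
    qed
  qed
qed auto

text \<open>The outer radius of the bands is sent to infinity; Fatou keeps the constant.\<close>

lemma sq_norm_tail_hilbert:
  "\<exists>C\<ge>0. \<forall>(e::'a::euclidean_space) \<epsilon> f. 0 < \<epsilon> \<longrightarrow> f \<in> borel_measurable borel \<longrightarrow> sq_norm f < \<infinity> \<longrightarrow> (AE x in lborel. line_integrable e f x) \<longrightarrow>
     sq_norm (tail_hilbert e \<epsilon> f) \<le> ennreal C * sq_norm f"
proof -
  obtain C where C: "0 \<le> C" "\<And>(e::'a) a b f. 0 < a \<Longrightarrow> a \<le> b \<Longrightarrow> f \<in> borel_measurable borel \<Longrightarrow> sq_norm f < \<infinity> \<Longrightarrow> sq_norm (band_hilbert e a b f) \<le> ennreal C * sq_norm f"
    using sq_norm_band_hilbert[where 'a='a] by blast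
  have "sq_norm (tail_hilbert e \<epsilon> f) \<le> ennreal C * sq_norm f"
    if \<epsilon>: "0 < \<epsilon>" and [measurable]: "f \<in> borel_measurable borel" and f: "sq_norm f < \<infinity>" "AE x in lborel. line_integrable e f x" for e :: 'a and \<epsilon> f
  proof (rule sq_norm_Fatou[where F="\<lambda>n. band_hilbert e \<epsilon> (\<epsilon> + real n) f"])
    show "sq_norm (band_hilbert e \<epsilon> (\<epsilon> + real n) f) \<le> ennreal C * sq_norm f" for n
      by (rule C(2)) (use \<epsilon> f in auto)
    show "AE x in lborel. (\<lambda>n. band_hilbert e \<epsilon> (\<epsilon> + real n) f x) \<longlonglongrightarrow> tail_hilbert e \<epsilon> f x"
      using f(2)
    proof eventually_elim
      fix x assume x: "line_integrable e f x"
      have "filterlim (\<lambda>n. \<epsilon> + real n) at_top sequentially" by real_asymp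
      then have "(\<lambda>n. tail_hilbert e (\<epsilon> + real n) f x) \<longlonglongrightarrow> 0" by (intro tail_hilbert_at_top[OF x]) auto
      then have "(\<lambda>n. tail_hilbert e \<epsilon> f x - tail_hilbert e (\<epsilon> + real n) f x) \<longlonglongrightarrow> tail_hilbert e \<epsilon> f x - 0" by (intro tendsto_intros)
      then show "(\<lambda>n. band_hilbert e \<epsilon> (\<epsilon> + real n) f x) \<longlonglongrightarrow> tail_hilbert e \<epsilon> f x"
        using \<epsilon> by (simp add: band_hilbert_eq_tail_hilbert[OF x] add_pos_nonneg)
    qed
  qed measurable
  then show ?thesis using C(1) by blast
qed

section \<open>Cotlar's inequality on the line\<close>

text \<open>The Hardy-Littlewood maximal inequality, with the 5 of Vitali's covering lemma. A Borel
  set \<open>T\<close> stands in for the level set, whose measurability is thereby no issue. It is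
  applied to squares of absolute values.\<close>

lemma maximal_weak_type:
  fixes \<phi> :: "real \<Rightarrow> ennreal"
  assumes [measurable]: "\<phi> \<in> borel_measurable borel" and fin: "(\<integral>\<^sup>+y. \<phi> y \<partial>lborel) < \<infinity>" and A: "0 < A"
  shows "\<exists>T\<in>sets borel. {x. \<exists>r>0. ennreal (2 * r * A) < (\<integral>\<^sup>+y. \<phi> y * indicator (cball x r) y \<partial>lborel)} \<subseteq> T
    \<and> emeasure lborel T \<le> ennreal (5 / A) * (\<integral>\<^sup>+y. \<phi> y \<partial>lborel)"
proof -
  let ?S = "{x. \<exists>r>0. ennreal (2 * r * A) < (\<integral>\<^sup>+y. \<phi> y * indicator (cball x r) y \<partial>lborel)}"
  define K where "K = {(x, r). 0 < r \<and> ennreal (2 * r * A) < (\<integral>\<^sup>+y. \<phi> y * indicator (cball x r) y \<partial>lborel)}"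
  obtain I where I: "0 \<le> I" "(\<integral>\<^sup>+y. \<phi> y \<partial>lborel) = ennreal I"
    using fin by (cases "\<integral>\<^sup>+y. \<phi> y \<partial>lborel") auto
  have [measurable]: "cball a r \<in> sets (borel :: real measure)" for a r by simp
  have cov: "?S \<subseteq> (\<Union>i\<in>K. cball (fst i) (snd i))"
    by (fastforce simp: K_def)
  \<comment> \<open>Vitali's lemma requires bounded radii; they are bounded because the total mass
    is finite.\<close>
  have rad: "0 < snd i \<and> snd i \<le> I / (2 * A)" if "i \<in> K" for i
  proof -
    have i: "0 < snd i" "ennreal (2 * snd i * A) < (\<integral>\<^sup>+y. \<phi> y * indicator (cball (fst i) (snd i)) y \<partial>lborel)"
      using that by (auto simp: K_def)
    note i(2)
    also have "(\<integral>\<^sup>+y. \<phi> y * indicator (cball (fst i) (snd i)) y \<partial>lborel) \<le> (\<integral>\<^sup>+y. \<phi> y \<partial>lborel)"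
      by (intro nn_integral_mono) (auto simp: indicator_def)
    finally have "2 * snd i * A < I" unfolding I using i(1) A by (simp add: ennreal_less_iff)
    then show ?thesis using i(1) A by (simp add: field_simps)
  qed
  obtain C where C: "countable C" "C \<subseteq> K" "pairwise (\<lambda>i j. disjnt (cball (fst i) (snd i)) (cball (fst j) (snd j))) C"
     "?S \<subseteq> (\<Union>i\<in>C. cball (fst i) (5 * snd i))"
    using Vitali_covering_lemma_cballs[OF cov rad] by blast
  define T where "T = (\<Union>i\<in>C. cball (fst i) (5 * snd i))"
  have [measurable]: "T \<in> sets borel" unfolding T_def using C(1) by (intro sets.countable_UN') auto
  have "emeasure lborel T = (\<integral>\<^sup>+y. indicator T y \<partial>lborel)" by simp
  \<comment> \<open>The countable sum is written as an integral over \<open>count_space C\<close>,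
    to be exchanged with the Lebesgue integral.\<close>
  also have "\<dots> \<le> (\<integral>\<^sup>+y. (\<integral>\<^sup>+i. indicator (cball (fst i) (5 * snd i)) y \<partial>count_space C) \<partial>lborel)"
  proof (rule nn_integral_mono)
    fix y
    show "indicator T y \<le> (\<integral>\<^sup>+i. indicator (cball (fst i) (5 * snd i)) y \<partial>count_space C)"
    proof (cases "y \<in> T")
      case True
      then obtain i where i: "i \<in> C" "y \<in> cball (fst i) (5 * snd i)" unfolding T_def by blast
      have "indicator (cball (fst i) (5 * snd i)) y \<le> (\<integral>\<^sup>+i. indicator (cball (fst i) (5 * snd i)) y \<partial>count_space C)"
        by (rule nn_integral_ge_point) (rule i)
      then show ?thesis using i True by simp
    qed simp
  qed
  also have "\<dots> = (\<integral>\<^sup>+i. (\<integral>\<^sup>+y. indicator (cball (fst i) (5 * snd i)) y \<partial>lborel) \<partial>count_space C)"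
    by (rule nn_integral_count_space_nn_integral[OF C(1)]) measurable
  also have "\<dots> \<le> (\<integral>\<^sup>+i. (\<integral>\<^sup>+y. ennreal (5 / A) * (\<phi> y * indicator (cball (fst i) (snd i)) y) \<partial>lborel) \<partial>count_space C)"
  proof (rule nn_integral_mono)
    fix i assume "i \<in> space (count_space C)"
    then have i: "0 < snd i" "ennreal (2 * snd i * A) < (\<integral>\<^sup>+y. \<phi> y * indicator (cball (fst i) (snd i)) y \<partial>lborel)"
      using C(2) by (auto simp: K_def)
    have "(\<integral>\<^sup>+y. indicator (cball (fst i) (5 * snd i)) y \<partial>lborel) = ennreal (10 * snd i)"
      using i(1) by (simp add: cball_eq_atLeastAtMost)
    also have "\<dots> = ennreal (5 / A) * ennreal (2 * snd i * A)"
      using i(1) A by (subst ennreal_mult[symmetric]) auto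
    also have "\<dots> \<le> ennreal (5 / A) * (\<integral>\<^sup>+y. \<phi> y * indicator (cball (fst i) (snd i)) y \<partial>lborel)"
      using i(2) by (intro mult_left_mono) auto
    also have "\<dots> = (\<integral>\<^sup>+y. ennreal (5 / A) * (\<phi> y * indicator (cball (fst i) (snd i)) y) \<partial>lborel)"
      by (rule nn_integral_cmult[symmetric]) measurable
    finally show "(\<integral>\<^sup>+y. indicator (cball (fst i) (5 * snd i)) y \<partial>lborel) \<le> (\<integral>\<^sup>+y. ennreal (5 / A) * (\<phi> y * indicator (cball (fst i) (snd i)) y) \<partial>lborel)" .
  qed
  also have "\<dots> = (\<integral>\<^sup>+y. (\<integral>\<^sup>+i. ennreal (5 / A) * (\<phi> y * indicator (cball (fst i) (snd i)) y) \<partial>count_space C) \<partial>lborel)"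
    by (rule nn_integral_count_space_nn_integral[OF C(1), symmetric]) measurable
  \<comment> \<open>The selected balls are disjoint, so at each \<open>y\<close> at most one term of
    the sum is nonzero.\<close>
  also have "\<dots> \<le> (\<integral>\<^sup>+y. ennreal (5 / A) * \<phi> y \<partial>lborel)"
  proof (rule nn_integral_mono)
    fix y
    show "(\<integral>\<^sup>+i. ennreal (5 / A) * (\<phi> y * indicator (cball (fst i) (snd i)) y) \<partial>count_space C) \<le> ennreal (5 / A) * \<phi> y"
    proof (cases "\<exists>i\<in>C. y \<in> cball (fst i) (snd i)")
      case True
      then obtain i where i: "i \<in> C" "y \<in> cball (fst i) (snd i)" by blast
      have "y \<notin> cball (fst j) (snd j)" if "j \<in> C" "j \<noteq> i" for j
        using C(3) i that unfolding pairwise_def disjnt_def by blast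
      then have "(\<integral>\<^sup>+i. ennreal (5 / A) * (\<phi> y * indicator (cball (fst i) (snd i)) y) \<partial>count_space C)
         = (\<integral>\<^sup>+j. (ennreal (5 / A) * \<phi> y) * indicator {i} j \<partial>count_space C)"
        using i by (intro nn_integral_cong) (auto simp: indicator_def)
      also have "\<dots> = (ennreal (5 / A) * \<phi> y) * emeasure (count_space C) {i}"
        using i by (intro nn_integral_cmult_indicator) auto
      finally show ?thesis using i by simp
    next
      case False
      then have "(\<integral>\<^sup>+i. ennreal (5 / A) * (\<phi> y * indicator (cball (fst i) (snd i)) y) \<partial>count_space C) = (\<integral>\<^sup>+i. 0 \<partial>count_space C)"
        by (intro nn_integral_cong) (auto simp: indicator_def)
      then show ?thesis by simp
    qed
  qed
  also have "\<dots> = ennreal (5 / A) * (\<integral>\<^sup>+y. \<phi> y \<partial>lborel)" by (rule nn_integral_cmult) measurable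
  finally show ?thesis using C(4) unfolding T_def[symmetric] by (intro bexI[of _ T]) auto
qed

text \<open>On the shell \<open>2 ^ n * \<epsilon> \<le> \<bar>x - y\<bar> \<le> 2 ^ Suc n *
  \<epsilon>\<close> the weight is at most \<open>1 / (\<epsilon> * 4 ^ n)\<close>, while the
  surrounding ball has mass at most \<open>2 * (2 ^ Suc n * \<epsilon>) * A\<close>. The products
  \<open>4 * A / 2 ^ n\<close> sum to \<open>8 * A\<close>.\<close>

lemma dyadic_tail_bound:
  fixes \<phi> :: "real \<Rightarrow> ennreal"
  assumes [measurable]: "\<phi> \<in> borel_measurable borel" and A: "0 \<le> A" and \<epsilon>: "0 < \<epsilon>"
    and avg: "\<And>r. 0 < r \<Longrightarrow> (\<integral>\<^sup>+y. \<phi> y * indicator (cball x r) y \<partial>lborel) \<le> ennreal (2 * r * A)"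
  shows "(\<integral>\<^sup>+y. ennreal (\<epsilon> * (tail_kernel \<epsilon> (x - y))\<^sup>2) * \<phi> y \<partial>lborel) \<le> ennreal (8 * A)"
proof -
  have [measurable]: "cball a r \<in> sets (borel :: real measure)" for a r by simp
  let ?g = "\<lambda>n y. ennreal (1 / (\<epsilon> * 4 ^ n)) * (\<phi> y * indicator (cball x (2 ^ Suc n * \<epsilon>)) y)"
  have pt: "ennreal (\<epsilon> * (tail_kernel \<epsilon> (x - y))\<^sup>2) * \<phi> y \<le> (\<Sum>n. ?g n y)" for y
  proof (cases "\<epsilon> < \<bar>x - y\<bar>")
    case False
    then show ?thesis by (simp add: tail_kernel_def)
  next
    case True
    define s where "s = \<bar>x - y\<bar> / \<epsilon>"
    have s: "1 < s" "\<bar>x - y\<bar> = s * \<epsilon>" using True \<epsilon> by (auto simp: s_def)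
    obtain m where m: "s < 2 ^ m" using real_arch_pow[of 2 s] by auto
    define l where "l = (LEAST m. s < 2 ^ m)"
    have l: "s < 2 ^ l" unfolding l_def using m by (rule LeastI)
    have "l \<noteq> 0" using l s by (intro notI) simp
    then obtain n where n: "l = Suc n" by (cases l) auto
    have "\<not> s < 2 ^ n" using not_less_Least[of n "\<lambda>m. s < 2 ^ m"] n unfolding l_def[symmetric] by simp
    then have ns: "2 ^ n \<le> s" "s \<le> 2 ^ Suc n" using l n by auto
    have "\<epsilon> * (tail_kernel \<epsilon> (x - y))\<^sup>2 = \<epsilon> / (s * \<epsilon>)\<^sup>2"
      using True unfolding s(2)[symmetric] by (simp add: tail_kernel_def power_divide)
    also have "\<dots> \<le> \<epsilon> / (2 ^ n * \<epsilon>)\<^sup>2"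
      using ns \<epsilon> s by (intro divide_left_mono power_mono mult_right_mono mult_pos_pos) auto
    also have "\<dots> = 1 / (\<epsilon> * 4 ^ n)"
    proof -
      have "(2 ^ n)\<^sup>2 = (4::real) ^ n" by (simp flip: power_mult power_even_eq add: power2_eq_square power_mult_distrib[symmetric])
      then show ?thesis using \<epsilon> by (simp add: power_mult_distrib power2_eq_square)
    qed
    finally have "ennreal (\<epsilon> * (tail_kernel \<epsilon> (x - y))\<^sup>2) * \<phi> y \<le> ennreal (1 / (\<epsilon> * 4 ^ n)) * \<phi> y"
      by (intro mult_right_mono ennreal_leI) auto
    also have "\<dots> = ?g n y"
    proof -
      have "\<bar>x - y\<bar> \<le> 2 ^ Suc n * \<epsilon>" unfolding s(2) using ns(2) \<epsilon> by (intro mult_right_mono) auto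
      then have "y \<in> cball x (2 ^ Suc n * \<epsilon>)" by (simp add: dist_real_def)
      then show ?thesis by simp
    qed
    also have "\<dots> \<le> (\<Sum>n. ?g n y)"
      using sum_le_suminf[of "\<lambda>n. ?g n y" "{n}"] by simp
    finally show ?thesis .
  qed
  have "(\<integral>\<^sup>+y. ennreal (\<epsilon> * (tail_kernel \<epsilon> (x - y))\<^sup>2) * \<phi> y \<partial>lborel) \<le> (\<integral>\<^sup>+y. (\<Sum>n. ?g n y) \<partial>lborel)"
    by (intro nn_integral_mono pt)
  also have "\<dots> = (\<Sum>n. \<integral>\<^sup>+y. ?g n y \<partial>lborel)" by (rule nn_integral_suminf) measurable
  also have "\<dots> \<le> (\<Sum>n. ennreal (4 * A * (1 / 2) ^ n))"
  proof (rule suminf_le)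
    fix n
    have "(\<integral>\<^sup>+y. ?g n y \<partial>lborel) = ennreal (1 / (\<epsilon> * 4 ^ n)) * (\<integral>\<^sup>+y. \<phi> y * indicator (cball x (2 ^ Suc n * \<epsilon>)) y \<partial>lborel)"
      by (rule nn_integral_cmult) measurable
    also have "\<dots> \<le> ennreal (1 / (\<epsilon> * 4 ^ n)) * ennreal (2 * (2 ^ Suc n * \<epsilon>) * A)"
      using \<epsilon> by (intro mult_left_mono avg) auto
    also have "\<dots> = ennreal (1 / (\<epsilon> * 4 ^ n) * (2 * (2 ^ Suc n * \<epsilon>) * A))"
      using \<epsilon> A by (intro ennreal_mult[symmetric]) auto
    also have "1 / (\<epsilon> * 4 ^ n) * (2 * (2 ^ Suc n * \<epsilon>) * A) = 4 * A * (1 / 2) ^ n"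
    proof -
      have "(4::real) ^ n = 2 ^ n * 2 ^ n" by (simp flip: power_mult_distrib)
      then show ?thesis using \<epsilon> by (simp add: field_simps power_divide)
    qed
    finally show "(\<integral>\<^sup>+y. ?g n y \<partial>lborel) \<le> ennreal (4 * A * (1 / 2) ^ n)" .
  qed auto
  also have "\<dots> = ennreal (4 * A * 2)"
    using A geometric_sums[of "1 / 2 :: real"] by (intro suminf_ennreal_eq sums_mult) auto
  finally show ?thesis by simp
qed

lemma tail_hilbert_real_swap:
  fixes f :: "real \<Rightarrow> complex"
  shows "tail_hilbert 1 \<epsilon> f x = (\<integral>y. tail_kernel \<epsilon> (x - y) *\<^sub>R f y \<partial>lborel)"
  unfolding tail_hilbert_def by (subst lborel_integral_real_affine[where c="-1" and t=x]) auto

lemma integrable_tail_hilbert_real_swap: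
  fixes f :: "real \<Rightarrow> complex"
  assumes "f \<in> borel_measurable borel" "sq_norm f < \<infinity>" "0 < \<epsilon>"
  shows "integrable lborel (\<lambda>y. tail_kernel \<epsilon> (x - y) *\<^sub>R f y)"
proof -
  have "integrable lborel (\<lambda>t. tail_kernel \<epsilon> t *\<^sub>R f (x - t))"
    using line_integrable_real[OF assms(1,2), of x] assms(3) by (simp add: line_integrable_def)
  from lborel_integrable_real_affine[OF this, of "-1" x] show ?thesis by simp
qed

text \<open>Since \<open>\<bar>x' - y\<bar> \<ge> 3 / 4 * \<bar>x - y\<bar> > \<delta>\<close>,
  neither kernel is cut off, and the difference of the reciprocals is the displacement over the
  product of the two distances. The constant 1/3 is 1/4 divided by 3/4.\<close>

lemma tail_kernel_difference_bound:
  assumes \<delta>: "0 < \<delta>" "\<delta> < 3 / 4 * \<epsilon>" and x': "\<bar>x' - x\<bar> \<le> \<epsilon> / 4" and y: "\<epsilon> < \<bar>x - y\<bar>"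
  shows "\<bar>tail_kernel \<delta> (x' - y) - tail_kernel \<epsilon> (x - y)\<bar> \<le> 1 / 3 * (\<epsilon> * (tail_kernel \<epsilon> (x - y))\<^sup>2)"
proof -
  define a b where "a = x - y" and "b = x' - y"
  have \<epsilon>: "0 < \<epsilon>" using \<delta> by simp
  have a: "\<epsilon> < \<bar>a\<bar>" using y by (simp add: a_def)
  have ab: "\<bar>a - b\<bar> \<le> \<epsilon> / 4" using x' by (simp add: a_def b_def abs_minus_commute)
  have b: "3 / 4 * \<bar>a\<bar> \<le> \<bar>b\<bar>" using a ab by linarith
  then have b\<delta>: "\<delta> < \<bar>b\<bar>" using a \<delta> by linarith
  have nz: "a \<noteq> 0" "b \<noteq> 0" using a b\<delta> \<epsilon> \<delta> by auto
  have "\<bar>1 / b - 1 / a\<bar> = \<bar>a - b\<bar> / (\<bar>a\<bar> * \<bar>b\<bar>)"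
    using nz by (simp add: diff_frac_eq abs_mult mult.commute)
  also have "\<dots> \<le> (\<epsilon> / 4) / (\<bar>a\<bar> * (3 / 4 * \<bar>a\<bar>))"
    using ab b nz \<epsilon> by (intro frac_le mult_left_mono mult_pos_pos) auto
  also have "\<dots> = 1 / 3 * (\<epsilon> * (1 / a)\<^sup>2)"
    using nz by (simp add: power2_eq_square field_simps)
  finally show ?thesis using a b\<delta> by (simp add: tail_kernel_def a_def b_def)
qed

text \<open>Compare the truncation at \<open>x\<close> with the values at nearby points of the transform of the part of \<open>g\<close>
  living outside the ball of radius \<open>\<epsilon>\<close>, and average over these points.\<close>

lemma Cotlar_pointwise:
  fixes g :: "real \<Rightarrow> complex"
  assumes [measurable]: "g \<in> borel_measurable borel" and g: "sq_norm g < \<infinity>"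
    and \<delta>: "0 < \<delta>" "\<delta> < 3 / 4 * \<epsilon>" and A: "0 \<le> A"
    and avg: "\<And>r. 0 < r \<Longrightarrow> (\<integral>\<^sup>+y. ennreal ((norm (g y))\<^sup>2) * indicator (cball x r) y \<partial>lborel) \<le> ennreal (2 * r * A)"
    and avgT: "\<And>r. 0 < r \<Longrightarrow> (\<integral>\<^sup>+y. ennreal ((norm (tail_hilbert 1 \<delta> g y))\<^sup>2) * indicator (cball x r) y \<partial>lborel) \<le> ennreal (2 * r * A)"
    and C: "0 \<le> C" "\<And>f. f \<in> borel_measurable borel \<Longrightarrow> sq_norm f < \<infinity> \<Longrightarrow> sq_norm (tail_hilbert (1::real) \<delta> f) \<le> ennreal C * sq_norm f"
  shows "(norm (tail_hilbert 1 \<epsilon> g x))\<^sup>2 \<le> (27 + 12 * C) * A"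
proof -
  have [measurable]: "cball a r \<in> sets (borel :: real measure)" for a r by simp
  have \<epsilon>: "0 < \<epsilon>" using \<delta> by simp
  \<comment> \<open>The near part has squared norm at most \<open>2 * \<epsilon> * A\<close>, so the
    L^2 bound of the truncation controls the mean of its transform over a ball of radius
    \<open>\<epsilon> / 4\<close>. For the far part the kernel hardly varies over that ball.\<close>
  define g1 where "g1 y = indicator (cball x \<epsilon>) y * g y" for y
  define g2 where "g2 y = indicator (- cball x \<epsilon>) y * g y" for y
  have [measurable]: "g1 \<in> borel_measurable borel" "g2 \<in> borel_measurable borel" unfolding g1_def g2_def by measurable
  have g1N: "sq_norm g1 \<le> ennreal (2 * \<epsilon> * A)"
  proof -
    have "sq_norm g1 = (\<integral>\<^sup>+y. ennreal ((norm (g y))\<^sup>2) * indicator (cball x \<epsilon>) y \<partial>lborel)"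
      unfolding sq_norm_def g1_def by (intro nn_integral_cong) (auto simp: indicator_def)
    then show ?thesis using avg[OF \<epsilon>] by simp
  qed
  have g1f: "sq_norm g1 < \<infinity>" using order_le_less_trans[OF g1N ennreal_less_top] by simp
  have "sq_norm g2 \<le> sq_norm g" unfolding sq_norm_def g2_def by (intro nn_integral_mono) (auto simp: indicator_def)
  then have g2f: "sq_norm g2 < \<infinity>" using g by (rule order_le_less_trans)
  have g12: "g = (\<lambda>y. g1 y + g2 y)" by (auto simp: g1_def g2_def indicator_def)
  \<comment> \<open>Cauchy-Schwarz for the weight
    \<open>\<epsilon> * (tail_kernel \<epsilon> (x - y))\<^sup>2\<close>: its mass is at most 8, and
    it integrates \<open>(norm (g y))\<^sup>2\<close> to at most \<open>8 * A\<close>. The 1/3 of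
    the kernel estimate leaves \<open>64 / 9 * A\<close>, which is at most
    \<open>8 * A\<close>.\<close>
  have near: "(norm (tail_hilbert 1 \<delta> g2 x' - tail_hilbert 1 \<epsilon> g x))\<^sup>2 \<le> 8 * A" if x': "\<bar>x' - x\<bar> \<le> \<epsilon> / 4" for x'
  proof -
    let ?D = "\<lambda>y. (tail_kernel \<delta> (x' - y) - tail_kernel \<epsilon> (x - y)) *\<^sub>R g2 y"
    let ?p = "\<lambda>y. ennreal (sqrt \<epsilon> * \<bar>tail_kernel \<epsilon> (x - y)\<bar>)" and ?q = "\<lambda>y. ennreal (sqrt \<epsilon> * \<bar>tail_kernel \<epsilon> (x - y)\<bar> * norm (g y))"
    have i1: "integrable lborel (\<lambda>y. tail_kernel \<delta> (x' - y) *\<^sub>R g2 y)" "integrable lborel (\<lambda>y. tail_kernel \<epsilon> (x - y) *\<^sub>R g2 y)"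
      using \<delta> \<epsilon> g2f by (intro integrable_tail_hilbert_real_swap; simp)+
    have "tail_hilbert 1 \<epsilon> g x = (\<integral>y. tail_kernel \<epsilon> (x - y) *\<^sub>R g2 y \<partial>lborel)"
      unfolding tail_hilbert_real_swap by (intro Bochner_Integration.integral_cong) (auto simp: g2_def tail_kernel_def indicator_def dist_real_def)
    then have "tail_hilbert 1 \<delta> g2 x' - tail_hilbert 1 \<epsilon> g x = (\<integral>y. ?D y \<partial>lborel)"
      unfolding tail_hilbert_real_swap[of \<delta>] scaleR_diff_left using i1 by (simp add: Bochner_Integration.integral_diff)
    moreover have "integrable lborel ?D" unfolding scaleR_diff_left using i1 by (rule Bochner_Integration.integrable_diff)
    ultimately have "ennreal (norm (tail_hilbert 1 \<delta> g2 x' - tail_hilbert 1 \<epsilon> g x)) \<le> (\<integral>\<^sup>+y. ennreal (norm (?D y)) \<partial>lborel)"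
      by (simp only: integral_norm_bound_ennreal)
    also have "\<dots> \<le> (\<integral>\<^sup>+y. ennreal (1 / 3) * (?p y * ?q y) \<partial>lborel)"
    proof (rule nn_integral_mono)
      fix y
      have "norm (?D y) \<le> 1 / 3 * ((sqrt \<epsilon> * \<bar>tail_kernel \<epsilon> (x - y)\<bar>) * (sqrt \<epsilon> * \<bar>tail_kernel \<epsilon> (x - y)\<bar> * norm (g y)))"
      proof (cases "\<epsilon> < \<bar>x - y\<bar>")
        case True
        have "norm (?D y) = \<bar>tail_kernel \<delta> (x' - y) - tail_kernel \<epsilon> (x - y)\<bar> * norm (g y)"
          using True by (simp add: g2_def dist_real_def)
        also have "\<dots> \<le> 1 / 3 * (\<epsilon> * (tail_kernel \<epsilon> (x - y))\<^sup>2) * norm (g y)"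
          by (rule mult_right_mono[OF tail_kernel_difference_bound[OF \<delta> x' True]]) simp
        also have "\<epsilon> * (tail_kernel \<epsilon> (x - y))\<^sup>2 = (sqrt \<epsilon> * \<bar>tail_kernel \<epsilon> (x - y)\<bar>) * (sqrt \<epsilon> * \<bar>tail_kernel \<epsilon> (x - y)\<bar>)"
          using \<epsilon> by (simp add: power2_eq_square[symmetric] power_mult_distrib)
        finally show ?thesis by (simp only: mult.assoc)
      next
        case False
        then have "g2 y = 0" by (simp add: g2_def dist_real_def)
        then show ?thesis using \<epsilon> by simp
      qed
      then have "ennreal (norm (?D y)) \<le> ennreal (1 / 3 * ((sqrt \<epsilon> * \<bar>tail_kernel \<epsilon> (x - y)\<bar>) * (sqrt \<epsilon> * \<bar>tail_kernel \<epsilon> (x - y)\<bar> * norm (g y))))"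
        by (rule ennreal_leI)
      also have "\<dots> = ennreal (1 / 3) * (?p y * ?q y)"
        using \<epsilon> by (subst ennreal_mult, simp, simp, subst ennreal_mult) auto
      finally show "ennreal (norm (?D y)) \<le> ennreal (1 / 3) * (?p y * ?q y)" .
    qed
    also have "\<dots> = ennreal (1 / 3) * (\<integral>\<^sup>+y. ?p y * ?q y \<partial>lborel)" by (rule nn_integral_cmult) measurable
    finally have "(ennreal (norm (tail_hilbert 1 \<delta> g2 x' - tail_hilbert 1 \<epsilon> g x)))\<^sup>2 \<le> (ennreal (1 / 3) * (\<integral>\<^sup>+y. ?p y * ?q y \<partial>lborel))\<^sup>2"
      by (rule power_mono) simp
    also have "\<dots> = ennreal (1 / 9) * (\<integral>\<^sup>+y. ?p y * ?q y \<partial>lborel)\<^sup>2"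
      by (simp add: power_mult_distrib ennreal_power power_divide)
    also have "(\<integral>\<^sup>+y. ?p y * ?q y \<partial>lborel)\<^sup>2 \<le> (\<integral>\<^sup>+y. (?p y)\<^sup>2 \<partial>lborel) * (\<integral>\<^sup>+y. (?q y)\<^sup>2 \<partial>lborel)"
      by (rule Cauchy_Schwarz_nn_integral) measurable
    also have "(\<integral>\<^sup>+y. (?p y)\<^sup>2 \<partial>lborel) \<le> ennreal (8 * 1)"
    proof -
      have "(\<integral>\<^sup>+y. (?p y)\<^sup>2 \<partial>lborel) = (\<integral>\<^sup>+y. ennreal (\<epsilon> * (tail_kernel \<epsilon> (x - y))\<^sup>2) * 1 \<partial>lborel)"
        using \<epsilon> by (intro nn_integral_cong) (simp add: ennreal_power power_mult_distrib)
      also have "\<dots> \<le> ennreal (8 * 1)"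
        by (rule dyadic_tail_bound) (use \<epsilon> in \<open>auto simp: cball_eq_atLeastAtMost\<close>)
      finally show ?thesis .
    qed
    also have "(\<integral>\<^sup>+y. (?q y)\<^sup>2 \<partial>lborel) \<le> ennreal (8 * A)"
    proof -
      have "(\<integral>\<^sup>+y. (?q y)\<^sup>2 \<partial>lborel) = (\<integral>\<^sup>+y. ennreal (\<epsilon> * (tail_kernel \<epsilon> (x - y))\<^sup>2) * ennreal ((norm (g y))\<^sup>2) \<partial>lborel)"
        using \<epsilon> by (intro nn_integral_cong) (simp add: ennreal_power power_mult_distrib ennreal_mult)
      also have "\<dots> \<le> ennreal (8 * A)"
        by (rule dyadic_tail_bound) (use \<epsilon> A avg in auto)
      finally show ?thesis .
    qed
    finally have "(ennreal (norm (tail_hilbert 1 \<delta> g2 x' - tail_hilbert 1 \<epsilon> g x)))\<^sup>2 \<le> ennreal (1 / 9) * (ennreal (8 * 1) * ennreal (8 * A))"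
      by (simp add: mult_left_mono mult_right_mono)
    also have "\<dots> = ennreal (1 / 9 * (8 * 1 * (8 * A)))"
      using A by (simp only: ennreal_mult[symmetric] mult_nonneg_nonneg)
    finally have "ennreal ((norm (tail_hilbert 1 \<delta> g2 x' - tail_hilbert 1 \<epsilon> g x))\<^sup>2) \<le> ennreal (1 / 9 * (8 * 1 * (8 * A)))"
      by (simp add: ennreal_power)
    then have "(norm (tail_hilbert 1 \<delta> g2 x' - tail_hilbert 1 \<epsilon> g x))\<^sup>2 \<le> 1 / 9 * (8 * 1 * (8 * A))"
      using A by (subst (asm) ennreal_le_iff) auto
    then show ?thesis using A by simp
  qed
  let ?X = "(norm (tail_hilbert 1 \<epsilon> g x))\<^sup>2"
  have pt: "?X \<le> 3 * (8 * A) + 3 * (norm (tail_hilbert 1 \<delta> g x'))\<^sup>2 + 3 * (norm (tail_hilbert 1 \<delta> g1 x'))\<^sup>2" if x': "\<bar>x' - x\<bar> \<le> \<epsilon> / 4" for x'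
  proof -
    have "tail_hilbert 1 \<delta> (\<lambda>y. g y - g1 y) x' = tail_hilbert 1 \<delta> g x' - tail_hilbert 1 \<delta> g1 x'"
      by (intro tail_hilbert_diff line_integrable_real) (use g g1f \<delta> in auto)
    moreover have "(\<lambda>y. g y - g1 y) = g2" unfolding g12 by simp
    ultimately have e: "tail_hilbert 1 \<delta> g2 x' = tail_hilbert 1 \<delta> g x' - tail_hilbert 1 \<delta> g1 x'" by simp
    define a b c where "a = norm (tail_hilbert 1 \<delta> g2 x' - tail_hilbert 1 \<epsilon> g x)" and "b = norm (tail_hilbert 1 \<delta> g x')" and "c = norm (tail_hilbert 1 \<delta> g1 x')"
    have "norm (tail_hilbert 1 \<epsilon> g x) \<le> a + b + c"
      unfolding a_def b_def c_def e by norm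
    then have "?X \<le> (a + b + c)\<^sup>2" by (intro power_mono) auto
    also have "\<dots> \<le> 3 * a\<^sup>2 + 3 * b\<^sup>2 + 3 * c\<^sup>2"
      using sum_squares_bound[of a b] sum_squares_bound[of a c] sum_squares_bound[of b c]
      by (simp add: power2_eq_square algebra_simps)
    also have "a\<^sup>2 \<le> 8 * A" unfolding a_def by (rule near[OF x'])
    finally show ?thesis unfolding b_def c_def by simp
  qed
  let ?J = "cball x (\<epsilon> / 4)"
  have mJ: "emeasure lborel ?J = ennreal (\<epsilon> / 2)" using \<epsilon> by (simp add: cball_eq_atLeastAtMost)
  have "ennreal (?X * (\<epsilon> / 2)) = ennreal ?X * emeasure lborel ?J"
    unfolding mJ using \<epsilon> by (intro ennreal_mult) auto
  also have "\<dots> = (\<integral>\<^sup>+x'. ennreal ?X * indicator ?J x' \<partial>lborel)" by (simp add: nn_integral_cmult_indicator)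
  also have "\<dots> \<le> (\<integral>\<^sup>+x'. ennreal (3 * (8 * A)) * indicator ?J x' + ennreal 3 * (ennreal ((norm (tail_hilbert 1 \<delta> g x'))\<^sup>2) * indicator ?J x') + ennreal 3 * ennreal ((norm (tail_hilbert 1 \<delta> g1 x'))\<^sup>2) \<partial>lborel)"
  proof (rule nn_integral_mono)
    fix x'
    show "ennreal ?X * indicator ?J x' \<le> ennreal (3 * (8 * A)) * indicator ?J x' + ennreal 3 * (ennreal ((norm (tail_hilbert 1 \<delta> g x'))\<^sup>2) * indicator ?J x') + ennreal 3 * ennreal ((norm (tail_hilbert 1 \<delta> g1 x'))\<^sup>2)"
    proof (cases "x' \<in> ?J")
      case True
      then have "\<bar>x' - x\<bar> \<le> \<epsilon> / 4" by (simp add: dist_real_def abs_minus_commute)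
      from pt[OF this] have "ennreal ?X \<le> ennreal (3 * (8 * A) + 3 * (norm (tail_hilbert 1 \<delta> g x'))\<^sup>2 + 3 * (norm (tail_hilbert 1 \<delta> g1 x'))\<^sup>2)"
        by (rule ennreal_leI)
      also have "\<dots> = ennreal (3 * (8 * A)) + ennreal 3 * ennreal ((norm (tail_hilbert 1 \<delta> g x'))\<^sup>2) + ennreal 3 * ennreal ((norm (tail_hilbert 1 \<delta> g1 x'))\<^sup>2)"
        using A by (simp add: ennreal_mult)
      finally show ?thesis using True by simp
    qed simp
  qed
  also have "\<dots> = ennreal (3 * (8 * A)) * emeasure lborel ?J + ennreal 3 * (\<integral>\<^sup>+x'. ennreal ((norm (tail_hilbert 1 \<delta> g x'))\<^sup>2) * indicator ?J x' \<partial>lborel) + ennreal 3 * sq_norm (tail_hilbert 1 \<delta> g1)"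
    unfolding sq_norm_def by (simp add: nn_integral_add nn_integral_cmult nn_integral_cmult_indicator del: ennreal_numeral)
  also have "\<dots> \<le> ennreal (3 * (8 * A)) * ennreal (\<epsilon> / 2) + ennreal 3 * ennreal (2 * (\<epsilon> / 4) * A) + ennreal 3 * (ennreal C * ennreal (2 * \<epsilon> * A))"
  proof (intro add_mono mult_left_mono)
    show "sq_norm (tail_hilbert 1 \<delta> g1) \<le> ennreal C * ennreal (2 * \<epsilon> * A)"
    proof -
      have "sq_norm (tail_hilbert 1 \<delta> g1) \<le> ennreal C * sq_norm g1" by (rule C(2)) (use g1f in auto)
      also have "\<dots> \<le> ennreal C * ennreal (2 * \<epsilon> * A)" by (rule mult_left_mono[OF g1N]) simp
      finally show ?thesis .
    qed
  qed (use mJ avgT[of "\<epsilon> / 4"] \<epsilon> in auto)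
  also have "\<dots> = ennreal (3 * (8 * A) * (\<epsilon> / 2) + 3 * (2 * (\<epsilon> / 4) * A) + 3 * (C * (2 * \<epsilon> * A)))"
    using A \<epsilon> C(1) by (simp add: ennreal_mult[symmetric] ennreal_plus[symmetric] del: ennreal_plus ennreal_numeral)
  finally have "?X * (\<epsilon> / 2) \<le> 3 * (8 * A) * (\<epsilon> / 2) + 3 * (2 * (\<epsilon> / 4) * A) + 3 * (C * (2 * \<epsilon> * A))"
    using A \<epsilon> C(1) by (subst (asm) ennreal_le_iff) auto
  \<comment> \<open>Relative to the length \<open>\<epsilon> / 2\<close> of the ball the three terms
    contribute \<open>24 * A\<close>, \<open>3 * A\<close> and \<open>12 * C * A\<close>.\<close>
  also have "\<dots> = ((27 + 12 * C) * A) * (\<epsilon> / 2)" by (simp add: field_simps)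
  finally show ?thesis using \<epsilon> by simp
qed

section \<open>Principal values on the line\<close>

text \<open>Outside the exceptional sets of the maximal inequality for \<open>g\<close> and for its
  truncation at \<delta>, Cotlar's inequality bounds all truncations beyond
  \<open>2 * \<delta>\<close> at once. The bound for the measure of these sets does not depend on
  \<delta>, so \<delta> may tend to 0.\<close>

lemma tail_hilbert_maximal_weak_type:
  "\<exists>D\<ge>0. \<forall>(g :: real \<Rightarrow> complex) s. g \<in> borel_measurable borel \<longrightarrow> sq_norm g < \<infinity> \<longrightarrow> 0 < s \<longrightarrow>
     emeasure lborel {x. \<exists>p::rat. 0 < p \<and> s < norm (tail_hilbert 1 (of_rat p) g x)} \<le> ennreal (D / s\<^sup>2) * sq_norm g"
proof -
  obtain C where C: "0 \<le> C" "\<And>e \<epsilon> f. 0 < \<epsilon> \<Longrightarrow> f \<in> borel_measurable borel \<Longrightarrow> sq_norm f < \<infinity> \<Longrightarrow>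
     (AE x in lborel. line_integrable e f x) \<Longrightarrow> sq_norm (tail_hilbert (e::real) \<epsilon> f) \<le> ennreal C * sq_norm f"
    using sq_norm_tail_hilbert[where 'a=real] by blast
  define c where "c = 27 + 12 * C"
  have c: "0 < c" using C by (simp add: c_def)
  define D where "D = 5 * c * (1 + C)"
  have D: "0 \<le> D" using C c by (simp add: D_def)
  have "emeasure lborel {x. \<exists>p::rat. 0 < p \<and> s < norm (tail_hilbert 1 (of_rat p) g x)} \<le> ennreal (D / s\<^sup>2) * sq_norm g"
    if [measurable]: "g \<in> borel_measurable borel" and g: "sq_norm g < \<infinity>" and s: "0 < s" for g :: "real \<Rightarrow> complex" and s
  proof -
    \<comment> \<open>The radii exceed \<open>2 * \<delta>\<close> for
      \<open>\<delta> = 1 / real (Suc n)\<close>, which secures the condition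
      \<open>\<delta> < 3 / 4 * \<epsilon>\<close> of \<open>Cotlar_pointwise\<close>.\<close>
    define E where "E n = {x. \<exists>p::rat. 2 / real (Suc n) < of_rat p \<and> s < norm (tail_hilbert 1 (of_rat p) g x)}" for n
    have Em [measurable]: "E n \<in> sets borel" for n unfolding E_def by measurable
    \<comment> \<open>At this level Cotlar's bound \<open>c * A\<close> is exactly
      \<open>s\<^sup>2\<close>.\<close>
    define A where "A = s\<^sup>2 / c"
    have A: "0 < A" using s c by (simp add: A_def)
    have le: "emeasure lborel (E n) \<le> ennreal (D / s\<^sup>2) * sq_norm g" for n
    proof -
      define \<delta> where "\<delta> = 1 / real (Suc n)"
      have \<delta>: "0 < \<delta>" by (simp add: \<delta>_def)
      have CT: "sq_norm (tail_hilbert 1 \<delta> f) \<le> ennreal C * sq_norm f" if "f \<in> borel_measurable borel" "sq_norm f < \<infinity>" for f :: "real \<Rightarrow> complex"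
        using that \<delta> by (intro C AE_I2 line_integrable_real) auto
      have T: "sq_norm (tail_hilbert 1 \<delta> g) < \<infinity>"
        using order_le_less_trans[OF CT[OF that(1) g]] g by (simp add: ennreal_mult_less_top)
      obtain T1 where T1: "T1 \<in> sets borel" "{x. \<exists>r>0. ennreal (2 * r * A) < (\<integral>\<^sup>+y. ennreal ((norm (g y))\<^sup>2) * indicator (cball x r) y \<partial>lborel)} \<subseteq> T1"
        "emeasure lborel T1 \<le> ennreal (5 / A) * sq_norm g"
        using maximal_weak_type[of "\<lambda>y. ennreal ((norm (g y))\<^sup>2)" A] g A unfolding sq_norm_def by auto
      obtain T2 where T2: "T2 \<in> sets borel" "{x. \<exists>r>0. ennreal (2 * r * A) < (\<integral>\<^sup>+y. ennreal ((norm (tail_hilbert 1 \<delta> g y))\<^sup>2) * indicator (cball x r) y \<partial>lborel)} \<subseteq> T2"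
        "emeasure lborel T2 \<le> ennreal (5 / A) * sq_norm (tail_hilbert 1 \<delta> g)"
        using maximal_weak_type[of "\<lambda>y. ennreal ((norm (tail_hilbert 1 \<delta> g y))\<^sup>2)" A] T A unfolding sq_norm_def by auto
      have "E n \<subseteq> T1 \<union> T2"
      proof
        fix x assume "x \<in> E n"
        then obtain p :: rat where p: "2 * \<delta> < of_rat p" "s < norm (tail_hilbert 1 (of_rat p) g x)" by (auto simp: E_def \<delta>_def)
        show "x \<in> T1 \<union> T2"
        proof (rule ccontr)
          assume x: "x \<notin> T1 \<union> T2"
          have "(norm (tail_hilbert 1 (of_rat p) g x))\<^sup>2 \<le> (27 + 12 * C) * A"
          proof (rule Cotlar_pointwise[OF _ g \<delta>])
            show "\<delta> < 3 / 4 * of_rat p" using p \<delta> by simp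
            show "(\<integral>\<^sup>+y. ennreal ((norm (g y))\<^sup>2) * indicator (cball x r) y \<partial>lborel) \<le> ennreal (2 * r * A)" if "0 < r" for r
              using x T1(2) that by (intro leI notI) blast
            show "(\<integral>\<^sup>+y. ennreal ((norm (tail_hilbert 1 \<delta> g y))\<^sup>2) * indicator (cball x r) y \<partial>lborel) \<le> ennreal (2 * r * A)" if "0 < r" for r
              using x T2(2) that by (intro leI notI) blast
            show "sq_norm (tail_hilbert 1 \<delta> f) \<le> ennreal C * sq_norm f" if "f \<in> borel_measurable borel" "sq_norm f < \<infinity>" for f :: "real \<Rightarrow> complex"
              by (rule CT[OF that])
            show "0 \<le> A" using A by (rule less_imp_le)
            show "g \<in> borel_measurable borel" by (rule that(1))
          qed (rule C(1))
          also have "\<dots> = s\<^sup>2" unfolding c_def[symmetric] A_def using c by simp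
          finally have sq: "(norm (tail_hilbert 1 (of_rat p) g x))\<^sup>2 \<le> s\<^sup>2" .
          have "norm (tail_hilbert 1 (of_rat p) g x) \<le> s"
            by (rule power2_le_imp_le[OF sq]) (use s in simp)
          then show False using p by simp
        qed
      qed
      then have "emeasure lborel (E n) \<le> emeasure lborel (T1 \<union> T2)" using T1 T2 by (intro emeasure_mono) auto
      also have "\<dots> \<le> emeasure lborel T1 + emeasure lborel T2" using T1 T2 by (intro emeasure_subadditive) auto
      also have "\<dots> \<le> ennreal (5 / A) * sq_norm g + ennreal (5 / A) * (ennreal C * sq_norm g)"
        using order_trans[OF T2(3) mult_left_mono[OF CT[OF that(1) g]]] by (intro add_mono T1(3)) simp
      also have "\<dots> = (ennreal (5 / A) + ennreal (5 / A) * ennreal C) * sq_norm g" by (simp add: distrib_right mult.assoc)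
      also have "ennreal (5 / A) + ennreal (5 / A) * ennreal C = ennreal (5 / A + 5 / A * C)"
        using A C(1) by (simp add: ennreal_mult[symmetric] ennreal_plus[symmetric] del: ennreal_plus)
      also have "5 / A + 5 / A * C = D / s\<^sup>2" using s c by (simp add: A_def D_def field_simps)
      finally show ?thesis .
    qed
    have "incseq E"
    proof (rule incseq_SucI, rule subsetI)
      fix n x assume "x \<in> E n"
      then obtain p :: rat where p: "2 / real (Suc n) < of_rat p" "s < norm (tail_hilbert 1 (of_rat p) g x)" by (auto simp: E_def)
      have "2 / real (Suc (Suc n)) \<le> 2 / real (Suc n)" by (intro divide_left_mono) auto
      then have "2 / real (Suc (Suc n)) < of_rat p" using p(1) by linarith
      then show "x \<in> E (Suc n)" using p(2) unfolding E_def by blast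
    qed
    then have "(SUP n. emeasure lborel (E n)) = emeasure lborel (\<Union>n. E n)"
      by (intro SUP_emeasure_incseq) auto
    moreover have "(\<Union>n. E n) = {x. \<exists>p::rat. 0 < p \<and> s < norm (tail_hilbert 1 (of_rat p) g x)}"
    proof safe
      fix x n assume "x \<in> E n"
      then obtain p :: rat where p: "2 / real (Suc n) < of_rat p" "s < norm (tail_hilbert 1 (of_rat p) g x)" by (auto simp: E_def)
      moreover have "0 < 2 / real (Suc n)" by simp
      ultimately have "0 < (of_rat p :: real)" by linarith
      then have "0 < p" by (simp only: zero_less_of_rat_iff)
      then show "\<exists>p::rat. 0 < p \<and> s < norm (tail_hilbert 1 (of_rat p) g x)" using p(2) by blast
    next
      fix x and p :: rat assume p: "0 < p" "s < norm (tail_hilbert 1 (of_rat p) g x)"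
      then have "0 < (of_rat p :: real) / 2" by simp
      then obtain n where "inverse (real (Suc n)) < of_rat p / 2" using reals_Archimedean by blast
      moreover have "2 / real (Suc n) = 2 * inverse (real (Suc n))" by (rule divide_inverse)
      ultimately have "2 / real (Suc n) < of_rat p" by linarith
      then show "x \<in> (\<Union>n. E n)" using p unfolding E_def by blast
    qed
    moreover have "(SUP n. emeasure lborel (E n)) \<le> ennreal (D / s\<^sup>2) * sq_norm g" by (intro SUP_least le)
    ultimately show ?thesis by simp
  qed
  then show ?thesis using D by blast
qed

text \<open>Only rational truncations occur, to keep the set of convergence measurable; right continuity in the
  truncation recovers the real ones.\<close>

definition pv_osc :: "'a::euclidean_space \<Rightarrow> ('a \<Rightarrow> complex) \<Rightarrow> nat \<Rightarrow> 'a \<Rightarrow> bool" where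
  "pv_osc e f k x \<longleftrightarrow> (\<exists>n::nat. \<forall>p q::rat. 0 < p \<longrightarrow> of_rat p < 1 / real (Suc n) \<longrightarrow> 0 < q \<longrightarrow> of_rat q < 1 / real (Suc n) \<longrightarrow>
     norm (tail_hilbert e (of_rat p) f x - tail_hilbert e (of_rat q) f x) \<le> 1 / real (Suc k))"

lemma pv_osc_measurable [measurable]:
  assumes [measurable]: "f \<in> borel_measurable borel"
  shows "Measurable.pred borel (pv_osc e f k)"
  unfolding pv_osc_def by measurable

lemma rat_decreasing_to:
  fixes a b :: real
  assumes "a < b"
  obtains s :: "nat \<Rightarrow> rat" where "\<And>n. a < of_rat (s n)" "\<And>n. of_rat (s n) < b" "(\<lambda>n. of_rat (s n)) \<longlonglongrightarrow> a"
proof -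
  have "\<exists>q::rat. a < of_rat q \<and> of_rat q < min b (a + 1 / real (Suc n))" for n
    using of_rat_dense[of a "min b (a + 1 / real (Suc n))"] assms by auto
  then obtain s :: "nat \<Rightarrow> rat" where s: "\<And>n. a < of_rat (s n)" "\<And>n. of_rat (s n) < min b (a + 1 / real (Suc n))" by metis
  have "(\<lambda>n. a + 1 / real (Suc n)) \<longlonglongrightarrow> a" by real_asymp
  then have "(\<lambda>n. of_rat (s n)) \<longlonglongrightarrow> a"
    by (rule tendsto_sandwich[OF _ _ tendsto_const, rotated 2]) (use s in \<open>auto intro!: always_eventually less_imp_le\<close>)
  then show thesis using s by (intro that[of s]) auto
qed

lemma pv_limit_exists:
  assumes f: "line_integrable e f x" and [measurable]: "f \<in> borel_measurable borel" and osc: "\<And>k. pv_osc e f k x"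
  shows "\<exists>l. ((\<lambda>\<epsilon>. tail_hilbert e \<epsilon> f x) \<longlongrightarrow> l) (at_right 0)"
proof -
  let ?F = "\<lambda>\<epsilon>. tail_hilbert e \<epsilon> f x"
  have real_osc: "\<exists>n::nat. \<forall>a b. 0 < a \<longrightarrow> a < 1 / real (Suc n) \<longrightarrow> 0 < b \<longrightarrow> b < 1 / real (Suc n) \<longrightarrow> norm (?F a - ?F b) \<le> 1 / real (Suc k)" for k
  proof -
    obtain n where n: "\<And>p q::rat. 0 < p \<Longrightarrow> of_rat p < 1 / real (Suc n) \<Longrightarrow> 0 < q \<Longrightarrow> of_rat q < 1 / real (Suc n) \<Longrightarrow>
      norm (?F (of_rat p) - ?F (of_rat q)) \<le> 1 / real (Suc k)"
      using osc[of k] unfolding pv_osc_def by blast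
    have "norm (?F a - ?F b) \<le> 1 / real (Suc k)" if ab: "0 < a" "a < 1 / real (Suc n)" "0 < b" "b < 1 / real (Suc n)" for a b
    proof -
      obtain s :: "nat \<Rightarrow> rat" where s: "\<And>m. a < of_rat (s m)" "\<And>m. of_rat (s m) < 1 / real (Suc n)" "(\<lambda>m. of_rat (s m)) \<longlonglongrightarrow> a"
        using rat_decreasing_to[OF ab(2)] by blast
      obtain r :: "nat \<Rightarrow> rat" where r: "\<And>m. b < of_rat (r m)" "\<And>m. of_rat (r m) < 1 / real (Suc n)" "(\<lambda>m. of_rat (r m)) \<longlonglongrightarrow> b"
        using rat_decreasing_to[OF ab(4)] by blast
      have "(\<lambda>m. ?F (of_rat (s m))) \<longlonglongrightarrow> ?F a" "(\<lambda>m. ?F (of_rat (r m))) \<longlonglongrightarrow> ?F b"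
        using ab s r by (auto intro!: tail_hilbert_right_continuous[OF f])
      then have lim: "(\<lambda>m. norm (?F (of_rat (s m)) - ?F (of_rat (r m)))) \<longlonglongrightarrow> norm (?F a - ?F b)"
        by (intro tendsto_intros)
      have pos: "0 < s m" "0 < r m" for m
      proof -
        have "0 < (of_rat (s m) :: real)" "0 < (of_rat (r m) :: real)" using s(1)[of m] r(1)[of m] ab by linarith+
        then show "0 < s m" "0 < r m" by auto
      qed
      show ?thesis by (rule LIMSEQ_le_const2[OF lim]) (use n pos s r in blast)
    qed
    then show ?thesis by blast
  qed
  \<comment> \<open>The shift by two puts the sample point strictly below
    \<open>1 / real (Suc n)\<close> as soon as \<open>n \<le> m\<close>.\<close>
  define c where "c m = ?F (1 / real (Suc (Suc m)))" for m
  have cm: "0 < 1 / real (Suc (Suc m))" "n \<le> m \<Longrightarrow> 1 / real (Suc (Suc m)) < 1 / real (Suc n)" for m n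
    by (auto intro!: divide_strict_left_mono)
  have "Cauchy c"
  proof (rule metric_CauchyI)
    fix r :: real assume "0 < r"
    then obtain k where k: "inverse (real (Suc k)) < r" using reals_Archimedean by blast
    obtain n where n: "\<And>a b. 0 < a \<Longrightarrow> a < 1 / real (Suc n) \<Longrightarrow> 0 < b \<Longrightarrow> b < 1 / real (Suc n) \<Longrightarrow> norm (?F a - ?F b) \<le> 1 / real (Suc k)"
      using real_osc[of k] by blast
    have "dist (c m) (c m') < r" if "n \<le> m" "n \<le> m'" for m m'
      using n[OF cm(1) cm(2)[OF that(1)] cm(1) cm(2)[OF that(2)]] k by (simp add: c_def dist_norm inverse_eq_divide)
    then show "\<exists>M. \<forall>m\<ge>M. \<forall>n\<ge>M. dist (c m) (c n) < r" by blast
  qed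
  then obtain l where l: "c \<longlonglongrightarrow> l" using Cauchy_convergent convergentD by blast
  have "(?F \<longlongrightarrow> l) (at_right 0)"
  proof (rule tendstoI)
    fix r :: real assume "0 < r"
    then obtain k where k: "inverse (real (Suc k)) < r" using reals_Archimedean by blast
    obtain n where n: "\<And>a b. 0 < a \<Longrightarrow> a < 1 / real (Suc n) \<Longrightarrow> 0 < b \<Longrightarrow> b < 1 / real (Suc n) \<Longrightarrow> norm (?F a - ?F b) \<le> 1 / real (Suc k)"
      using real_osc[of k] by blast
    have le: "dist (?F a) l < r" if a: "0 < a" "a < 1 / real (Suc n)" for a
    proof -
      have "(\<lambda>m. norm (?F a - c m)) \<longlonglongrightarrow> norm (?F a - l)" by (intro tendsto_intros l)
      moreover have "\<exists>N. \<forall>m\<ge>N. norm (?F a - c m) \<le> 1 / real (Suc k)"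
        using n[OF a cm(1) cm(2)] unfolding c_def by blast
      ultimately have "norm (?F a - l) \<le> 1 / real (Suc k)" by (rule LIMSEQ_le_const2)
      then show ?thesis using k by (simp add: dist_norm inverse_eq_divide)
    qed
    show "\<forall>\<^sub>F \<epsilon> in at_right 0. dist (?F \<epsilon>) l < r"
      unfolding eventually_at_right_field using le by (intro exI[of _ "1 / real (Suc n)"]) auto
  qed
  then show ?thesis by blast
qed

text \<open>The band kernel is odd and has integral 0, so \<open>g x\<close> may be subtracted. The
  Lipschitz bound then cancels the singularity, and the integrand is at most \<open>L\<close> on an
  interval of length \<open>2 * q\<close>.\<close>

lemma tail_hilbert_test_fn_increment:
  fixes g :: "real \<Rightarrow> complex"
  assumes g: "test_fn g" and L: "0 \<le> L" "\<And>x y. norm (g x - g y) \<le> L * norm (x - y)" and pq: "0 < p" "p \<le> q"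
  shows "norm (tail_hilbert 1 p g x - tail_hilbert 1 q g x) \<le> 2 * q * L"
proof -
  note [measurable] = test_fn_measurable[OF g]
  note k = tail_kernel_diff_integrable[OF pq]
  obtain B where B: "\<And>x. norm (g x) \<le> B" using test_fnE[OF g] by metis
  have "line_integrable 1 g x" using sq_norm_test_fn_finite[OF g] by (intro line_integrable_real) auto
  then have "tail_hilbert 1 p g x - tail_hilbert 1 q g x = band_hilbert 1 p q g x" using pq by (intro band_hilbert_eq_tail_hilbert[symmetric]) auto
  also have "\<dots> = (\<integral>t. (tail_kernel p t - tail_kernel q t) *\<^sub>R (g (x - t) - g x) \<partial>lborel)"
  proof -
    have i1: "integrable lborel (\<lambda>t. (tail_kernel p t - tail_kernel q t) *\<^sub>R g (x - t))"
      by (rule integrable_scaleR_bounded[OF k _ B]) measurable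
    have i2: "integrable lborel (\<lambda>t. (tail_kernel p t - tail_kernel q t) *\<^sub>R g x)" using k by (rule integrable_scaleR_left)
    have "(\<integral>t. (tail_kernel p t - tail_kernel q t) *\<^sub>R (g (x - t) - g x) \<partial>lborel) = band_hilbert 1 p q g x - (\<integral>t. (tail_kernel p t - tail_kernel q t) *\<^sub>R g x \<partial>lborel)"
      unfolding band_hilbert_def scaleR_diff_right real_scaleR_def mult_1_right
      using i1 i2 by (simp add: Bochner_Integration.integral_diff)
    moreover have "(\<integral>t. (tail_kernel p t - tail_kernel q t) *\<^sub>R g x \<partial>lborel) = 0"
      using integral_scaleR_left[OF k, of "g x"] by (simp add: tail_kernel_diff_integral)
    ultimately show ?thesis by simp
  qed
  finally have "norm (tail_hilbert 1 p g x - tail_hilbert 1 q g x) \<le> (\<integral>t. norm ((tail_kernel p t - tail_kernel q t) *\<^sub>R (g (x - t) - g x)) \<partial>lborel)"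
    by (simp only: integral_norm_bound)
  also have "\<dots> \<le> (\<integral>t. L * indicator {-q..q} t \<partial>lborel)"
  proof (rule integral_mono')
    show "integrable lborel (\<lambda>t. L * indicator {-q..q} t)"
      using pq by (intro integrable_mult_right) (auto simp: integrable_indicator_iff emeasure_lborel_Icc_eq)
    show "norm ((tail_kernel p t - tail_kernel q t) *\<^sub>R (g (x - t) - g x)) \<le> L * indicator {-q..q} t" for t
    proof (cases "p < \<bar>t\<bar> \<and> \<bar>t\<bar> \<le> q")
      case True
      then have t: "0 < \<bar>t\<bar>" using pq by linarith
      have "norm ((tail_kernel p t - tail_kernel q t) *\<^sub>R (g (x - t) - g x)) = norm (g (x - t) - g x) / \<bar>t\<bar>"
        using True by (simp add: tail_kernel_diff[OF pq(2)])
      also have "\<dots> \<le> L * \<bar>t\<bar> / \<bar>t\<bar>" using L(2)[of "x - t" x] t by (intro divide_right_mono) auto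
      also have "\<dots> = L" using t by simp
      finally show ?thesis using True by (auto simp: indicator_def)
    next
      case False
      then have "tail_kernel p t - tail_kernel q t = 0" unfolding tail_kernel_diff[OF pq(2)] by (rule if_not_P)
      then show ?thesis using L(1) by simp
    qed
  qed (use L in auto)
  also have "\<dots> = L * (2 * q)" using pq by simp
  finally show ?thesis by (simp add: mult_ac)
qed

lemma pv_osc_test_fn:
  fixes g :: "real \<Rightarrow> complex"
  assumes g: "test_fn g"
  shows "pv_osc 1 g k x"
proof -
  obtain L r B where L: "0 \<le> L" "\<And>x y. norm (g x - g y) \<le> L * norm (x - y)" using test_fnE[OF g] by metis
  \<comment> \<open>The added 1 guards against \<open>L = 0\<close>.\<close>
  have pos: "0 < 1 / (real (Suc k) * (2 * L + 1))" using L by simp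
  obtain n where n: "inverse (real (Suc n)) < 1 / (real (Suc k) * (2 * L + 1))" using reals_Archimedean[OF pos] by blast
  have main: "norm (tail_hilbert 1 p g x - tail_hilbert 1 q g x) \<le> 1 / real (Suc k)" if pq: "0 < p" "p \<le> q" "q < 1 / real (Suc n)" for p q
  proof -
    have "norm (tail_hilbert 1 p g x - tail_hilbert 1 q g x) \<le> 2 * q * L" by (rule tail_hilbert_test_fn_increment[OF g L pq(1,2)])
    also have "\<dots> \<le> q * (2 * L + 1)" using pq by (simp add: algebra_simps)
    also have "\<dots> \<le> (1 / (real (Suc k) * (2 * L + 1))) * (2 * L + 1)"
      using pq n L by (intro mult_right_mono) (auto simp: inverse_eq_divide)
    also have "\<dots> = 1 / real (Suc k)" using L by simp
    finally show ?thesis .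
  qed
  show ?thesis unfolding pv_osc_def
  proof (intro exI[of _ n] allI impI)
    fix p q :: rat assume *: "0 < p" "of_rat p < 1 / real (Suc n)" "0 < q" "of_rat q < 1 / real (Suc n)"
    show "norm (tail_hilbert 1 (of_rat p) g x - tail_hilbert 1 (of_rat q) g x) \<le> 1 / real (Suc k)"
    proof (cases "p \<le> q")
      case True
      then show ?thesis using * by (intro main) (auto simp: of_rat_less_eq)
    next
      case False
      then have "norm (tail_hilbert 1 (of_rat q) g x - tail_hilbert 1 (of_rat p) g x) \<le> 1 / real (Suc k)"
        using * by (intro main) (auto simp: of_rat_less_eq)
      then show ?thesis by (simp add: norm_minus_commute)
    qed
  qed
qed

text \<open>The truncations of a nearby test function settle down everywhere, and the maximal
  inequality controls the difference at all truncations simultaneously, outside a set whose measure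
  tends to 0 with the error of approximation. The level \<open>s\<close> is fixed before the
  approximation is chosen.\<close>

lemma pv_osc_AE_real:
  fixes g :: "real \<Rightarrow> complex"
  assumes [measurable]: "g \<in> borel_measurable borel" and g: "sq_norm g < \<infinity>"
  shows "AE x in lborel. pv_osc 1 g k x"
proof -
  obtain D where D: "0 \<le> D" "\<And>(g :: real \<Rightarrow> complex) s. g \<in> borel_measurable borel \<Longrightarrow> sq_norm g < \<infinity> \<Longrightarrow> 0 < s \<Longrightarrow>
     emeasure lborel {x. \<exists>p::rat. 0 < p \<and> s < norm (tail_hilbert 1 (of_rat p) g x)} \<le> ennreal (D / s\<^sup>2) * sq_norm g"
    using tail_hilbert_maximal_weak_type by blast
  \<comment> \<open>The budget \<open>1 / real (Suc k)\<close> is split: \<open>s\<close> for each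
    of the two truncations of the error, and one half, \<open>1 / real (Suc (2 * k + 1))\<close>,
    for the oscillation of the test function.\<close>
  define s where "s = 1 / (4 * real (Suc k))"
  have s: "0 < s" by (simp add: s_def)
  have "emeasure lborel {x. \<not> pv_osc 1 g k x} \<le> 0"
  proof (rule ennreal_le_epsilon)
    fix \<eta> :: real assume \<eta>: "0 < \<eta>"
    define d where "d = \<eta> / (D / s\<^sup>2 + 1)"
    have den: "0 < D / s\<^sup>2 + 1" using D(1) s by (simp add: add_nonneg_pos)
    have d: "0 < d" using \<eta> den by (simp add: d_def)
    obtain u where u: "test_fn u" "sq_norm (\<lambda>x. g x - u x) \<le> ennreal d" using test_fn_dense[of g d] g d by auto
    have [measurable]: "u \<in> borel_measurable borel" using u by (intro test_fn_measurable)
    have fin: "sq_norm (\<lambda>x. g x - u x) < \<infinity>" using order_le_less_trans[OF u(2) ennreal_less_top] by simp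
    let ?E = "{x. \<exists>p::rat. 0 < p \<and> s < norm (tail_hilbert 1 (of_rat p) (\<lambda>x. g x - u x) x)}"
    have "{x. \<not> pv_osc 1 g k x} \<subseteq> ?E"
    proof (rule subsetI, rule ccontr)
      fix x assume x: "x \<in> {x. \<not> pv_osc 1 g k x}" "x \<notin> ?E"
      have li: "line_integrable 1 g x" "line_integrable 1 u x"
        using g sq_norm_test_fn_finite[OF u(1)] by (auto intro: line_integrable_real)
      obtain n where n: "\<And>p q::rat. 0 < p \<Longrightarrow> of_rat p < 1 / real (Suc n) \<Longrightarrow> 0 < q \<Longrightarrow> of_rat q < 1 / real (Suc n) \<Longrightarrow>
        norm (tail_hilbert 1 (of_rat p) u x - tail_hilbert 1 (of_rat q) u x) \<le> 1 / real (Suc (2 * k + 1))"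
        using pv_osc_test_fn[OF u(1), of "2 * k + 1" x] unfolding pv_osc_def by blast
      have small: "norm (tail_hilbert 1 (of_rat p) g x - tail_hilbert 1 (of_rat p) u x) \<le> s" if "0 < p" for p :: rat
      proof -
        have "\<not> s < norm (tail_hilbert 1 (of_rat p) (\<lambda>x. g x - u x) x)" using x(2) that by blast
        then show ?thesis using that tail_hilbert_diff[OF li, of "of_rat p"] by simp
      qed
      have "pv_osc 1 g k x" unfolding pv_osc_def
      proof (intro exI[of _ n] allI impI)
        fix p q :: rat assume pq: "0 < p" "of_rat p < 1 / real (Suc n)" "0 < q" "of_rat q < 1 / real (Suc n)"
        define a b a' b' where "a = tail_hilbert 1 (of_rat p) g x" and "b = tail_hilbert 1 (of_rat q) g x" and "a' = tail_hilbert 1 (of_rat p) u x" and "b' = tail_hilbert 1 (of_rat q) u x"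
        have "norm (a - b) \<le> norm (a - a') + norm (b - b') + norm (a' - b')" by norm
        also have "\<dots> \<le> s + s + 1 / real (Suc (2 * k + 1))"
          unfolding a_def b_def a'_def b'_def by (intro add_mono small n pq)
        also have "\<dots> = 1 / real (Suc k)"
        proof -
          have "real (Suc (2 * k + 1)) = 2 * real (Suc k)" by simp
          then show ?thesis unfolding s_def by (simp only:) (simp add: divide_simps del: of_nat_Suc)
        qed
        finally show "norm (tail_hilbert 1 (of_rat p) g x - tail_hilbert 1 (of_rat q) g x) \<le> 1 / real (Suc k)" unfolding a_def b_def .
      qed
      then show False using x(1) by simp
    qed
    then have "emeasure lborel {x. \<not> pv_osc 1 g k x} \<le> emeasure lborel ?E" by (intro emeasure_mono) auto
    also have "\<dots> \<le> ennreal (D / s\<^sup>2) * sq_norm (\<lambda>x. g x - u x)" by (rule D(2)) (use s fin in auto)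
    also have "\<dots> \<le> ennreal (D / s\<^sup>2) * ennreal d" by (intro mult_left_mono u) auto
    also have "\<dots> = ennreal (D / s\<^sup>2 * d)" using D(1) d by (intro ennreal_mult[symmetric]) auto
    also have "\<dots> \<le> ennreal \<eta>"
    proof (rule ennreal_leI)
      have "D / s\<^sup>2 * d \<le> (D / s\<^sup>2 + 1) * d" using d by (intro mult_right_mono) auto
      then show "D / s\<^sup>2 * d \<le> \<eta>" using den by (simp add: d_def)
    qed
    finally show "emeasure lborel {x. \<not> pv_osc 1 g k x} \<le> 0 + ennreal \<eta>" by simp
  qed
  then show ?thesis by (subst AE_iff_measurable[OF _ refl]) auto
qed

section \<open>Principal values along a direction\<close>

lemma tail_hilbert_along_line:
  "tail_hilbert 1 \<epsilon> (\<lambda>s. f (x + s *\<^sub>R e)) s = tail_hilbert e \<epsilon> f (x + s *\<^sub>R e)"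
  unfolding tail_hilbert_def by (simp add: scaleR_diff_left add_diff_eq)

lemma pv_osc_along_line:
  "pv_osc 1 (\<lambda>s. f (x + s *\<^sub>R e)) k s \<longleftrightarrow> pv_osc e f k (x + s *\<^sub>R e)"
  unfolding pv_osc_def tail_hilbert_along_line ..

text \<open>Two points of a chord are at distance at most \<open>2 * R\<close>. The chord is
  enclosed in an interval centred at one of its own parameters, hence 4 in place of 2.\<close>

lemma emeasure_line_ball:
  fixes x e :: "'a::euclidean_space"
  assumes e: "e \<noteq> 0" and R: "0 \<le> R"
  shows "(\<integral>\<^sup>+s. indicator (cball 0 R) (x - s *\<^sub>R e) \<partial>lborel) \<le> ennreal (4 * R / norm e)"
proof (cases "\<exists>s. x - s *\<^sub>R e \<in> cball 0 R")
  case False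
  then have "(\<integral>\<^sup>+s. indicator (cball 0 R) (x - s *\<^sub>R e) \<partial>lborel) = (\<integral>\<^sup>+s. 0 \<partial>(lborel :: real measure))"
    by (intro nn_integral_cong) (auto simp: indicator_def)
  then show ?thesis by simp
next
  case True
  then obtain a where a: "norm (x - a *\<^sub>R e) \<le> R" by auto
  let ?d = "2 * R / norm e"
  have d: "0 \<le> ?d" using R by simp
  have "(\<integral>\<^sup>+s. indicator (cball 0 R) (x - s *\<^sub>R e) \<partial>lborel) \<le> (\<integral>\<^sup>+s. indicator {a - ?d..a + ?d} s \<partial>lborel)"
  proof (rule nn_integral_mono)
    fix s
    have "\<bar>s - a\<bar> \<le> ?d" if "norm (x - s *\<^sub>R e) \<le> R"
    proof -
      have "(s - a) *\<^sub>R e = (x - a *\<^sub>R e) - (x - s *\<^sub>R e)" by (simp add: scaleR_diff_left)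
      then have "\<bar>s - a\<bar> * norm e \<le> norm (x - a *\<^sub>R e) + norm (x - s *\<^sub>R e)"
        by (metis norm_scaleR norm_triangle_ineq4)
      then have "\<bar>s - a\<bar> * norm e \<le> 2 * R" using a that by simp
      then show ?thesis using e by (simp add: pos_le_divide_eq)
    qed
    then show "indicator (cball 0 R) (x - s *\<^sub>R e) \<le> (indicator {a - ?d..a + ?d} s :: ennreal)"
      by (auto simp: indicator_def abs_le_iff)
  qed
  also have "\<dots> = ennreal (4 * R / norm e)" using d by simp
  finally show ?thesis .
qed

text \<open>If \<open>x\<close> ran over the whole space, every line would be counted infinitely
  often. With \<open>x\<close> restricted to a ball, a value of \<open>f\<close> is counted only for
  the parameters \<open>s\<close> of a chord, and the double integral is finite.\<close>

lemma AE_line_square_integrable: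
  fixes f :: "'a::euclidean_space \<Rightarrow> complex"
  assumes [measurable]: "f \<in> borel_measurable borel" and f: "sq_norm f < \<infinity>" and e: "e \<noteq> 0"
  shows "AE x in lborel. (\<integral>\<^sup>+s. ennreal ((norm (f (x + s *\<^sub>R e)))\<^sup>2) \<partial>lborel) < \<infinity>"
proof -
  define h where "h y = ennreal ((norm (f y))\<^sup>2)" for y
  have [measurable]: "h \<in> borel_measurable borel" unfolding h_def by measurable
  have [measurable]: "cball 0 r \<in> sets (borel :: 'a measure)" for r by simp
  have "AE x in lborel. (\<integral>\<^sup>+s. h (x + s *\<^sub>R e) \<partial>lborel) * indicator (cball 0 (real n)) x \<noteq> \<infinity>" for n :: nat
  proof (rule nn_integral_noteq_infinite)
    let ?i = "\<lambda>x. indicator (cball 0 (real n)) x :: ennreal"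
    have "(\<integral>\<^sup>+x. (\<integral>\<^sup>+s. h (x + s *\<^sub>R e) \<partial>lborel) * ?i x \<partial>lborel) = (\<integral>\<^sup>+x. (\<integral>\<^sup>+s. h (x + s *\<^sub>R e) * ?i x \<partial>lborel) \<partial>lborel)"
      by (intro nn_integral_cong nn_integral_multc[symmetric]) measurable
    also have "\<dots> = (\<integral>\<^sup>+s. (\<integral>\<^sup>+x. h (x + s *\<^sub>R e) * ?i x \<partial>lborel) \<partial>lborel)"
      by (rule lborel_pair.Fubini') measurable
    also have "\<dots> = (\<integral>\<^sup>+s. (\<integral>\<^sup>+x. h x * ?i (x - s *\<^sub>R e) \<partial>lborel) \<partial>lborel)"
    proof (rule nn_integral_cong)
      fix s
      have "(\<integral>\<^sup>+x. (\<lambda>x. h (x + s *\<^sub>R e) * ?i x) (x - s *\<^sub>R e) \<partial>lborel) = (\<integral>\<^sup>+x. h (x + s *\<^sub>R e) * ?i x \<partial>lborel)"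
        by (rule nn_integral_translate) measurable
      then show "(\<integral>\<^sup>+x. h (x + s *\<^sub>R e) * ?i x \<partial>lborel) = (\<integral>\<^sup>+x. h x * ?i (x - s *\<^sub>R e) \<partial>lborel)" by simp
    qed
    also have "\<dots> = (\<integral>\<^sup>+x. (\<integral>\<^sup>+s. h x * ?i (x - s *\<^sub>R e) \<partial>lborel) \<partial>lborel)"
      by (rule lborel_pair.Fubini') measurable
    also have "\<dots> = (\<integral>\<^sup>+x. h x * (\<integral>\<^sup>+s. ?i (x - s *\<^sub>R e) \<partial>lborel) \<partial>lborel)"
      by (intro nn_integral_cong nn_integral_cmult) measurable
    also have "\<dots> \<le> (\<integral>\<^sup>+x. h x * ennreal (4 * real n / norm e) \<partial>lborel)"
      by (intro nn_integral_mono mult_left_mono emeasure_line_ball e) auto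
    also have "\<dots> = sq_norm f * ennreal (4 * real n / norm e)"
      unfolding sq_norm_def h_def by (rule nn_integral_multc) measurable
    also have "\<dots> < \<infinity>" using f by (simp add: ennreal_mult_less_top)
    finally show "(\<integral>\<^sup>+x. (\<integral>\<^sup>+s. h (x + s *\<^sub>R e) \<partial>lborel) * ?i x \<partial>lborel) \<noteq> \<infinity>" by simp
  qed measurable
  then have "AE x in lborel. \<forall>n::nat. (\<integral>\<^sup>+s. h (x + s *\<^sub>R e) \<partial>lborel) * indicator (cball 0 (real n)) x \<noteq> \<infinity>"
    unfolding AE_all_countable by blast
  then show ?thesis
  proof eventually_elim
    fix x assume *: "\<forall>n::nat. (\<integral>\<^sup>+s. h (x + s *\<^sub>R e) \<partial>lborel) * indicator (cball 0 (real n)) x \<noteq> \<infinity>"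
    obtain n where "norm x \<le> real n" using real_arch_simple by blast
    then have "(\<integral>\<^sup>+s. h (x + s *\<^sub>R e) \<partial>lborel) \<noteq> \<infinity>" using *[rule_format, of n] by simp
    then show "(\<integral>\<^sup>+s. ennreal ((norm (f (x + s *\<^sub>R e)))\<^sup>2) \<partial>lborel) < \<infinity>"
      unfolding h_def by (simp add: less_top)
  qed
qed

lemma AE_line_integrable:
  fixes f :: "'a::euclidean_space \<Rightarrow> complex"
  assumes [measurable]: "f \<in> borel_measurable borel" and f: "sq_norm f < \<infinity>" and e: "e \<noteq> 0"
  shows "AE x in lborel. line_integrable e f x"
  using AE_line_square_integrable[OF assms]
proof eventually_elim
  fix x assume fin: "(\<integral>\<^sup>+s. ennreal ((norm (f (x + s *\<^sub>R e)))\<^sup>2) \<partial>lborel) < \<infinity>"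
  have "(\<integral>\<^sup>+s. ennreal ((norm (f (x + s *\<^sub>R e)))\<^sup>2) \<partial>lborel) = (\<integral>\<^sup>+s. ennreal ((norm (f (x - s *\<^sub>R e)))\<^sup>2) \<partial>lborel)"
    by (subst nn_integral_real_affine[where c="-1" and t=0]) auto
  then show "line_integrable e f x" using fin by (intro line_integrableI) auto
qed

text \<open>Translation along \<open>e\<close> preserves the measure, so the measure of the
  exceptional set is its average over the shifts \<open>s *\<^sub>R e\<close> with
  \<open>s \<in> {0..1}\<close>. Tonelli then reduces the claim to the sections along lines, without
  coordinates adapted to \<open>e\<close>.\<close>

lemma AE_pv_osc:
  fixes f :: "'a::euclidean_space \<Rightarrow> complex"
  assumes [measurable]: "f \<in> borel_measurable borel" and f: "sq_norm f < \<infinity>" and e: "e \<noteq> 0"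
  shows "AE x in lborel. pv_osc e f k x"
proof -
  define Z where "Z = {x. \<not> pv_osc e f k x}"
  have [measurable]: "Z \<in> sets borel" unfolding Z_def by measurable
  have "emeasure lborel Z = (\<integral>\<^sup>+s. emeasure lborel Z * indicator {0..1::real} s \<partial>lborel)"
    by (subst nn_integral_cmult_indicator) auto
  also have "\<dots> = (\<integral>\<^sup>+s. (\<integral>\<^sup>+x. indicator Z (x + s *\<^sub>R e) * indicator {0..1::real} s \<partial>lborel) \<partial>lborel)"
  proof (rule nn_integral_cong)
    fix s :: real
    have "(\<integral>\<^sup>+x. indicator Z (x - (- s) *\<^sub>R e) \<partial>lborel) = (\<integral>\<^sup>+x. indicator Z x \<partial>lborel)"
      by (rule nn_integral_translate) measurable
    then have "emeasure lborel Z = (\<integral>\<^sup>+x. indicator Z (x + s *\<^sub>R e) \<partial>lborel)" by simp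
    then show "emeasure lborel Z * indicator {0..1} s = (\<integral>\<^sup>+x. indicator Z (x + s *\<^sub>R e) * indicator {0..1} s \<partial>lborel)"
      by (simp add: nn_integral_multc)
  qed
  also have "\<dots> = (\<integral>\<^sup>+x. (\<integral>\<^sup>+s. indicator Z (x + s *\<^sub>R e) * indicator {0..1::real} s \<partial>lborel) \<partial>lborel)"
    by (rule lborel_pair.Fubini'[symmetric]) measurable
  also have "\<dots> = (\<integral>\<^sup>+x. 0 \<partial>(lborel :: 'a measure))"
  proof (rule nn_integral_cong_AE)
    show "AE x in lborel. (\<integral>\<^sup>+s. indicator Z (x + s *\<^sub>R e) * indicator {0..1::real} s \<partial>lborel) = 0"
      using AE_line_square_integrable[OF assms]
    proof eventually_elim
      fix x assume fin: "(\<integral>\<^sup>+s. ennreal ((norm (f (x + s *\<^sub>R e)))\<^sup>2) \<partial>lborel) < \<infinity>"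
      have "AE s in lborel. pv_osc 1 (\<lambda>s. f (x + s *\<^sub>R e)) k s"
        by (rule pv_osc_AE_real) (use fin in \<open>auto simp: sq_norm_def\<close>)
      then have "AE s in lborel. pv_osc e f k (x + s *\<^sub>R e)" unfolding pv_osc_along_line .
      then have "AE s in lborel. indicator Z (x + s *\<^sub>R e) * indicator {0..1::real} s = (0 :: ennreal)"
        by eventually_elim (simp add: Z_def)
      then show "(\<integral>\<^sup>+s. indicator Z (x + s *\<^sub>R e) * indicator {0..1::real} s \<partial>lborel) = 0"
        by (subst nn_integral_0_iff_AE) auto
    qed
  qed
  finally have "emeasure lborel Z = 0" by simp
  then show ?thesis unfolding Z_def by (subst AE_iff_measurable[OF _ refl]) auto
qed

lemma AE_pv_exists:
  fixes f :: "'a::euclidean_space \<Rightarrow> complex"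
  assumes [measurable]: "f \<in> borel_measurable borel" and f: "sq_norm f < \<infinity>" and e: "e \<noteq> 0"
  shows "AE x in lborel. line_integrable e f x \<and> (\<exists>l. ((\<lambda>\<epsilon>. tail_hilbert e \<epsilon> f x) \<longlongrightarrow> l) (at_right 0))"
proof -
  have "AE x in lborel. \<forall>k. pv_osc e f k x"
    unfolding AE_all_countable using AE_pv_osc[OF assms] by blast
  then show ?thesis using AE_line_integrable[OF assms]
    by eventually_elim (auto intro: pv_limit_exists)
qed

section \<open>The principal value as the limit of a sequence of bands\<close>

definition band_seq :: "'a::euclidean_space \<Rightarrow> nat \<Rightarrow> ('a \<Rightarrow> complex) \<Rightarrow> 'a \<Rightarrow> complex" where
  "band_seq e n f = band_hilbert e (1 / real (Suc n)) (real (Suc n)) f"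

text \<open>The factor \<open>1 / pi\<close> is left out. The limit is taken along a sequence, and \<open>lim\<close> has a junk value where
  it does not exist, so that the result is Borel measurable for every Borel measurable function.\<close>

definition pv_hilbert :: "'a::euclidean_space \<Rightarrow> ('a \<Rightarrow> complex) \<Rightarrow> 'a \<Rightarrow> complex" where
  "pv_hilbert e f x = lim (\<lambda>n. band_seq e n f x)"

lemma band_seq_range: "0 < 1 / real (Suc n)" "1 / real (Suc n) \<le> real (Suc n)"
  by (simp_all add: field_simps)

lemma band_seq_measurable [measurable]:
  assumes [measurable]: "f \<in> borel_measurable borel"
  shows "band_seq e n f \<in> borel_measurable borel"
  unfolding band_seq_def by measurable

lemma pv_hilbert_measurable [measurable]:
  assumes [measurable]: "f \<in> borel_measurable borel"
  shows "pv_hilbert e f \<in> borel_measurable borel"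
  unfolding pv_hilbert_def[abs_def] by (rule borel_measurable_lim_metric) measurable

lemma band_seq_tendsto_pv:
  assumes li: "line_integrable e f x" and [measurable]: "f \<in> borel_measurable borel"
    and l: "((\<lambda>\<epsilon>. tail_hilbert e \<epsilon> f x) \<longlongrightarrow> l) (at_right 0)"
  shows "(\<lambda>n. band_seq e n f x) \<longlonglongrightarrow> l"
proof -
  have "filterlim (\<lambda>n. 1 / real (Suc n)) (at_right 0) sequentially" by real_asymp
  with l have "(\<lambda>n. tail_hilbert e (1 / real (Suc n)) f x) \<longlonglongrightarrow> l" by (rule filterlim_compose)
  moreover have "filterlim (\<lambda>n. real (Suc n)) at_top sequentially" by real_asymp
  then have "(\<lambda>n. tail_hilbert e (real (Suc n)) f x) \<longlonglongrightarrow> 0" by (intro tail_hilbert_at_top[OF li]) auto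
  ultimately have "(\<lambda>n. tail_hilbert e (1 / real (Suc n)) f x - tail_hilbert e (real (Suc n)) f x) \<longlonglongrightarrow> l - 0" by (rule tendsto_diff)
  moreover have "band_seq e n f x = tail_hilbert e (1 / real (Suc n)) f x - tail_hilbert e (real (Suc n)) f x" for n
    unfolding band_seq_def by (rule band_hilbert_eq_tail_hilbert[OF li]) auto
  ultimately show ?thesis by simp
qed

lemma AE_pv_pv_hilbert:
  fixes f :: "'a::euclidean_space \<Rightarrow> complex"
  assumes [measurable]: "f \<in> borel_measurable borel" and f: "sq_norm f < \<infinity>" and e: "e \<noteq> 0"
  shows "AE x in lborel. ((\<lambda>\<epsilon>. tail_hilbert e \<epsilon> f x) \<longlongrightarrow> pv_hilbert e f x) (at_right 0)"
  using AE_pv_exists[OF assms]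
proof eventually_elim
  fix x assume x: "line_integrable e f x \<and> (\<exists>l. ((\<lambda>\<epsilon>. tail_hilbert e \<epsilon> f x) \<longlongrightarrow> l) (at_right 0))"
  then obtain l where l: "((\<lambda>\<epsilon>. tail_hilbert e \<epsilon> f x) \<longlongrightarrow> l) (at_right 0)" by blast
  have "pv_hilbert e f x = l" unfolding pv_hilbert_def by (rule limI) (use band_seq_tendsto_pv[OF _ _ l] x in auto)
  then show "((\<lambda>\<epsilon>. tail_hilbert e \<epsilon> f x) \<longlongrightarrow> pv_hilbert e f x) (at_right 0)" using l by simp
qed

text \<open>For \<open>e = 0\<close> an odd kernel is integrated against a constant. The zero
  direction serves as an origin: a bound for differences of two transforms contains one for a single
  transform.\<close>

lemma band_seq_zero_direction: "band_seq 0 n f = (\<lambda>x. 0)"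
proof (rule ext)
  fix x
  show "band_seq 0 n f x = 0" unfolding band_seq_def band_hilbert_def
    using integral_scaleR_left[OF tail_kernel_diff_integrable[OF band_seq_range[of n]], of "f x"]
    by (simp add: tail_kernel_diff_integral)
qed

lemma pv_hilbert_zero_direction: "pv_hilbert 0 f = (\<lambda>x. 0)"
  unfolding pv_hilbert_def[abs_def] band_seq_zero_direction by (simp add: limI[OF tendsto_const])

lemma AE_band_seq_tendsto_pv_hilbert:
  fixes f :: "'a::euclidean_space \<Rightarrow> complex"
  assumes [measurable]: "f \<in> borel_measurable borel" and f: "sq_norm f < \<infinity>"
  shows "AE x in lborel. (\<lambda>n. band_seq e n f x) \<longlonglongrightarrow> pv_hilbert e f x"
proof (cases "e = 0")
  case True
  then show ?thesis by (simp add: band_seq_zero_direction pv_hilbert_zero_direction)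
next
  case False
  show ?thesis using AE_pv_pv_hilbert[OF assms False] AE_line_integrable[OF assms False]
    by eventually_elim (auto intro: band_seq_tendsto_pv)
qed

text \<open>The values of \<open>lim\<close> are additive where the limits exist, which is almost
  everywhere.\<close>

lemma pv_hilbert_diff_AE:
  fixes f g :: "'a::euclidean_space \<Rightarrow> complex"
  assumes [measurable]: "f \<in> borel_measurable borel" "g \<in> borel_measurable borel" and fin: "sq_norm f < \<infinity>" "sq_norm g < \<infinity>" and e: "e \<noteq> 0"
  shows "AE x in lborel. pv_hilbert e (\<lambda>x. f x - g x) x = pv_hilbert e f x - pv_hilbert e g x"
proof -
  have "sq_norm (\<lambda>x. f x - g x) \<le> 2 * sq_norm f + 2 * sq_norm g" by (rule sq_norm_diff_le) auto
  also have "\<dots> < \<infinity>" using fin by (simp add: ennreal_mult_less_top)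
  finally have "sq_norm (\<lambda>x. f x - g x) < \<infinity>" .
  then have "AE x in lborel. ((\<lambda>\<epsilon>. tail_hilbert e \<epsilon> (\<lambda>x. f x - g x) x) \<longlongrightarrow> pv_hilbert e (\<lambda>x. f x - g x) x) (at_right 0)"
    by (intro AE_pv_pv_hilbert e) auto
  then show ?thesis
    using AE_pv_pv_hilbert[OF assms(1) fin(1) e] AE_pv_pv_hilbert[OF assms(2) fin(2) e]
      AE_line_integrable[OF assms(1) fin(1) e] AE_line_integrable[OF assms(2) fin(2) e]
  proof eventually_elim
    case (elim x)
    have "((\<lambda>\<epsilon>. tail_hilbert e \<epsilon> f x - tail_hilbert e \<epsilon> g x) \<longlongrightarrow> pv_hilbert e f x - pv_hilbert e g x) (at_right 0)"
      by (intro tendsto_diff) (use elim in auto)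
    moreover have "eventually (\<lambda>\<epsilon>. tail_hilbert e \<epsilon> f x - tail_hilbert e \<epsilon> g x = tail_hilbert e \<epsilon> (\<lambda>x. f x - g x) x) (at_right 0)"
      unfolding eventually_at_right_field using tail_hilbert_diff[of e f x g] elim by (intro exI[of _ 1]) auto
    ultimately have "((\<lambda>\<epsilon>. tail_hilbert e \<epsilon> (\<lambda>x. f x - g x) x) \<longlongrightarrow> pv_hilbert e f x - pv_hilbert e g x) (at_right 0)"
      by (rule Lim_transform_eventually)
    with elim(1) show ?case by (intro tendsto_unique[OF trivial_limit_at_right_real]) auto
  qed
qed

lemma sq_norm_pv_hilbert:
  "\<exists>C\<ge>0. \<forall>(e::'a::euclidean_space) f. f \<in> borel_measurable borel \<longrightarrow> sq_norm f < \<infinity> \<longrightarrow> sq_norm (pv_hilbert e f) \<le> ennreal C * sq_norm f"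
proof -
  obtain C where C: "0 \<le> C" "\<And>(e::'a) a b f. 0 < a \<Longrightarrow> a \<le> b \<Longrightarrow> f \<in> borel_measurable borel \<Longrightarrow> sq_norm f < \<infinity> \<Longrightarrow>
     sq_norm (band_hilbert e a b f) \<le> ennreal C * sq_norm f"
    using sq_norm_band_hilbert[where 'a='a] by blast
  have "sq_norm (pv_hilbert e f) \<le> ennreal C * sq_norm f" if "f \<in> borel_measurable borel" "sq_norm f < \<infinity>" for e :: 'a and f
    by (rule sq_norm_Fatou[OF _ AE_band_seq_tendsto_pv_hilbert[OF that]])
       (use that C(2)[OF band_seq_range] in \<open>auto simp: band_seq_def\<close>)
  then show ?thesis using C(1) by blast
qed

section \<open>Packing directions by separating planes\<close>

unbundle cross3_syntax

text \<open>Let \<open>b\<close> be the infimum of the levels whose upper tail has mass at most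
  \<open>s\<close>. The open tail above \<open>b\<close> still has mass at most \<open>s\<close>,
  the closed tail from \<open>b\<close> on has mass at least \<open>s\<close>, and every point of
  the closed tail belongs to the set in question. A level may carry mass, which is why the inner
  inequality is strict.\<close>

lemma (in finite_measure) measure_upper_quantile:
  fixes X :: "'a \<Rightarrow> real"
  assumes [measurable]: "X \<in> borel_measurable M" and s: "s \<le> measure M (space M)"
  shows "s \<le> measure M {w \<in> space M. measure M {w' \<in> space M. X w < X w'} \<le> s}"
proof -
  define G where "G t = measure M {w \<in> space M. t < X w}" for t
  have anti: "G u \<le> G t" if "t \<le> u" for t u
    unfolding G_def using that by (intro finite_measure_mono) auto
  show ?thesis
  proof (cases "0 < s")
    case False
    then show ?thesis by (intro order_trans[OF _ measure_nonneg]) simp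
  next
    case s0: True
    have "(\<lambda>n. G (real n)) \<longlonglongrightarrow> measure M (\<Inter>n. {w \<in> space M. real n < X w})"
      unfolding G_def by (intro finite_Lim_measure_decseq) (auto simp: decseq_def)
    moreover have "(\<Inter>n. {w \<in> space M. real n < X w}) = {}"
    proof -
      have "\<exists>n. \<not> real n < X w" for w
        using reals_Archimedean2[of "X w"] by (auto intro: less_asym)
      then show ?thesis by blast
    qed
    ultimately have "(\<lambda>n. G (real n)) \<longlonglongrightarrow> 0" by simp
    then obtain n where "G (real n) < s"
      using order_tendstoD(2)[OF _ s0] eventually_happens'[OF sequentially_bot] by blast
    then have ne: "{t. G t \<le> s} \<noteq> {}" by (auto intro: less_imp_le)
    show ?thesis
    proof (cases "{t. G t \<le> s} = UNIV")
      \<comment> \<open>This happens if \<open>s\<close> is the total mass. The levels then have no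
        infimum, but every point qualifies.\<close>
      case True
      then have "{w \<in> space M. measure M {w' \<in> space M. X w < X w'} \<le> s} = space M"
        unfolding G_def by auto
      then show ?thesis using s by simp
    next
      case False
      then obtain t0 where t0: "s < G t0" using not_le by blast
      define b where "b = Inf {t. G t \<le> s}"
      have bdd: "bdd_below {t. G t \<le> s}"
        proof (rule bdd_belowI[of _ t0])
        fix t assume "t \<in> {t. G t \<le> s}"
        then show "t0 \<le> t" using anti[of t t0] t0 by (cases "t0 \<le> t") auto
      qed
      have lo: "s < G t" if "t < b" for t
        using cInf_lower[OF _ bdd, of t] that unfolding b_def[symmetric] by (cases "G t \<le> s") auto
      have hi: "G t \<le> s" if bt: "b < t" for t
      proof -
        obtain u where "G u \<le> s" "u < t"
          using cInf_lessD[OF ne bt[unfolded b_def]] by auto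
        then show ?thesis using anti[of u t] by simp
      qed
      have "(\<lambda>n. G (b + inverse (real (Suc n)))) \<longlonglongrightarrow> measure M (\<Union>n. {w \<in> space M. b + inverse (real (Suc n)) < X w})"
        unfolding G_def
      proof (rule finite_Lim_measure_incseq)
        show "incseq (\<lambda>n. {w \<in> space M. b + inverse (real (Suc n)) < X w})"
        proof (rule incseq_SucI, safe)
          fix n w assume "b + inverse (real (Suc n)) < X w"
          moreover have "inverse (real (Suc (Suc n))) \<le> inverse (real (Suc n))" by simp
          ultimately show "b + inverse (real (Suc (Suc n))) < X w" by linarith
        qed
      qed auto
      moreover have "(\<Union>n. {w \<in> space M. b + inverse (real (Suc n)) < X w}) = {w \<in> space M. b < X w}"
      proof safe
        fix w n assume "b + inverse (real (Suc n)) < X w"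
        moreover have "inverse (real (Suc n)) > 0" by simp
        ultimately show "b < X w" by linarith
      next
        fix w assume w: "w \<in> space M" "b < X w"
        then obtain n where "inverse (real (Suc n)) < X w - b"
          using reals_Archimedean[of "X w - b"] by auto
        then show "w \<in> (\<Union>n. {w \<in> space M. b + inverse (real (Suc n)) < X w})" using w by (auto simp: algebra_simps)
      qed
      ultimately have "(\<lambda>n. G (b + inverse (real (Suc n)))) \<longlonglongrightarrow> G b" by (simp add: G_def)
      then have Gb: "G b \<le> s"
        by (rule LIMSEQ_le_const2) (use hi in auto)
      have "(\<lambda>n. G (b - inverse (real (Suc n)))) \<longlonglongrightarrow> measure M (\<Inter>n. {w \<in> space M. b - inverse (real (Suc n)) < X w})"
        unfolding G_def
      proof (rule finite_Lim_measure_decseq)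
        show "decseq (\<lambda>n. {w \<in> space M. b - inverse (real (Suc n)) < X w})"
        proof (rule decseq_SucI, safe)
          fix n w assume "b - inverse (real (Suc (Suc n))) < X w"
          moreover have "inverse (real (Suc (Suc n))) \<le> inverse (real (Suc n))" by simp
          ultimately show "b - inverse (real (Suc n)) < X w" by linarith
        qed
      qed auto
      moreover have "(\<Inter>n. {w \<in> space M. b - inverse (real (Suc n)) < X w}) = {w \<in> space M. b \<le> X w}"
      proof safe
        fix w assume w: "w \<in> (\<Inter>n. {w \<in> space M. b - inverse (real (Suc n)) < X w})"
        show "b \<le> X w"
        proof (rule ccontr)
          assume "\<not> b \<le> X w"
          then obtain n where "inverse (real (Suc n)) < b - X w"
            using reals_Archimedean[of "b - X w"] by auto
          moreover have "b - inverse (real (Suc n)) < X w" using w by blast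
          ultimately show False by linarith
        qed
        show "w \<in> space M" using w by blast
      next
        fix w and n :: nat assume "b \<le> X w"
        moreover have "inverse (real (Suc n)) > 0" by simp
        ultimately show "b - inverse (real (Suc n)) < X w" by linarith
      qed
      ultimately have "(\<lambda>n. G (b - inverse (real (Suc n)))) \<longlonglongrightarrow> measure M {w \<in> space M. b \<le> X w}" by simp
      then have "s \<le> measure M {w \<in> space M. b \<le> X w}"
        by (rule LIMSEQ_le_const) (auto intro!: less_imp_le lo)
      also have "\<dots> \<le> measure M {w \<in> space M. G (X w) \<le> s}"
      proof (rule finite_measure_mono)
        show "{w \<in> space M. b \<le> X w} \<subseteq> {w \<in> space M. G (X w) \<le> s}"
          using anti Gb order_trans by blast
        have "mono (\<lambda>t. - G t)" using anti by (intro monoI) simp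
        then have "(\<lambda>t. - (- G t)) \<in> borel_measurable borel" by (intro borel_measurable_uminus borel_measurable_mono)
        then have [measurable]: "G \<in> borel_measurable borel" by simp
        show "{w \<in> space M. G (X w) \<le> s} \<in> sets M" by measurable
      qed
      finally show ?thesis unfolding G_def .
    qed
  qed
qed

lemma cross_measurable [measurable]:
  assumes "f \<in> borel_measurable N" "g \<in> borel_measurable N"
  shows "(\<lambda>x. f x \<times> g x :: real^3) \<in> borel_measurable N"
proof (rule borel_measurable_continuous_Pair[OF assms])
  have bb: "bounded_bilinear (cross3)"
    using bilinear_cross by (simp add: bilinear_conv_bounded_bilinear)
  show "continuous_on UNIV (\<lambda>x. fst x \<times> snd x :: real^3)"
    using bounded_bilinear.continuous_on[OF bb continuous_on_fst[OF continuous_on_id] continuous_on_snd[OF continuous_on_id]] .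
qed

lemma orthogonal_vector_exists:
  fixes P :: "real^3"
  obtains E where "E \<noteq> 0" "E \<bullet> P = 0"
proof -
  have "2 \<le> DIM(real^3)" by simp
  then obtain y where "y \<noteq> 0" "orthogonal P y"
    by (rule orthogonal_to_vector_exists)
  then show thesis
    by (intro that[of y]) (simp_all add: orthogonal_def inner_commute[of y P])
qed

text \<open>Of the density \<open>|f^|^2\<close> the packing argument uses only that its mass is
  finite and that almost no \<xi> is orthogonal to a given nonzero vector.\<close>

locale plane_null_measure = finite_measure M for M :: "(real^3) measure" +
  assumes sets_M [measurable_cong]: "sets M = sets borel"
    and plane_null: "P \<noteq> 0 \<Longrightarrow> AE \<xi> in M. \<xi> \<bullet> P \<noteq> 0"
begin

lemma space_M [simp]: "space M = UNIV"
  using sets_eq_imp_space_eq[OF sets_M] by simp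

text \<open>Points of the projective plane and lines in it are represented by vectors; a line \<open>\<xi>\<close> separates two
  points if it changes sign between their representatives.\<close>

definition sep :: "real^3 \<Rightarrow> real^3 \<Rightarrow> real" where
  "sep P Q = measure M {\<xi>. (\<xi> \<bullet> P) * (\<xi> \<bullet> Q) < 0}"

lemma sep_measurable [measurable]:
  assumes [measurable]: "g \<in> borel_measurable N"
  shows "(\<lambda>x. sep P (g x)) \<in> borel_measurable N"
proof -
  have "sep P Q = (\<integral>\<eta>. (if (\<eta> \<bullet> P) * (\<eta> \<bullet> Q) < 0 then 1 else 0) \<partial>M)" for Q
  proof -
    have "{\<xi>. (\<xi> \<bullet> P) * (\<xi> \<bullet> Q) < 0} \<in> sets M" by measurable
    then have "sep P Q = (\<integral>\<eta>. indicator {\<xi>. (\<xi> \<bullet> P) * (\<xi> \<bullet> Q) < 0} \<eta> \<partial>M)"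
      unfolding sep_def by simp
    also have "\<dots> = (\<integral>\<eta>. (if (\<eta> \<bullet> P) * (\<eta> \<bullet> Q) < 0 then 1 else 0) \<partial>M)"
      by (rule Bochner_Integration.integral_cong) (auto simp: indicator_def)
    finally show ?thesis .
  qed
  then show ?thesis by simp
qed

lemma sep_le_total: "sep P Q \<le> measure M UNIV"
  unfolding sep_def using bounded_measure[of "{\<xi>. (\<xi> \<bullet> P) * (\<xi> \<bullet> Q) < 0}"] by simp

lemma sep_nonneg: "0 \<le> sep P Q" unfolding sep_def by simp
lemma sep_commute: "sep P Q = sep Q P" unfolding sep_def by (simp add: mult.commute)
lemma sep_self [simp]: "sep P P = 0" unfolding sep_def by (simp add: not_less[THEN iffD2])

text \<open>Almost every plane that changes sign between \<open>P\<close> and \<open>R\<close> does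
  not vanish at \<open>Q\<close>, and so changes sign on one side of \<open>Q\<close>.\<close>

lemma sep_triangle:
  assumes "Q \<noteq> 0"
  shows "sep P R \<le> sep P Q + sep Q R"
proof -
  let ?A = "\<lambda>P Q. {\<xi>::real^3. (\<xi> \<bullet> P) * (\<xi> \<bullet> Q) < 0}"
  have m [measurable]: "?A P Q \<in> sets M" for P Q by measurable
  have "sep P R \<le> measure M (?A P Q \<union> ?A Q R)"
    unfolding sep_def
  proof (rule finite_measure_mono_AE)
    show "AE \<xi> in M. \<xi> \<in> ?A P R \<longrightarrow> \<xi> \<in> ?A P Q \<union> ?A Q R"
      using plane_null[OF assms] by eventually_elim (auto simp: mult_less_0_iff)
  qed simp
  also have "\<dots> \<le> sep P Q + sep Q R"
    unfolding sep_def by (rule measure_Un_le) auto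
  finally show ?thesis .
qed

text \<open>Only positive factors are harmless: a negative one exchanges separating and
  non-separating planes. This is why both signs of a cross product are counted below.\<close>

lemma sep_scale_pos: "0 < k \<Longrightarrow> sep P (k *\<^sub>R Q) = sep P Q"
  unfolding sep_def by (rule arg_cong[of _ _ "measure M"]) (auto simp: mult_less_0_iff zero_less_mult_iff)

text \<open>\<open>P\<close> is the point at infinity of the line \<open>E + t *\<^sub>R P\<close>.
  The plane \<xi> meets this line at the parameter
  \<open>- (\<xi> \<bullet> E) / (\<xi> \<bullet> P)\<close>, so the distance from \<open>P\<close>
  is the mass of an upper tail of that parameter, and quantiles apply.\<close>

lemma sep_pencil:
  assumes P: "P \<noteq> 0"
  shows "sep P (E + t *\<^sub>R P) = measure M {\<xi>. t < - (\<xi> \<bullet> E) / (\<xi> \<bullet> P)}"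
  unfolding sep_def
proof (rule measure_eq_AE)
  show "AE \<xi> in M. (\<xi> \<in> {\<xi>. (\<xi> \<bullet> P) * (\<xi> \<bullet> (E + t *\<^sub>R P)) < 0}) = (\<xi> \<in> {\<xi>. t < - (\<xi> \<bullet> E) / (\<xi> \<bullet> P)})"
    using plane_null[OF P]
  proof eventually_elim
    fix \<xi> assume nz: "\<xi> \<bullet> P \<noteq> 0"
    then have pos: "0 < (\<xi> \<bullet> P)\<^sup>2" by simp
    have "t < - (\<xi> \<bullet> E) / (\<xi> \<bullet> P) \<longleftrightarrow> t * (\<xi> \<bullet> P)\<^sup>2 < (- (\<xi> \<bullet> E) / (\<xi> \<bullet> P)) * (\<xi> \<bullet> P)\<^sup>2"
      by (rule mult_less_cancel_right_pos[OF pos, symmetric])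
    also have "(- (\<xi> \<bullet> E) / (\<xi> \<bullet> P)) * (\<xi> \<bullet> P)\<^sup>2 = - (\<xi> \<bullet> E) * (\<xi> \<bullet> P)"
      using nz by (simp add: power2_eq_square)
    finally show "(\<xi> \<in> {\<xi>. (\<xi> \<bullet> P) * (\<xi> \<bullet> (E + t *\<^sub>R P)) < 0}) = (\<xi> \<in> {\<xi>. t < - (\<xi> \<bullet> E) / (\<xi> \<bullet> P)})"
      by (auto simp: inner_add_right power2_eq_square algebra_simps)
  qed
qed (use sets_M in \<open>measurable\<close>)

lemma pencil_quantile:
  assumes P: "P \<noteq> 0" and s: "s \<le> measure M UNIV"
  shows "s \<le> measure M {\<xi>. sep P (E + (- (\<xi> \<bullet> E) / (\<xi> \<bullet> P)) *\<^sub>R P) \<le> s}"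
  using measure_upper_quantile[of "\<lambda>\<xi>. - (\<xi> \<bullet> E) / (\<xi> \<bullet> P)" s] s
  unfolding sep_pencil[OF P] by simp

text \<open>From \<open>P\<close> walk along a fixed line until mass \<open>s\<close> has been crossed, and at each crossing point turn
  into the crossed line and again walk until mass \<open>s\<close> has been crossed. Every end point is the
  intersection \<open>\<plusminus> \<xi> \<times> \<xi>'\<close> of two lines.\<close>

lemma ball_mass:
  assumes P: "P \<noteq> 0" and s: "0 < s" "s \<le> measure M UNIV"
  shows "ennreal (s * s) \<le> (\<integral>\<^sup>+\<xi>. \<integral>\<^sup>+\<xi>'. indicator {z. sep P z \<le> 2 * s} (\<xi> \<times> \<xi>')
      + indicator {z. sep P z \<le> 2 * s} (- (\<xi> \<times> \<xi>')) \<partial>M \<partial>M)"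
proof -
  \<comment> \<open>Orthogonality to \<open>P\<close> keeps the points \<open>Q \<xi>\<close> of the
    line away from 0, as \<open>sep_triangle\<close> and \<open>plane_null\<close> require.\<close>
  obtain E where E: "E \<noteq> 0" "E \<bullet> P = 0" using orthogonal_vector_exists by blast
  \<comment> \<open>The point at which the plane \<xi> crosses the line through \<open>P\<close> and
    \<open>E\<close>.\<close>
  define Q where "Q \<xi> = E + (- (\<xi> \<bullet> E) / (\<xi> \<bullet> P)) *\<^sub>R P" for \<xi>
  have [measurable]: "Q \<in> borel_measurable borel" unfolding Q_def by measurable
  have Q0: "Q \<xi> \<noteq> 0" for \<xi>
  proof
    assume "Q \<xi> = 0"
    then have "E \<bullet> Q \<xi> = 0" by simp
    moreover have "E \<bullet> Q \<xi> = E \<bullet> E" using E(2) unfolding Q_def by (simp add: inner_diff_right)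
    ultimately show False using E(1) by simp
  qed
  let ?B = "\<lambda>z. indicator {z. sep P z \<le> 2 * s} z :: ennreal"
  define A where "A = {\<xi>. \<xi> \<bullet> P \<noteq> 0 \<and> sep P (Q \<xi>) \<le> s}"
  have [measurable]: "A \<in> sets M" unfolding A_def by measurable
  have "s \<le> measure M {\<xi>. sep P (Q \<xi>) \<le> s}"
    using pencil_quantile[OF P s(2)] unfolding Q_def .
  also have "\<dots> \<le> measure M A"
  proof (rule finite_measure_mono_AE)
    show "AE \<xi> in M. \<xi> \<in> {\<xi>. sep P (Q \<xi>) \<le> s} \<longrightarrow> \<xi> \<in> A"
      using plane_null[OF P] by eventually_elim (auto simp: A_def)
  qed simp
  finally have A: "s \<le> measure M A" .
  have inner: "ennreal s \<le> (\<integral>\<^sup>+\<xi>'. ?B (\<xi> \<times> \<xi>') + ?B (- (\<xi> \<times> \<xi>')) \<partial>M)" if "\<xi> \<in> A" for \<xi>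
  proof -
    have \<xi>: "\<xi> \<bullet> P \<noteq> 0" "sep P (Q \<xi>) \<le> s" using that by (auto simp: A_def)
    then have \<xi>Q: "\<xi> \<bullet> Q \<xi> = 0" by (simp add: Q_def inner_diff_right)
    \<comment> \<open>\<open>?F\<close> and \<open>Q \<xi>\<close> are both orthogonal to \<xi>, so
      the second walk, starting from \<open>Q \<xi>\<close> along
      \<open>?F + t *\<^sub>R Q \<xi>\<close>, stays inside \<xi>.\<close>
    let ?F = "\<xi> \<times> Q \<xi>"
    let ?y = "\<lambda>\<xi>'. ?F + (- (\<xi>' \<bullet> ?F) / (\<xi>' \<bullet> Q \<xi>)) *\<^sub>R Q \<xi>"
    have "ennreal s \<le> ennreal (measure M {\<xi>'. sep (Q \<xi>) (?y \<xi>') \<le> s})"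
      by (intro ennreal_leI pencil_quantile Q0 s)
    also have "\<dots> = (\<integral>\<^sup>+\<xi>'. indicator {\<xi>'. sep (Q \<xi>) (?y \<xi>') \<le> s} \<xi>' \<partial>M)"
      by (simp add: emeasure_eq_measure)
    also have "\<dots> \<le> (\<integral>\<^sup>+\<xi>'. ?B (\<xi> \<times> \<xi>') + ?B (- (\<xi> \<times> \<xi>')) \<partial>M)"
    proof (rule nn_integral_mono_AE)
      show "AE \<xi>' in M. indicator {\<xi>'. sep (Q \<xi>) (?y \<xi>') \<le> s} \<xi>' \<le> ?B (\<xi> \<times> \<xi>') + ?B (- (\<xi> \<times> \<xi>'))"
        using plane_null[OF Q0[of \<xi>]]
      proof eventually_elim
        fix \<xi>' assume nz: "\<xi>' \<bullet> Q \<xi> \<noteq> 0"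
        \<comment> \<open>Lagrange's identity, used twice, exhibits the end point
          \<open>?y \<xi>'\<close> as a multiple of \<open>\<xi> \<times> \<xi>'\<close>. The factor
          has the sign of \<open>\<xi>' \<bullet> Q \<xi>\<close>, hence the two alternatives in
          \<open>sepy\<close>.\<close>
        have "?F \<times> Q \<xi> = - (Q \<xi> \<times> (\<xi> \<times> Q \<xi>))" by (rule cross_skew)
        also have "\<dots> = - ((Q \<xi> \<bullet> Q \<xi>) *\<^sub>R \<xi>)" using \<xi>Q by (simp add: Lagrange inner_commute)
        finally have FQ: "?F \<times> Q \<xi> = - ((Q \<xi> \<bullet> Q \<xi>) *\<^sub>R \<xi>)" .
        have "(\<xi>' \<bullet> Q \<xi>) *\<^sub>R ?y \<xi>' = (\<xi>' \<bullet> Q \<xi>) *\<^sub>R ?F - (\<xi>' \<bullet> ?F) *\<^sub>R Q \<xi>"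
          using nz by (simp add: scaleR_diff_right)
        also have "\<dots> = \<xi>' \<times> (?F \<times> Q \<xi>)" by (rule Lagrange[symmetric])
        also have "\<dots> = (Q \<xi> \<bullet> Q \<xi>) *\<^sub>R (\<xi> \<times> \<xi>')"
          unfolding FQ using cross_skew[of \<xi> \<xi>'] by (simp add: cross_mult_right)
        finally have "(1 / (\<xi>' \<bullet> Q \<xi>)) *\<^sub>R ((\<xi>' \<bullet> Q \<xi>) *\<^sub>R ?y \<xi>') = (1 / (\<xi>' \<bullet> Q \<xi>)) *\<^sub>R ((Q \<xi> \<bullet> Q \<xi>) *\<^sub>R (\<xi> \<times> \<xi>'))"
          by simp
        then have y: "?y \<xi>' = ((Q \<xi> \<bullet> Q \<xi>) / (\<xi>' \<bullet> Q \<xi>)) *\<^sub>R (\<xi> \<times> \<xi>')"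
          using nz by simp
        have pos: "0 < Q \<xi> \<bullet> Q \<xi>" using Q0 by simp
        have sepy: "sep P (?y \<xi>') = sep P (\<xi> \<times> \<xi>') \<or> sep P (?y \<xi>') = sep P (- (\<xi> \<times> \<xi>'))"
        proof (cases "0 < \<xi>' \<bullet> Q \<xi>")
          case True
          then show ?thesis unfolding y using pos by (simp add: sep_scale_pos)
        next
          case False
          then have "0 < - ((Q \<xi> \<bullet> Q \<xi>) / (\<xi>' \<bullet> Q \<xi>))" using nz pos by (simp add: divide_less_0_iff)
          from sep_scale_pos[OF this, of P "- (\<xi> \<times> \<xi>')"] show ?thesis unfolding y by simp
        qed
        show "indicator {\<xi>'. sep (Q \<xi>) (?y \<xi>') \<le> s} \<xi>' \<le> ?B (\<xi> \<times> \<xi>') + ?B (- (\<xi> \<times> \<xi>'))"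
        proof (cases "sep (Q \<xi>) (?y \<xi>') \<le> s")
          case True
          then have "sep P (?y \<xi>') \<le> 2 * s" using sep_triangle[OF Q0, of P "?y \<xi>'" \<xi>] \<xi>(2) by simp
          with sepy have "sep P (\<xi> \<times> \<xi>') \<le> 2 * s \<or> sep P (- (\<xi> \<times> \<xi>')) \<le> 2 * s" by auto
          then show ?thesis by (auto simp: indicator_def)
        qed simp
      qed
    qed
    finally show ?thesis .
  qed
  have "ennreal (s * s) \<le> ennreal s * emeasure M A"
    using A s by (simp add: emeasure_eq_measure flip: ennreal_mult)
  also have "\<dots> = (\<integral>\<^sup>+\<xi>. ennreal s * indicator A \<xi> \<partial>M)" by (simp add: nn_integral_cmult_indicator)
  also have "\<dots> \<le> (\<integral>\<^sup>+\<xi>. \<integral>\<^sup>+\<xi>'. ?B (\<xi> \<times> \<xi>') + ?B (- (\<xi> \<times> \<xi>')) \<partial>M \<partial>M)"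
    using inner by (intro nn_integral_mono) (auto simp: indicator_def)
  finally show ?thesis .
qed

text \<open>The balls of radius \<open>2 * s\<close> around the points of \<open>S\<close> are
  disjoint, so a nonzero vector lies in at most one of them. For almost every pair both
  \<open>\<xi> \<times> \<xi>'\<close> and its negative are nonzero; hence the masses in
  \<open>ball_mass\<close> sum to at most twice the square of the total mass.\<close>

lemma separated_card:
  assumes S: "finite S" "0 \<notin> S" and s: "0 < s" "s \<le> measure M UNIV"
    and sep: "\<And>P Q. P \<in> S \<Longrightarrow> Q \<in> S \<Longrightarrow> P \<noteq> Q \<Longrightarrow> 4 * s < sep P Q"
  shows "real (card S) * (s * s) \<le> 2 * (measure M UNIV)\<^sup>2"
proof -
  let ?B = "\<lambda>P z. indicator {z. sep P z \<le> 2 * s} z :: ennreal"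
  have [measurable]: "(\<lambda>z. ?B P z) \<in> borel_measurable borel" for P by measurable
  have one: "(\<Sum>P\<in>S. ?B P z) \<le> 1" if z: "z \<noteq> 0" for z
  proof (cases "\<exists>P\<in>S. sep P z \<le> 2 * s")
    case True
    then obtain P where P: "P \<in> S" "sep P z \<le> 2 * s" by blast
    have "sep Q z > 2 * s" if "Q \<in> S" "Q \<noteq> P" for Q
      using sep[OF that(1) P(1) that(2)] sep_triangle[OF z, of Q P] P(2) by (simp add: sep_commute[of z])
    then have "(\<Sum>Q\<in>S. ?B Q z) = (\<Sum>Q\<in>S. if Q = P then 1 else 0)"
      using P by (intro sum.cong) (auto simp: indicator_def not_le)
    then show ?thesis using P(1) S(1) by simp
  next
    case False
    then have "(\<Sum>P\<in>S. ?B P z) = 0" by (intro sum.neutral) (auto simp: indicator_def)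
    then show ?thesis by simp
  qed
  have "ennreal (real (card S) * (s * s)) = (\<Sum>P\<in>S. ennreal (s * s))"
    using s by (simp add: ennreal_mult ennreal_of_nat_eq_real_of_nat)
  also have "\<dots> \<le> (\<Sum>P\<in>S. \<integral>\<^sup>+\<xi>. \<integral>\<^sup>+\<xi>'. ?B P (\<xi> \<times> \<xi>') + ?B P (- (\<xi> \<times> \<xi>')) \<partial>M \<partial>M)"
    using S s by (intro sum_mono ball_mass) auto
  also have "\<dots> = (\<integral>\<^sup>+\<xi>. \<integral>\<^sup>+\<xi>'. (\<Sum>P\<in>S. ?B P (\<xi> \<times> \<xi>') + ?B P (- (\<xi> \<times> \<xi>'))) \<partial>M \<partial>M)"
    by (subst nn_integral_sum[symmetric], measurable) (simp add: nn_integral_sum)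
  also have "\<dots> \<le> (\<integral>\<^sup>+\<xi>. \<integral>\<^sup>+\<xi>'. 2 \<partial>M \<partial>M)"
  proof (rule nn_integral_mono_AE)
    have "AE \<xi> in M. \<xi> \<bullet> axis 1 1 \<noteq> 0" by (rule plane_null) (simp add: axis_eq_0_iff)
    then show "AE \<xi> in M. (\<integral>\<^sup>+\<xi>'. (\<Sum>P\<in>S. ?B P (\<xi> \<times> \<xi>') + ?B P (- (\<xi> \<times> \<xi>'))) \<partial>M) \<le> (\<integral>\<^sup>+\<xi>'. 2 \<partial>M)"
    proof eventually_elim
      fix \<xi> :: "real^3" assume "\<xi> \<bullet> axis 1 1 \<noteq> 0"
      then have \<xi>: "\<xi> \<noteq> 0" by auto
      \<comment> \<open>A \<xi>' parallel to \<xi> would be orthogonal to \<open>a\<close>, so the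
        degenerate pairs form a null set.\<close>
      obtain a where a: "a \<noteq> 0" "a \<bullet> \<xi> = 0" using orthogonal_vector_exists by blast
      show "(\<integral>\<^sup>+\<xi>'. (\<Sum>P\<in>S. ?B P (\<xi> \<times> \<xi>') + ?B P (- (\<xi> \<times> \<xi>'))) \<partial>M) \<le> (\<integral>\<^sup>+\<xi>'. 2 \<partial>M)"
      proof (rule nn_integral_mono_AE)
        show "AE \<xi>' in M. (\<Sum>P\<in>S. ?B P (\<xi> \<times> \<xi>') + ?B P (- (\<xi> \<times> \<xi>'))) \<le> 2"
          using plane_null[OF a(1)]
        proof eventually_elim
          fix \<xi>' assume nz: "\<xi>' \<bullet> a \<noteq> 0"
          have "\<xi> \<times> \<xi>' \<noteq> 0"
          proof
            assume "\<xi> \<times> \<xi>' = 0"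
            then have "0 = (\<xi> \<times> (\<xi> \<times> \<xi>')) \<bullet> a" by simp
            also have "\<dots> = - ((\<xi> \<bullet> \<xi>) * (\<xi>' \<bullet> a))"
              using a(2) unfolding Lagrange by (simp add: inner_diff_left inner_commute[of \<xi> a])
            finally show False using nz \<xi> by simp
          qed
          then have "(\<Sum>P\<in>S. ?B P (\<xi> \<times> \<xi>')) + (\<Sum>P\<in>S. ?B P (- (\<xi> \<times> \<xi>'))) \<le> 1 + 1"
            by (intro add_mono one) auto
          then show "(\<Sum>P\<in>S. ?B P (\<xi> \<times> \<xi>') + ?B P (- (\<xi> \<times> \<xi>'))) \<le> 2"
            by (simp add: sum.distrib one_add_one)
        qed
      qed
    qed
  qed
  also have "\<dots> = ennreal (2 * (measure M UNIV)\<^sup>2)"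
    by (simp add: emeasure_eq_measure ennreal_mult power2_eq_square mult.assoc)
  finally show ?thesis by (simp add: ennreal_le_iff)
qed

text \<open>Let M be the total mass, n the number of points and s = 2 M / sqrt n. If all distances
  exceeded 4 s, then n s^2 = 4 M^2 would contradict the bound 2 M^2 of
  \<open>separated_card\<close>.\<close>

lemma close_pair_exists:
  assumes S: "finite S" "0 \<notin> S" "2 \<le> card S"
  shows "\<exists>P\<in>S. \<exists>Q\<in>S. P \<noteq> Q \<and> sep P Q \<le> 8 * measure M UNIV / sqrt (card S)"
proof (rule ccontr)
  assume "\<not> ?thesis"
  then have far: "8 * measure M UNIV / sqrt (card S) < sep P Q" if "P \<in> S" "Q \<in> S" "P \<noteq> Q" for P Q
    using that by (force simp: not_le)
  define s where "s = 2 * measure M UNIV / sqrt (card S)"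
  obtain P Q where PQ: "P \<in> S" "Q \<in> S" "P \<noteq> Q"
    using S(3) by (metis card_2_iff' card_le_Suc_iff numeral_2_eq_2 insertCI obtain_subset_with_card_n subsetD)
  have n: "0 < sqrt (card S)" using S by simp
  have s0: "0 \<le> s" using n by (simp add: s_def)
  have far': "4 * s < sep P Q" if "P \<in> S" "Q \<in> S" "P \<noteq> Q" for P Q
    using far[OF that] by (simp add: s_def)
  \<comment> \<open>One far pair exists as \<open>S\<close> has two points; it makes the total mass
    positive and at least \<open>s\<close>.\<close>
  have "4 * s < measure M UNIV" using far'[OF PQ] sep_le_total[of P Q] by simp
  then have tot: "0 < measure M UNIV" "s \<le> measure M UNIV" using s0 by simp_all
  have "0 < s" using tot n by (simp add: s_def)
  then have "real (card S) * (s * s) \<le> 2 * (measure M UNIV)\<^sup>2"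
    using tot far' by (intro separated_card S) auto
  moreover have "real (card S) * (s * s) = 4 * (measure M UNIV)\<^sup>2"
  proof -
    have "s * s = 4 * (measure M UNIV)\<^sup>2 / (sqrt (card S) * sqrt (card S))"
      by (simp add: s_def power2_eq_square)
    moreover have "sqrt (card S) * sqrt (card S) = real (card S)" by simp
    moreover have "real (card S) \<noteq> 0" using S(3) by linarith
    ultimately show ?thesis by simp
  qed
  ultimately show False using tot by simp
qed

end

unbundle no cross3_syntax

section \<open>Chaining along greedy matchings\<close>

text \<open>Remove a close pair, send \<open>p\<close> to \<open>q\<close> and \<open>q\<close> to
  itself, and continue with the rest; a single point left over represents itself. With m points
  remaining the cost is at most K / sqrt m.\<close>

lemma greedy_matching:
  fixes d :: "'v \<Rightarrow> 'v \<Rightarrow> real"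
  assumes "finite S" and K: "0 \<le> K" and self: "\<And>v. d v v = 0"
    and pair: "\<And>T. T \<subseteq> S \<Longrightarrow> 2 \<le> card T \<Longrightarrow> \<exists>p\<in>T. \<exists>q\<in>T. p \<noteq> q \<and> d p q \<le> K / sqrt (card T)"
  shows "\<exists>R \<pi>. R \<subseteq> S \<and> \<pi> ` S \<subseteq> R \<and> 2 * card R \<le> card S + 1 \<and> (\<Sum>v\<in>S. d v (\<pi> v)) \<le> K * sqrt (card S)"
  using assms(1) pair
proof (induction "card S" arbitrary: S rule: less_induct)
  case less
  show ?case
  proof (cases "2 \<le> card S")
    case False
    then show ?thesis using K self by (intro exI[of _ S] exI[of _ id]) auto
  next
    case True
    then obtain p q where pq: "p \<in> S" "q \<in> S" "p \<noteq> q" "d p q \<le> K / sqrt (card S)"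
      using less.prems(2)[of S] by blast
    define T where "T = S - {p, q}"
    have T: "T \<subseteq> S" "finite T" "p \<notin> T" "q \<notin> T" "S = insert p (insert q T)"
      using pq less.prems(1) by (auto simp: T_def)
    have cS: "card S = card T + 2" using T pq by simp
    have "\<exists>R \<pi>. R \<subseteq> T \<and> \<pi> ` T \<subseteq> R \<and> 2 * card R \<le> card T + 1 \<and> (\<Sum>v\<in>T. d v (\<pi> v)) \<le> K * sqrt (card T)"
    proof (rule less.hyps)
      show "card T < card S" using cS by simp
      show "\<exists>p\<in>U. \<exists>q\<in>U. p \<noteq> q \<and> d p q \<le> K / sqrt (card U)" if "U \<subseteq> T" "2 \<le> card U" for U
        using less.prems(2)[of U] that T by blast
    qed (rule T)
    then obtain R \<pi> where R: "R \<subseteq> T" "\<pi> ` T \<subseteq> R" "2 * card R \<le> card T + 1" "(\<Sum>v\<in>T. d v (\<pi> v)) \<le> K * sqrt (card T)"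
      by blast
    define \<rho> where "\<rho> = \<pi>(p := q, q := q)"
    have \<rho>: "\<rho> p = q" "\<rho> q = q" "\<And>v. v \<in> T \<Longrightarrow> \<rho> v = \<pi> v" using T pq by (auto simp: \<rho>_def)
    have "(\<Sum>v\<in>S. d v (\<rho> v)) = d p q + d q q + (\<Sum>v\<in>T. d v (\<pi> v))"
      using T pq \<rho> by simp
    also have "\<dots> \<le> K / sqrt (card S) + K * sqrt (card T)"
      using pq R self by simp
    also have "\<dots> \<le> K * sqrt (card S)"
    proof -
      \<comment> \<open>\<open>n\<^sup>2 - m\<^sup>2 = 2\<close> gives
        \<open>1 / n \<le> n - m\<close>, so the costs telescope.\<close>
      define n m where "n = sqrt (card S)" and "m = sqrt (card T)"
      have nm: "0 < n" "0 \<le> m" "m \<le> n" "n\<^sup>2 = m\<^sup>2 + 2" using cS by (auto simp: n_def m_def)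
      have "2 = (n - m) * (n + m)" using nm by (simp add: power2_eq_square algebra_simps)
      also have "\<dots> \<le> (n - m) * (2 * n)" using nm by (intro mult_left_mono) auto
      finally have "1 / n \<le> n - m" using nm by (simp add: field_simps)
      then have "K * (1 / n) \<le> K * (n - m)" using K by (rule mult_left_mono)
      then show ?thesis unfolding n_def[symmetric] m_def[symmetric] by (simp add: algebra_simps)
    qed
    finally have sum: "(\<Sum>v\<in>S. d v (\<rho> v)) \<le> K * sqrt (card S)" .
    have "card (insert q R) \<le> card R + 1" by (rule card_insert_le_m1) auto
    then have "2 * card (insert q R) \<le> card S + 1" using R cS by simp
    moreover have "insert q R \<subseteq> S" "\<rho> ` S \<subseteq> insert q R" using R T \<rho> by auto
    ultimately show ?thesis using sum by blast
  qed
qed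

text \<open>The constant 8000 is a solution \<open>K\<close> of \<open>1.1 * 0.8661 * K + 11 * 4 * 8 \<le> K\<close>, where \<open>0.8661\<^sup>2 \<ge> 3 / 4\<close>.\<close>

lemma nn_integral_SUP_square_chain:
  fixes F :: "'v \<Rightarrow> 'x \<Rightarrow> complex"
  assumes "finite S" and [measurable]: "\<And>v. F v \<in> borel_measurable N"
    and A: "0 \<le> A" and self: "\<And>v. d v v = 0" and nonneg: "\<And>u v. 0 \<le> d u v"
    and pair: "\<And>T. T \<subseteq> S \<Longrightarrow> 2 \<le> card T \<Longrightarrow> \<exists>p\<in>T. \<exists>q\<in>T. p \<noteq> q \<and> d p q \<le> 8 * A / sqrt (card T)"
    and diff: "\<And>u v. u \<in> S \<Longrightarrow> v \<in> S \<Longrightarrow> (\<integral>\<^sup>+x. ennreal ((norm (F u x - F v x))\<^sup>2) \<partial>N) \<le> ennreal (4 * d u v)"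
    and bound: "\<And>v. v \<in> S \<Longrightarrow> (\<integral>\<^sup>+x. ennreal ((norm (F v x))\<^sup>2) \<partial>N) \<le> ennreal A"
  shows "(\<integral>\<^sup>+x. (SUP v\<in>S. ennreal ((norm (F v x))\<^sup>2)) \<partial>N) \<le> ennreal (8000 * A * sqrt (card S))"
  using assms(1) pair diff bound
proof (induction "card S" arbitrary: S rule: less_induct)
  case less
  note fin = less.prems(1)
  have [measurable]: "(\<lambda>x. SUP v\<in>T. ennreal ((norm (F v x))\<^sup>2)) \<in> borel_measurable N" if "T \<subseteq> S" for T
    using finite_subset[OF that fin] by (intro borel_measurable_SUP) (auto intro: countable_finite)
  consider "card S = 0" | "card S = 1" | "2 \<le> card S" by linarith
  then show ?case
  proof cases
    case 1
    then show ?thesis using fin by (simp add: bot_ennreal)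
  next
    case 2
    then obtain v where v: "S = {v}" by (rule card_1_singletonE)
    have "(\<integral>\<^sup>+x. (SUP v\<in>S. ennreal ((norm (F v x))\<^sup>2)) \<partial>N) \<le> ennreal A"
      using less.prems(4)[of v] v by simp
    also have "\<dots> \<le> ennreal (8000 * A * sqrt (card S))" using A v by (intro ennreal_leI) simp
    finally show ?thesis .
  next
    case 3
    define n where "n = sqrt (card S)"
    have n0: "0 \<le> n" by (simp add: n_def)
    have "\<exists>R \<pi>. R \<subseteq> S \<and> \<pi> ` S \<subseteq> R \<and> 2 * card R \<le> card S + 1 \<and> (\<Sum>v\<in>S. d v (\<pi> v)) \<le> 8 * A * sqrt (card S)"
      by (rule greedy_matching) (use fin A self less.prems(2) in auto)
    then obtain R \<pi> where R: "R \<subseteq> S" "\<pi> ` S \<subseteq> R" "2 * card R \<le> card S + 1" and sum: "(\<Sum>v\<in>S. d v (\<pi> v)) \<le> 8 * A * n"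
      unfolding n_def by blast
    have IH: "(\<integral>\<^sup>+x. (SUP v\<in>R. ennreal ((norm (F v x))\<^sup>2)) \<partial>N) \<le> ennreal (8000 * A * sqrt (card R))"
    proof (rule less.hyps)
      show "card R < card S" using R 3 by linarith
      show "finite R" using R fin finite_subset by blast
      show "\<exists>p\<in>T. \<exists>q\<in>T. p \<noteq> q \<and> d p q \<le> 8 * A / sqrt (card T)" if "T \<subseteq> R" "2 \<le> card T" for T
        by (rule less.prems(2)) (use that R(1) in auto)
      show "(\<integral>\<^sup>+x. ennreal ((norm (F u x - F v x))\<^sup>2) \<partial>N) \<le> ennreal (4 * d u v)" if "u \<in> R" "v \<in> R" for u v
        by (rule less.prems(3)) (use that R(1) in auto)
      show "(\<integral>\<^sup>+x. ennreal ((norm (F v x))\<^sup>2) \<partial>N) \<le> ennreal A" if "v \<in> R" for v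
        by (rule less.prems(4)) (use that R(1) in auto)
    qed
    \<comment> \<open>\<open>(card S + 1) / 2 \<le> 3 / 4 * card S\<close> holds from
      \<open>card S = 2\<close> on, with equality there.\<close>
    have rR: "sqrt (card R) \<le> 0.8661 * n"
    proof -
      have "real (card R) \<le> 3 / 4 * real (card S)" using R(3) 3 by linarith
      also have "\<dots> \<le> (0.8661)\<^sup>2 * real (card S)" by (intro mult_right_mono) (auto simp: power2_eq_square)
      finally have "sqrt (card R) \<le> sqrt ((0.8661)\<^sup>2 * real (card S))" by (rule real_sqrt_le_mono)
      then show ?thesis by (simp add: real_sqrt_mult n_def)
    qed
    \<comment> \<open>\<open>(a + b)\<^sup>2 \<le> 1.1 * a\<^sup>2 + 11 * b\<^sup>2\<close> is
      \<open>0 \<le> (a - 10 * b)\<^sup>2\<close>. The first coefficient has to be close to 1 for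
      the recursion to contract; the second one may be large. The increments are summed, since the
      matching controls their sum.\<close>
    have pt: "(SUP v\<in>S. ennreal ((norm (F v x))\<^sup>2)) \<le> ennreal 1.1 * (SUP v\<in>R. ennreal ((norm (F v x))\<^sup>2))
        + ennreal 11 * (\<Sum>v\<in>S. ennreal ((norm (F v x - F (\<pi> v) x))\<^sup>2))" for x
    proof (rule SUP_least)
      fix v assume v: "v \<in> S"
      define a b where "a = norm (F (\<pi> v) x)" and "b = norm (F v x - F (\<pi> v) x)"
      have "norm (F v x) \<le> a + b" unfolding a_def b_def by norm
      then have "(norm (F v x))\<^sup>2 \<le> (a + b)\<^sup>2" by (intro power_mono) auto
      also have "\<dots> \<le> 1.1 * a\<^sup>2 + 11 * b\<^sup>2"
      proof -
        have "0 \<le> (a - 10 * b)\<^sup>2" by simp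
        then show ?thesis by (simp add: power2_eq_square algebra_simps)
      qed
      finally have "ennreal ((norm (F v x))\<^sup>2) \<le> ennreal (1.1 * a\<^sup>2 + 11 * b\<^sup>2)" by (rule ennreal_leI)
      also have "\<dots> = ennreal 1.1 * ennreal (a\<^sup>2) + ennreal 11 * ennreal (b\<^sup>2)"

      proof -
        have "ennreal (1.1 * a\<^sup>2) = ennreal 1.1 * ennreal (a\<^sup>2)" by (rule ennreal_mult) auto
        moreover have "ennreal (11 * b\<^sup>2) = ennreal 11 * ennreal (b\<^sup>2)" by (rule ennreal_mult) auto
        moreover have "ennreal (1.1 * a\<^sup>2 + 11 * b\<^sup>2) = ennreal (1.1 * a\<^sup>2) + ennreal (11 * b\<^sup>2)"
          by (rule ennreal_plus) auto
        ultimately show ?thesis by (simp only:)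
      qed
      also have "\<dots> \<le> ennreal 1.1 * (SUP v\<in>R. ennreal ((norm (F v x))\<^sup>2))
        + ennreal 11 * (\<Sum>v\<in>S. ennreal ((norm (F v x - F (\<pi> v) x))\<^sup>2))"
      proof (intro add_mono mult_left_mono)
        show "ennreal (a\<^sup>2) \<le> (SUP v\<in>R. ennreal ((norm (F v x))\<^sup>2))"
          unfolding a_def using R v by (intro SUP_upper) auto
        show "ennreal (b\<^sup>2) \<le> (\<Sum>v\<in>S. ennreal ((norm (F v x - F (\<pi> v) x))\<^sup>2))"
          unfolding b_def using fin v by (intro member_le_sum) auto
      qed auto
      finally show "ennreal ((norm (F v x))\<^sup>2) \<le> ennreal 1.1 * (SUP v\<in>R. ennreal ((norm (F v x))\<^sup>2))
        + ennreal 11 * (\<Sum>v\<in>S. ennreal ((norm (F v x - F (\<pi> v) x))\<^sup>2))" .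
    qed
    have "(\<integral>\<^sup>+x. (SUP v\<in>S. ennreal ((norm (F v x))\<^sup>2)) \<partial>N) \<le>
       (\<integral>\<^sup>+x. ennreal 1.1 * (SUP v\<in>R. ennreal ((norm (F v x))\<^sup>2))
        + ennreal 11 * (\<Sum>v\<in>S. ennreal ((norm (F v x - F (\<pi> v) x))\<^sup>2)) \<partial>N)"
      by (intro nn_integral_mono pt)
    also have "\<dots> = ennreal 1.1 * (\<integral>\<^sup>+x. (SUP v\<in>R. ennreal ((norm (F v x))\<^sup>2)) \<partial>N)
        + ennreal 11 * (\<Sum>v\<in>S. \<integral>\<^sup>+x. ennreal ((norm (F v x - F (\<pi> v) x))\<^sup>2) \<partial>N)"
      using R by (subst nn_integral_add) (auto simp: nn_integral_cmult nn_integral_sum simp del: sum_ennreal)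
    also have "\<dots> \<le> ennreal 1.1 * ennreal (8000 * A * sqrt (card R)) + ennreal 11 * (\<Sum>v\<in>S. ennreal (4 * d v (\<pi> v)))"
      using R by (intro add_mono mult_left_mono IH sum_mono less.prems(3)) auto
    also have "(\<Sum>v\<in>S. ennreal (4 * d v (\<pi> v))) = ennreal (\<Sum>v\<in>S. 4 * d v (\<pi> v))"
      using nonneg by (intro sum_ennreal) simp
    also have "ennreal 1.1 * ennreal (8000 * A * sqrt (card R)) + ennreal 11 * ennreal (\<Sum>v\<in>S. 4 * d v (\<pi> v))
        = ennreal (1.1 * (8000 * A * sqrt (card R)) + 11 * (\<Sum>v\<in>S. 4 * d v (\<pi> v)))"
    proof -
      have 1: "0 \<le> 8000 * A * sqrt (card R)" using A by simp
      have 2: "0 \<le> (\<Sum>v\<in>S. 4 * d v (\<pi> v))" using nonneg by (intro sum_nonneg) simp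
      have "ennreal (1.1 * (8000 * A * sqrt (card R))) = ennreal 1.1 * ennreal (8000 * A * sqrt (card R))"
        by (rule ennreal_mult) (use 1 in auto)
      moreover have "ennreal (11 * (\<Sum>v\<in>S. 4 * d v (\<pi> v))) = ennreal 11 * ennreal (\<Sum>v\<in>S. 4 * d v (\<pi> v))"
        by (rule ennreal_mult) (use 2 in auto)
      moreover have "ennreal (1.1 * (8000 * A * sqrt (card R)) + 11 * (\<Sum>v\<in>S. 4 * d v (\<pi> v))) = ennreal (1.1 * (8000 * A * sqrt (card R))) + ennreal (11 * (\<Sum>v\<in>S. 4 * d v (\<pi> v)))"
        by (rule ennreal_plus) (use 1 2 in auto)
      ultimately show ?thesis by (simp only:)
    qed
    also have "\<dots> \<le> ennreal (8000 * A * n)"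
    proof (rule ennreal_leI)
      have "1.1 * (8000 * A * sqrt (card R)) \<le> 1.1 * (8000 * A * (0.8661 * n))"
        using rR A by (intro mult_left_mono) auto
      moreover have "(\<Sum>v\<in>S. 4 * d v (\<pi> v)) = 4 * (\<Sum>v\<in>S. d v (\<pi> v))" by (simp add: sum_distrib_left)
      moreover have "0 \<le> A * n" using A n0 by simp
      ultimately show "1.1 * (8000 * A * sqrt (card R)) + 11 * (\<Sum>v\<in>S. 4 * d v (\<pi> v)) \<le> 8000 * A * n"
        using sum by (simp add: algebra_simps)
    qed
    finally show ?thesis unfolding n_def .
  qed
qed

section \<open>The maximal estimate\<close>

lemma fourier_diff:
  assumes "test_fn f" "test_fn g"
  shows "fourier (\<lambda>x. f x - g x) \<xi> = fourier f \<xi> - fourier g \<xi>"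
proof -
  have "integrable lborel (\<lambda>x. f x * cis (- (x \<bullet> \<xi>)))" "integrable lborel (\<lambda>x. g x * cis (- (x \<bullet> \<xi>)))"
    by (rule integrable_cis[OF test_fn_integrable[OF assms(1)]], simp)
       (rule integrable_cis[OF test_fn_integrable[OF assms(2)]], simp)
  then show ?thesis
    unfolding fourier_def left_diff_distrib by (rule Bochner_Integration.integral_diff)
qed

definition fourier_measure :: "(real^3 \<Rightarrow> complex) \<Rightarrow> (real^3) measure" where
  "fourier_measure f = density lborel (\<lambda>\<xi>. ennreal (1 / (2 * pi) ^ 3) * ennreal ((norm (fourier f \<xi>))\<^sup>2))"

lemma nn_integral_fourier_measure:
  assumes [measurable]: "f \<in> borel_measurable borel" "h \<in> borel_measurable borel"
  shows "(\<integral>\<^sup>+\<xi>. h \<xi> \<partial>fourier_measure f) = ennreal (1 / (2 * pi) ^ 3) * (\<integral>\<^sup>+\<xi>. ennreal ((norm (fourier f \<xi>))\<^sup>2) * h \<xi> \<partial>lborel)"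
  unfolding fourier_measure_def by (subst nn_integral_density) (auto simp: mult.assoc nn_integral_cmult)

lemma Plancherel_real3:
  fixes f :: "real^3 \<Rightarrow> complex"
  assumes "test_fn f"
  shows "ennreal (1 / (2 * pi) ^ 3) * (\<integral>\<^sup>+\<xi>. ennreal ((norm (fourier f \<xi>))\<^sup>2) \<partial>lborel) = sq_norm f"
proof -
  have "ennreal (1 / (2 * pi) ^ 3) * (ennreal ((2 * pi) ^ 3) * sq_norm f) = sq_norm f"
    by (subst mult.assoc[symmetric], subst ennreal_mult[symmetric]) auto
  then show ?thesis unfolding Plancherel_sq_norm[OF assms] by simp
qed

lemma fourier_measure_total:
  assumes "test_fn f"
  shows "emeasure (fourier_measure f) UNIV = sq_norm f"
proof -
  note [measurable] = test_fn_measurable[OF assms]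
  have "emeasure (fourier_measure f) UNIV = (\<integral>\<^sup>+\<xi>. 1 \<partial>fourier_measure f)"
    by (simp add: fourier_measure_def)
  also have "\<dots> = ennreal (1 / (2 * pi) ^ 3) * (\<integral>\<^sup>+\<xi>. ennreal ((norm (fourier f \<xi>))\<^sup>2) * 1 \<partial>lborel)"
    by (rule nn_integral_fourier_measure) measurable
  also have "\<dots> = sq_norm f" unfolding mult_1_right by (rule Plancherel_real3[OF assms])
  finally show ?thesis .
qed

text \<open>The measure has a density with respect to Lebesgue measure, for which hyperplanes are
  null.\<close>

lemma plane_null_fourier_measure:
  assumes f: "test_fn f"
  shows "plane_null_measure (fourier_measure f)"
proof (intro plane_null_measure.intro finite_measureI plane_null_measure_axioms.intro)
  note [measurable] = test_fn_measurable[OF f]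
  show "emeasure (fourier_measure f) (space (fourier_measure f)) \<noteq> \<infinity>"
    using fourier_measure_total[OF f] sq_norm_test_fn_finite[OF f] by (simp add: fourier_measure_def)
  show "sets (fourier_measure f) = sets borel" by (simp add: fourier_measure_def)
  fix P :: "real^3" assume P: "P \<noteq> 0"
  have "{x. P \<bullet> x = 0} \<in> null_sets lebesgue"
    using negligible_hyperplane[of P 0] P by (simp add: negligible_iff_null_sets)
  moreover have [measurable]: "{x. P \<bullet> x = 0} \<in> sets borel" by measurable
  ultimately have "{x. P \<bullet> x = 0} \<in> null_sets lborel" by (simp add: null_sets_def emeasure_completion)
  then have "AE \<xi> in lborel. \<xi> \<notin> {x. P \<bullet> x = 0}" by (rule AE_not_in)
  then have "AE \<xi> in lborel. \<xi> \<bullet> P \<noteq> 0" by eventually_elim (simp add: inner_commute)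
  then show "AE \<xi> in fourier_measure f. \<xi> \<bullet> P \<noteq> 0"
    unfolding fourier_measure_def by (subst AE_density) auto
qed

text \<open>For each band Plancherel gives an equality. On the frequency side uniformly bounded
  multipliers converge under a finite measure; in space there is only convergence almost everywhere,
  and Fatou turns it into an inequality.\<close>

lemma sq_norm_pv_hilbert_diff_le:
  fixes f :: "real^3 \<Rightarrow> complex"
  assumes f: "test_fn f"
  shows "sq_norm (\<lambda>x. pv_hilbert u f x - pv_hilbert v f x) \<le> (\<integral>\<^sup>+\<xi>. ennreal (pi\<^sup>2 * (sgn (\<xi> \<bullet> u) - sgn (\<xi> \<bullet> v))\<^sup>2) \<partial>fourier_measure f)"
proof -
  note [measurable] = test_fn_measurable[OF f]
  have fin: "sq_norm f < \<infinity>" by (rule sq_norm_test_fn_finite[OF f])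
  interpret plane_null_measure "fourier_measure f" by (rule plane_null_fourier_measure[OF f])
  define m where "m n \<tau> = band_multiplier (1 / real (Suc n)) (real (Suc n)) \<tau>" for n \<tau>
  have [measurable]: "m n \<in> borel_measurable borel" for n unfolding m_def[abs_def] band_multiplier_def by measurable
  have T: "test_fn (band_seq e n f)" for e n unfolding band_seq_def by (rule band_hilbert_test_fn[OF f band_seq_range])
  have FTm: "fourier (\<lambda>x. band_seq u n f x - band_seq v n f x) \<xi> = (m n (\<xi> \<bullet> u) - m n (\<xi> \<bullet> v)) * fourier f \<xi>" for n \<xi>
    unfolding fourier_diff[OF T T] unfolding band_seq_def fourier_band_hilbert[OF f band_seq_range] m_def by (simp add: left_diff_distrib)
  have N2n: "sq_norm (\<lambda>x. band_seq u n f x - band_seq v n f x) = (\<integral>\<^sup>+\<xi>. ennreal ((norm (m n (\<xi> \<bullet> u) - m n (\<xi> \<bullet> v)))\<^sup>2) \<partial>fourier_measure f)" for n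
    unfolding Plancherel_real3[OF test_fn_diff[OF T T], symmetric] FTm norm_mult power_mult_distrib
    by (subst nn_integral_fourier_measure) (auto simp: ennreal_mult mult.commute)
  obtain B where B: "0 \<le> B" "\<And>a b \<tau>. 0 < a \<Longrightarrow> a \<le> b \<Longrightarrow> norm (band_multiplier a b \<tau>) \<le> B"
    using band_multiplier_bounded by blast
  have "(\<lambda>n. sq_norm (\<lambda>x. band_seq u n f x - band_seq v n f x)) \<longlonglongrightarrow> (\<integral>\<^sup>+\<xi>. ennreal (pi\<^sup>2 * (sgn (\<xi> \<bullet> u) - sgn (\<xi> \<bullet> v))\<^sup>2) \<partial>fourier_measure f)"
    unfolding N2n
  proof (rule nn_integral_dominated_convergence[where w="\<lambda>_. ennreal ((2 * B)\<^sup>2)"])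
    show "(\<integral>\<^sup>+\<xi>. ennreal ((2 * B)\<^sup>2) \<partial>fourier_measure f) < \<infinity>"
      using fourier_measure_total[OF f] fin by (simp add: ennreal_mult_less_top)
    show "AE \<xi> in fourier_measure f. ennreal ((norm (m n (\<xi> \<bullet> u) - m n (\<xi> \<bullet> v)))\<^sup>2) \<le> ennreal ((2 * B)\<^sup>2)" for n
    proof (intro AE_I2 ennreal_leI power_mono)
      fix \<xi>
      have "norm (m n (\<xi> \<bullet> u) - m n (\<xi> \<bullet> v)) \<le> norm (m n (\<xi> \<bullet> u)) + norm (m n (\<xi> \<bullet> v))" by (rule norm_triangle_ineq4)
      also have "\<dots> \<le> B + B" unfolding m_def by (intro add_mono B band_seq_range)
      finally show "norm (m n (\<xi> \<bullet> u) - m n (\<xi> \<bullet> v)) \<le> 2 * B" by simp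
    qed simp
    show "AE \<xi> in fourier_measure f. (\<lambda>n. ennreal ((norm (m n (\<xi> \<bullet> u) - m n (\<xi> \<bullet> v)))\<^sup>2)) \<longlonglongrightarrow> ennreal (pi\<^sup>2 * (sgn (\<xi> \<bullet> u) - sgn (\<xi> \<bullet> v))\<^sup>2)"
    proof (intro AE_I2 tendsto_ennrealI)
      fix \<xi>
      have "(\<lambda>n. (norm (m n (\<xi> \<bullet> u) - m n (\<xi> \<bullet> v)))\<^sup>2) \<longlonglongrightarrow>
        (norm (- (\<i> * pi * complex_of_real (sgn (\<xi> \<bullet> u))) - - (\<i> * pi * complex_of_real (sgn (\<xi> \<bullet> v)))))\<^sup>2"
        unfolding m_def by (intro tendsto_intros band_multiplier_tendsto)
      also have "- (\<i> * pi * complex_of_real (sgn (\<xi> \<bullet> u))) - - (\<i> * pi * complex_of_real (sgn (\<xi> \<bullet> v)))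
         = - \<i> * complex_of_real (pi * (sgn (\<xi> \<bullet> u) - sgn (\<xi> \<bullet> v)))" by (simp add: algebra_simps)
      also have "(norm \<dots>)\<^sup>2 = pi\<^sup>2 * (sgn (\<xi> \<bullet> u) - sgn (\<xi> \<bullet> v))\<^sup>2"
        unfolding norm_mult norm_of_real by (simp add: power_mult_distrib)
      finally show "(\<lambda>n. (norm (m n (\<xi> \<bullet> u) - m n (\<xi> \<bullet> v)))\<^sup>2) \<longlonglongrightarrow> pi\<^sup>2 * (sgn (\<xi> \<bullet> u) - sgn (\<xi> \<bullet> v))\<^sup>2" .
    qed
  qed measurable
  then have "liminf (\<lambda>n. sq_norm (\<lambda>x. band_seq u n f x - band_seq v n f x)) = (\<integral>\<^sup>+\<xi>. ennreal (pi\<^sup>2 * (sgn (\<xi> \<bullet> u) - sgn (\<xi> \<bullet> v))\<^sup>2) \<partial>fourier_measure f)"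
    by (rule lim_imp_Liminf[OF sequentially_bot])
  moreover have "sq_norm (\<lambda>x. pv_hilbert u f x - pv_hilbert v f x) \<le> liminf (\<lambda>n. sq_norm (\<lambda>x. band_seq u n f x - band_seq v n f x))"
  proof (rule sq_norm_le_liminf)
    have "AE x in lborel. (\<lambda>n. band_seq u n f x) \<longlonglongrightarrow> pv_hilbert u f x" "AE x in lborel. (\<lambda>n. band_seq v n f x) \<longlonglongrightarrow> pv_hilbert v f x"
      by (intro AE_band_seq_tendsto_pv_hilbert fin; measurable)+
    then show "AE x in lborel. (\<lambda>n. band_seq u n f x - band_seq v n f x) \<longlonglongrightarrow> pv_hilbert u f x - pv_hilbert v f x"
      by eventually_elim (rule tendsto_diff)
  qed measurable
  ultimately show ?thesis by simp
qed

text \<open>The distance for the chaining is \<open>pi\<^sup>2 * sep u v\<close>. The squared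
  difference of signs is 4 on the separating planes and 0 on almost all others;
  \<open>pi\<^sup>2\<close> makes up for the omitted factor \<open>1 / pi\<close>.\<close>

lemma maximal_pv_hilbert_test_fn:
  fixes f :: "real^3 \<Rightarrow> complex"
  assumes f: "test_fn f" and S: "finite S" "0 \<notin> S"
  shows "(\<integral>\<^sup>+x. (SUP v\<in>S. ennreal ((norm (pv_hilbert v f x))\<^sup>2)) \<partial>lborel) \<le> ennreal (8000 * pi\<^sup>2 * sqrt (card S)) * sq_norm f"
proof -
  note [measurable] = test_fn_measurable[OF f]
  interpret plane_null_measure "fourier_measure f" by (rule plane_null_fourier_measure[OF f])
  define t where "t = measure (fourier_measure f) UNIV"
  have t: "0 \<le> t" "sq_norm f = ennreal t"
    unfolding t_def by (rule measure_nonneg) (rule fourier_measure_total[OF f, unfolded emeasure_eq_measure, symmetric])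
  have "(\<integral>\<^sup>+x. (SUP v\<in>S. ennreal ((norm (pv_hilbert v f x))\<^sup>2)) \<partial>lborel) \<le> ennreal (8000 * (pi\<^sup>2 * t) * sqrt (card S))"
  proof (rule nn_integral_SUP_square_chain[where d="\<lambda>u v. pi\<^sup>2 * sep u v"])
    show "\<exists>p\<in>T. \<exists>q\<in>T. p \<noteq> q \<and> pi\<^sup>2 * sep p q \<le> 8 * (pi\<^sup>2 * t) / sqrt (card T)" if "T \<subseteq> S" "2 \<le> card T" for T
    proof -
      have "finite T" "0 \<notin> T" using that S finite_subset by auto
      from close_pair_exists[OF this that(2)]
      obtain p q where pq: "p \<in> T" "q \<in> T" "p \<noteq> q" "sep p q \<le> 8 * t / sqrt (card T)"
        unfolding t_def by blast
      have "pi\<^sup>2 * sep p q \<le> pi\<^sup>2 * (8 * t / sqrt (card T))" by (intro mult_left_mono pq) simp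
      also have "\<dots> = 8 * (pi\<^sup>2 * t) / sqrt (card T)" by simp
      finally show ?thesis using pq by blast
    qed
    show "(\<integral>\<^sup>+x. ennreal ((norm (pv_hilbert u f x - pv_hilbert v f x))\<^sup>2) \<partial>lborel) \<le> ennreal (4 * (pi\<^sup>2 * sep u v))"
      if "u \<in> S" "v \<in> S" for u v
    proof -
      have uv: "u \<noteq> 0" "v \<noteq> 0" using that S(2) by auto
      let ?A = "{\<xi>. (\<xi> \<bullet> u) * (\<xi> \<bullet> v) < 0}"
      have [measurable]: "?A \<in> sets (fourier_measure f)" by measurable
      have "sq_norm (\<lambda>x. pv_hilbert u f x - pv_hilbert v f x) \<le> (\<integral>\<^sup>+\<xi>. ennreal (pi\<^sup>2 * (sgn (\<xi> \<bullet> u) - sgn (\<xi> \<bullet> v))\<^sup>2) \<partial>fourier_measure f)"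
        by (rule sq_norm_pv_hilbert_diff_le[OF f])
      also have "\<dots> = (\<integral>\<^sup>+\<xi>. ennreal (4 * pi\<^sup>2) * indicator ?A \<xi> \<partial>fourier_measure f)"
      proof (rule nn_integral_cong_AE)
        show "AE \<xi> in fourier_measure f. ennreal (pi\<^sup>2 * (sgn (\<xi> \<bullet> u) - sgn (\<xi> \<bullet> v))\<^sup>2) = ennreal (4 * pi\<^sup>2) * indicator ?A \<xi>"
          using plane_null[OF uv(1)] plane_null[OF uv(2)]
          by eventually_elim (auto simp: sgn_if mult_less_0_iff indicator_def power2_eq_square mult.commute)
      qed
      also have "\<dots> = ennreal (4 * pi\<^sup>2) * emeasure (fourier_measure f) ?A" by (rule nn_integral_cmult_indicator) measurable
      also have "\<dots> = ennreal (4 * (pi\<^sup>2 * sep u v))"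
        unfolding emeasure_eq_measure sep_def by (subst ennreal_mult[symmetric]) (auto simp: mult.assoc)
      finally show ?thesis unfolding sq_norm_def .
    qed
    \<comment> \<open>A single transform is its difference from the one in direction 0.\<close>
    show "(\<integral>\<^sup>+x. ennreal ((norm (pv_hilbert v f x))\<^sup>2) \<partial>lborel) \<le> ennreal (pi\<^sup>2 * t)" for v
    proof -
      have "sq_norm (\<lambda>x. pv_hilbert v f x - pv_hilbert 0 f x) \<le> (\<integral>\<^sup>+\<xi>. ennreal (pi\<^sup>2 * (sgn (\<xi> \<bullet> v) - sgn (\<xi> \<bullet> 0))\<^sup>2) \<partial>fourier_measure f)"
        by (rule sq_norm_pv_hilbert_diff_le[OF f])
      also have "\<dots> \<le> (\<integral>\<^sup>+\<xi>. ennreal (pi\<^sup>2) \<partial>fourier_measure f)"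
        by (intro nn_integral_mono ennreal_leI) (auto simp: sgn_if)
      also have "\<dots> = ennreal (pi\<^sup>2 * t)"
        using t(1) by (simp add: emeasure_eq_measure t_def ennreal_mult)
      finally show ?thesis by (simp add: pv_hilbert_zero_direction sq_norm_def)
    qed
  qed (use S t sep_nonneg in auto)
  also have "\<dots> = ennreal (8000 * pi\<^sup>2 * sqrt (card S)) * sq_norm f"
    unfolding t(2) using t(1) by (subst ennreal_mult[symmetric]) (auto simp: mult_ac)
  finally show ?thesis .
qed

text \<open>The maximal operator is only sublinear, so the error \<open>f - g\<close> is handled by
  summing over all directions. The resulting factor \<open>card S\<close> is harmless because
  \<open>g\<close> is chosen after \<open>S\<close>. Splitting \<open>f\<close>, and then bounding
  the norm of \<open>g\<close> by that of \<open>f\<close>, costs a factor 2 each, whence 32000 in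
  place of 8000.\<close>

lemma maximal_pv_hilbert_L2:
  fixes f :: "real^3 \<Rightarrow> complex"
  assumes [measurable]: "f \<in> borel_measurable borel" and f: "sq_norm f < \<infinity>" and S: "finite S" "0 \<notin> S"
  shows "(\<integral>\<^sup>+x. (SUP v\<in>S. ennreal ((norm (pv_hilbert v f x))\<^sup>2)) \<partial>lborel) \<le> ennreal (32000 * pi\<^sup>2 * sqrt (card S)) * sq_norm f"
proof (rule ennreal_le_epsilon)
  fix \<eta> :: real assume \<eta>: "0 < \<eta>"
  obtain C where C: "0 \<le> C" "\<And>(e::real^3) f. f \<in> borel_measurable borel \<Longrightarrow> sq_norm f < \<infinity> \<Longrightarrow> sq_norm (pv_hilbert e f) \<le> ennreal C * sq_norm f"
    using sq_norm_pv_hilbert by blast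
  define K where "K = 8000 * pi\<^sup>2 * sqrt (card S)"
  \<comment> \<open>Up to the 1, the total weight with which the error \<open>d\<close> enters the
    final estimate.\<close>
  define M where "M = 4 * K + 2 * (real (card S) * C) + 1"
  have K: "0 \<le> K" by (simp add: K_def)
  have M: "0 < M" using K C by (simp add: M_def add_nonneg_pos)
  define d where "d = \<eta> / M"
  have d: "0 < d" using \<eta> M by (simp add: d_def)
  obtain g where g: "test_fn g" "sq_norm (\<lambda>x. f x - g x) \<le> ennreal d" using test_fn_dense[of f d] f d by auto
  have [measurable]: "g \<in> borel_measurable borel" using g by (intro test_fn_measurable)
  have [measurable]: "(\<lambda>x. SUP v\<in>S. ennreal ((norm (pv_hilbert v g x))\<^sup>2)) \<in> borel_measurable borel"
    using S(1) by (intro borel_measurable_SUP) (auto intro: countable_finite)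
  have fg: "sq_norm (\<lambda>x. f x - g x) < \<infinity>" using order_le_less_trans[OF g(2) ennreal_less_top] by simp
  have gle: "sq_norm g \<le> 2 * sq_norm f + 2 * ennreal d"
  proof -
    have "sq_norm g = sq_norm (\<lambda>x. f x - (f x - g x))" by simp
    also have "\<dots> \<le> 2 * sq_norm f + 2 * sq_norm (\<lambda>x. f x - g x)" by (rule sq_norm_diff_le) auto
    also have "\<dots> \<le> 2 * sq_norm f + 2 * ennreal d" by (intro add_mono mult_left_mono g(2)) auto
    finally show ?thesis .
  qed
  have "AE x in lborel. \<forall>v\<in>S. pv_hilbert v (\<lambda>x. f x - g x) x = pv_hilbert v f x - pv_hilbert v g x"
    using S f sq_norm_test_fn_finite[OF g(1)] by (intro AE_finite_allI pv_hilbert_diff_AE) auto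
  then have pt: "AE x in lborel. (SUP v\<in>S. ennreal ((norm (pv_hilbert v f x))\<^sup>2)) \<le>
     2 * (SUP v\<in>S. ennreal ((norm (pv_hilbert v g x))\<^sup>2)) + 2 * (\<Sum>v\<in>S. ennreal ((norm (pv_hilbert v (\<lambda>x. f x - g x) x))\<^sup>2))"
  proof eventually_elim
    fix x assume *: "\<forall>v\<in>S. pv_hilbert v (\<lambda>x. f x - g x) x = pv_hilbert v f x - pv_hilbert v g x"
    show "(SUP v\<in>S. ennreal ((norm (pv_hilbert v f x))\<^sup>2)) \<le>
     2 * (SUP v\<in>S. ennreal ((norm (pv_hilbert v g x))\<^sup>2)) + 2 * (\<Sum>v\<in>S. ennreal ((norm (pv_hilbert v (\<lambda>x. f x - g x) x))\<^sup>2))"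
    proof (rule SUP_least)
      fix v assume v: "v \<in> S"
      have "pv_hilbert v f x = pv_hilbert v g x + pv_hilbert v (\<lambda>x. f x - g x) x" using * v by simp
      then have "ennreal ((norm (pv_hilbert v f x))\<^sup>2) \<le> 2 * ennreal ((norm (pv_hilbert v g x))\<^sup>2) + 2 * ennreal ((norm (pv_hilbert v (\<lambda>x. f x - g x) x))\<^sup>2)"
        by (simp only: norm_square_add_le)
      also have "\<dots> \<le> 2 * (SUP v\<in>S. ennreal ((norm (pv_hilbert v g x))\<^sup>2)) + 2 * (\<Sum>v\<in>S. ennreal ((norm (pv_hilbert v (\<lambda>x. f x - g x) x))\<^sup>2))"
      proof (intro add_mono mult_left_mono)
        show "ennreal ((norm (pv_hilbert v g x))\<^sup>2) \<le> (SUP v\<in>S. ennreal ((norm (pv_hilbert v g x))\<^sup>2))" using v by (intro SUP_upper)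
        show "ennreal ((norm (pv_hilbert v (\<lambda>x. f x - g x) x))\<^sup>2) \<le> (\<Sum>v\<in>S. ennreal ((norm (pv_hilbert v (\<lambda>x. f x - g x) x))\<^sup>2))"
          using v S(1) by (intro member_le_sum) auto
      qed auto
      finally show "ennreal ((norm (pv_hilbert v f x))\<^sup>2) \<le> 2 * (SUP v\<in>S. ennreal ((norm (pv_hilbert v g x))\<^sup>2)) + 2 * (\<Sum>v\<in>S. ennreal ((norm (pv_hilbert v (\<lambda>x. f x - g x) x))\<^sup>2))" .
    qed
  qed
  have "(\<integral>\<^sup>+x. (SUP v\<in>S. ennreal ((norm (pv_hilbert v f x))\<^sup>2)) \<partial>lborel) \<le>
     (\<integral>\<^sup>+x. 2 * (SUP v\<in>S. ennreal ((norm (pv_hilbert v g x))\<^sup>2)) + 2 * (\<Sum>v\<in>S. ennreal ((norm (pv_hilbert v (\<lambda>x. f x - g x) x))\<^sup>2)) \<partial>lborel)"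
    by (rule nn_integral_mono_AE[OF pt])
  also have "\<dots> = 2 * (\<integral>\<^sup>+x. (SUP v\<in>S. ennreal ((norm (pv_hilbert v g x))\<^sup>2)) \<partial>lborel) + 2 * (\<Sum>v\<in>S. sq_norm (pv_hilbert v (\<lambda>x. f x - g x)))"
    unfolding sq_norm_def by (subst nn_integral_add) (auto simp: nn_integral_cmult nn_integral_sum simp del: sum_ennreal)
  also have "\<dots> \<le> 2 * (ennreal K * (2 * sq_norm f + 2 * ennreal d)) + 2 * (\<Sum>v\<in>S. ennreal C * ennreal d)"
  proof (intro add_mono mult_left_mono sum_mono)
    show "(\<integral>\<^sup>+x. (SUP v\<in>S. ennreal ((norm (pv_hilbert v g x))\<^sup>2)) \<partial>lborel) \<le> ennreal K * (2 * sq_norm f + 2 * ennreal d)"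
      using maximal_pv_hilbert_test_fn[OF g(1) S] mult_left_mono[OF gle, of "ennreal K"] unfolding K_def by (auto intro: order_trans)
    show "sq_norm (pv_hilbert v (\<lambda>x. f x - g x)) \<le> ennreal C * ennreal d" for v
    proof -
      have "sq_norm (pv_hilbert v (\<lambda>x. f x - g x)) \<le> ennreal C * sq_norm (\<lambda>x. f x - g x)" by (rule C(2)[OF _ fg]) measurable
      also have "\<dots> \<le> ennreal C * ennreal d" by (intro mult_left_mono g(2)) simp
      finally show ?thesis .
    qed
  qed auto
  also have "\<dots> = ennreal (4 * K) * sq_norm f + ennreal ((4 * K + 2 * (real (card S) * C)) * d)"
  proof -
    obtain m where m: "0 \<le> m" "sq_norm f = ennreal m" using f by (cases "sq_norm f") auto
    have "2 * (ennreal K * (2 * sq_norm f + 2 * ennreal d)) + 2 * (\<Sum>v\<in>S. ennreal C * ennreal d)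
      = ennreal (2 * (K * (2 * m + 2 * d)) + 2 * (real (card S) * (C * d)))"
      using m K C(1) d by (simp add: ennreal_mult ennreal_plus ennreal_of_nat_eq_real_of_nat)
    also have "2 * (K * (2 * m + 2 * d)) + 2 * (real (card S) * (C * d)) = 4 * K * m + (4 * K + 2 * (real (card S) * C)) * d"
      by (simp add: algebra_simps)
    also have "ennreal \<dots> = ennreal (4 * K) * sq_norm f + ennreal ((4 * K + 2 * (real (card S) * C)) * d)"
      unfolding m using m K C(1) d by (subst ennreal_plus) (auto simp: ennreal_mult)
    finally show ?thesis .
  qed
  also have "\<dots> \<le> ennreal (4 * K) * sq_norm f + ennreal \<eta>"
  proof (intro add_left_mono ennreal_leI)
    have "(4 * K + 2 * (real (card S) * C)) * d \<le> M * d" using d by (intro mult_right_mono) (auto simp: M_def)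
    then show "(4 * K + 2 * (real (card S) * C)) * d \<le> \<eta>" using M by (simp add: d_def)
  qed
  also have "4 * K = 32000 * pi\<^sup>2 * sqrt (card S)" by (simp add: K_def)
  finally show "(\<integral>\<^sup>+x. (SUP v\<in>S. ennreal ((norm (pv_hilbert v f x))\<^sup>2)) \<partial>lborel) \<le> ennreal (32000 * pi\<^sup>2 * sqrt (card S)) * sq_norm f + ennreal \<eta>" .
qed

section \<open>Directional Hilbert transforms of square-integrable functions\<close>

lemma lift_nth: "lift v $ 1 = v $ 1" "lift v $ 2 = v $ 2" "lift v $ 3 = 1"
  by (simp_all add: lift_def)

lemma lift_nonzero: "lift v \<noteq> 0"
  using lift_nth(3)[of v] by (metis zero_index zero_neq_one)

lemma inj_lift: "inj lift"
proof (rule injI)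
  fix u v :: "real^2" assume "lift u = lift v"
  then have "u $ 1 = v $ 1" "u $ 2 = v $ 2" using lift_nth(1,2) by metis+
  then show "u = v" by (simp add: vec_eq_iff forall_2)
qed

lemma lebesgue_measurable_borel_representative:
  fixes f :: "'a::euclidean_space \<Rightarrow> complex"
  assumes [measurable]: "f \<in> borel_measurable lebesgue"
  obtains g where "g \<in> borel_measurable borel" "AE x in lborel. f x = g x"
proof -
  obtain r where r: "r \<in> borel_measurable lborel" "AE x in lborel. Re (f x) = r x"
    using completion_ex_borel_measurable_real[of "\<lambda>x. Re (f x)" lborel] by auto
  obtain i where i: "i \<in> borel_measurable lborel" "AE x in lborel. Im (f x) = i x"
    using completion_ex_borel_measurable_real[of "\<lambda>x. Im (f x)" lborel] by auto
  have [measurable]: "r \<in> borel_measurable borel" "i \<in> borel_measurable borel" using r i by auto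
  show thesis
  proof (rule that[of "\<lambda>x. complex_of_real (r x) + \<i> * complex_of_real (i x)"])
    show "AE x in lborel. f x = complex_of_real (r x) + \<i> * complex_of_real (i x)"
      using r(2) i(2) by eventually_elim (simp add: complex_eq_iff)
  qed measurable
qed

text \<open>Tonelli for a Borel null set containing the exceptional points. Hence the passage to a
  Borel representative leaves the truncations unchanged at almost every point.\<close>

lemma AE_along_line:
  fixes e :: "'a::euclidean_space"
  assumes "AE x in lborel. P x"
  shows "AE x in lborel. AE t in lborel. P (x - t *\<^sub>R e)"
proof -
  obtain Z where Z: "{x \<in> space lborel. \<not> P x} \<subseteq> Z" "emeasure lborel Z = 0" "Z \<in> sets lborel"
    using assms by (rule AE_E)
  then have [measurable]: "Z \<in> sets borel" by simp
  have "(\<integral>\<^sup>+x. (\<integral>\<^sup>+t. indicator Z (x - t *\<^sub>R e) \<partial>lborel) \<partial>lborel) = (\<integral>\<^sup>+t. (\<integral>\<^sup>+x. indicator Z (x - t *\<^sub>R e) \<partial>lborel) \<partial>lborel)"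
    by (rule lborel_pair.Fubini') measurable
  also have "\<dots> = (\<integral>\<^sup>+t. (\<integral>\<^sup>+x. indicator Z x \<partial>lborel) \<partial>(lborel :: real measure))"
    by (rule nn_integral_cong, rule nn_integral_translate) measurable
  also have "\<dots> = 0" using Z by simp
  finally have "AE x in lborel. (\<integral>\<^sup>+t. indicator Z (x - t *\<^sub>R e) \<partial>lborel) = 0"
    by (subst (asm) nn_integral_0_iff_AE) auto
  then show ?thesis
  proof eventually_elim
    fix x assume "(\<integral>\<^sup>+t. indicator Z (x - t *\<^sub>R e) \<partial>lborel) = 0"
    then have "AE t in lborel. indicator Z (x - t *\<^sub>R e) = (0 :: ennreal)"
      by (subst (asm) nn_integral_0_iff_AE) auto
    then show "AE t in lborel. P (x - t *\<^sub>R e)"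
      by eventually_elim (use Z(1) in \<open>auto simp: indicator_def split: if_splits\<close>)
  qed
qed

text \<open>A Lebesgue measurable function on space need not be measurable on each line.
  \<open>F\<close> inherits measurability for the completion from its agreement with
  \<open>G\<close> almost everywhere.\<close>

lemma integral_lebesgue_cong_borel:
  fixes F G :: "'a::euclidean_space \<Rightarrow> 'b::{banach,second_countable_topology}"
  assumes G: "G \<in> borel_measurable borel" and FG: "AE t in lborel. F t = G t"
  shows "integral\<^sup>L lebesgue F = integral\<^sup>L lborel G"
proof -
  have G': "G \<in> borel_measurable lebesgue" using G by (intro measurable_completion) simp
  have AE: "AE t in lebesgue. F t = G t" using FG by (rule AE_completion)
  have F': "F \<in> borel_measurable lebesgue"
  proof (rule measurableI)
    fix U :: "'b set" assume U: "U \<in> sets borel"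
    show "F -` U \<inter> space lebesgue \<in> sets lebesgue"
    proof (rule completion.in_sets_AE)
      show "AE x in lebesgue. (x \<in> G -` U \<inter> space lebesgue) = (x \<in> F -` U \<inter> space lebesgue)"
        using AE by eventually_elim auto
      show "G -` U \<inter> space lebesgue \<in> sets lebesgue" using G' U by (rule measurable_sets)
    qed auto
  qed simp
  have "integral\<^sup>L lebesgue F = integral\<^sup>L lebesgue G" by (rule integral_cong_AE[OF F' G' AE])
  also have "\<dots> = integral\<^sup>L lborel G" using G by (intro integral_completion) simp
  finally show ?thesis .
qed

text \<open>Two null sets are discarded: points whose line carries a non-negligible difference of
  \<open>f\<close> and \<open>g\<close>, and points at which the truncations of \<open>g\<close>
  diverge. Elsewhere \<open>Lim\<close> is a genuine limit and not an unspecified value.\<close>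

lemma AE_directional_Hilbert:
  assumes [measurable]: "g \<in> borel_measurable borel" and g: "sq_norm g < \<infinity>" and fg: "AE x in lborel. f x = g x"
  shows "AE x in lborel. directional_Hilbert v f x = pv_hilbert (lift v) g x / pi"
  using AE_along_line[OF fg, of "lift v"] AE_pv_pv_hilbert[OF _ g lift_nonzero[of v], simplified]
proof eventually_elim
  case (elim x)
  have "(CLINT t:{t. \<epsilon> < \<bar>t\<bar>}|lebesgue. f (x - t *\<^sub>R lift v) / of_real t) = tail_hilbert (lift v) \<epsilon> g x" for \<epsilon>
    unfolding set_lebesgue_integral_def tail_hilbert_def
  proof (rule integral_lebesgue_cong_borel)
    show "AE t in lborel. indicator {t. \<epsilon> < \<bar>t\<bar>} t *\<^sub>R (f (x - t *\<^sub>R lift v) / of_real t) = tail_kernel \<epsilon> t *\<^sub>R g (x - t *\<^sub>R lift v)"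
      using elim(1) by eventually_elim (simp add: tail_kernel_def scaleR_conv_of_real indicator_def)
  qed measurable
  moreover have "((\<lambda>\<epsilon>. 1 / pi * tail_hilbert (lift v) \<epsilon> g x) \<longlongrightarrow> 1 / pi * pv_hilbert (lift v) g x) (at_right 0)"
    by (intro tendsto_intros elim(2))
  ultimately show ?case unfolding directional_Hilbert_def
    by (simp add: tendsto_Lim[OF trivial_limit_at_right_real])
qed

lemma L2_norm_le_iff:
  assumes c: "0 \<le> c"
  shows "L2_norm f \<le> ennreal (sqrt c) \<longleftrightarrow> (\<integral>\<^sup>+x. ennreal ((norm (f x))\<^sup>2) \<partial>lebesgue) \<le> ennreal c"
proof (cases "\<integral>\<^sup>+x. ennreal ((norm (f x))\<^sup>2) \<partial>lebesgue")
  case (real r)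
  then show ?thesis using c by (simp add: L2_norm_def ennreal_le_iff)
next
  case top
  then show ?thesis by (simp add: L2_norm_def top_unique)
qed

theorem theorem3p5:
  fixes h :: "real \<Rightarrow> real"
  assumes "\<And>x. x \<ge> 2 \<Longrightarrow> h x \<ge> 2"
    and "mono_on {2..} h"
    and "filterlim h at_top at_top"
    and "((\<lambda>x. h x / ln x) \<longlongrightarrow> 0) at_top"
    and "((\<lambda>x. h ((ln x) ^ 4) / h x) \<longlongrightarrow> 0) at_top"
  shows "\<exists>C>0. \<forall>N::nat. N \<ge> 2 \<longrightarrow>
           (\<forall>\<Omega>::(real ^ 2) set. finite \<Omega> \<and> card \<Omega> = N \<longrightarrow>
              L2_operator_norm (maximal_Hilbert \<Omega>)
                \<le> ennreal (C * real N powr (1 / 4) * h (real N)))"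
proof -
  \<comment> \<open>The constant of \<open>maximal_pv_hilbert_L2\<close>. It bounds squared norms,
    so \<open>sqrt K\<close> is the final constant and \<open>sqrt N\<close> turns into
    \<open>real N powr (1 / 4)\<close>.\<close>
  define K where "K = 32000 * pi\<^sup>2"
  have K: "0 < K" by (simp add: K_def)
  have main: "L2_norm (maximal_Hilbert \<Omega> f) \<le> ennreal (sqrt K * real N powr (1 / 4) * h (real N))"
    if N: "2 \<le> N" and \<Omega>: "finite \<Omega>" "card \<Omega> = N" and f: "f \<in> L2_space" "L2_norm f \<le> 1" for N :: nat and \<Omega> and f
  proof -
    have "f \<in> borel_measurable lebesgue" using f by (simp add: L2_space_def)
    then obtain g where [measurable]: "g \<in> borel_measurable borel" and fg: "AE x in lborel. f x = g x"
      by (rule lebesgue_measurable_borel_representative)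
    have "(\<integral>\<^sup>+x. ennreal ((norm (f x))\<^sup>2) \<partial>lebesgue) \<le> 1"
      using f(2) L2_norm_le_iff[of 1 f] by simp
    also have "(\<integral>\<^sup>+x. ennreal ((norm (f x))\<^sup>2) \<partial>lebesgue) = sq_norm g"
      unfolding sq_norm_def nn_integral_completion using fg by (intro nn_integral_cong_AE) (auto elim: eventually_mono)
    finally have g1: "sq_norm g \<le> 1" .
    then have g: "sq_norm g < \<infinity>" by (rule order_le_less_trans) simp
    define S where "S = lift ` \<Omega>"
    have S: "finite S" "0 \<notin> S" "card S = N"
      using \<Omega> lift_nonzero card_image[OF inj_on_subset[OF inj_lift, of \<Omega>]] by (auto simp: S_def)
    have ne: "\<Omega> \<noteq> {}" using \<Omega> N by auto
    have "AE x in lborel. \<forall>v\<in>\<Omega>. directional_Hilbert v f x = pv_hilbert (lift v) g x / pi"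
      using \<Omega>(1) by (intro AE_finite_allI AE_directional_Hilbert g fg) auto
    then have "AE x in lborel. ennreal ((norm (maximal_Hilbert \<Omega> f x))\<^sup>2) \<le> (SUP v\<in>S. ennreal ((norm (pv_hilbert v g x))\<^sup>2))"
    proof eventually_elim
      fix x assume *: "\<forall>v\<in>\<Omega>. directional_Hilbert v f x = pv_hilbert (lift v) g x / pi"
      \<comment> \<open>On the reals \<open>SUP\<close> is meaningful only for nonempty bounded
        sets; here it is attained.\<close>
      have "maximal_Hilbert \<Omega> f x \<in> (\<lambda>v. cmod (directional_Hilbert v f x)) ` \<Omega>"
        unfolding maximal_Hilbert_def using \<Omega>(1) ne by (subst cSup_eq_Max) (auto intro!: Max_in)
      then obtain v where v: "v \<in> \<Omega>" "maximal_Hilbert \<Omega> f x = cmod (directional_Hilbert v f x)" by blast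
      have "norm (maximal_Hilbert \<Omega> f x) = norm (pv_hilbert (lift v) g x) / pi"
        using v * by (simp add: norm_divide)
      \<comment> \<open>The factor \<open>1 / pi\<close> is below 1 and is given away.\<close>
      also have "\<dots> \<le> norm (pv_hilbert (lift v) g x) / 1" using pi_gt3 by (intro divide_left_mono) auto
      finally have "ennreal ((norm (maximal_Hilbert \<Omega> f x))\<^sup>2) \<le> ennreal ((norm (pv_hilbert (lift v) g x))\<^sup>2)"
        by (intro ennreal_leI power_mono) auto
      also have "\<dots> \<le> (SUP v\<in>S. ennreal ((norm (pv_hilbert v g x))\<^sup>2))"
        using v by (intro SUP_upper) (simp add: S_def)
      finally show "ennreal ((norm (maximal_Hilbert \<Omega> f x))\<^sup>2) \<le> (SUP v\<in>S. ennreal ((norm (pv_hilbert v g x))\<^sup>2))" .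
    qed
    then have "(\<integral>\<^sup>+x. ennreal ((norm (maximal_Hilbert \<Omega> f x))\<^sup>2) \<partial>lebesgue) \<le> (\<integral>\<^sup>+x. (SUP v\<in>S. ennreal ((norm (pv_hilbert v g x))\<^sup>2)) \<partial>lborel)"
      unfolding nn_integral_completion by (rule nn_integral_mono_AE)
    also have "\<dots> \<le> ennreal (K * sqrt N) * sq_norm g"
      using maximal_pv_hilbert_L2[OF _ g S(1,2)] unfolding K_def S(3) by simp
    also have "\<dots> \<le> ennreal (K * sqrt N) * 1" by (intro mult_left_mono g1) simp
    finally have "L2_norm (maximal_Hilbert \<Omega> f) \<le> ennreal (sqrt (K * sqrt N))"
      using K by (subst L2_norm_le_iff) auto
    also have "sqrt (K * sqrt N) = sqrt K * real N powr (1 / 4)"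
      by (simp add: real_sqrt_mult powr_half_sqrt[symmetric] powr_powr)
    also have "ennreal \<dots> \<le> ennreal (sqrt K * real N powr (1 / 4) * h (real N))"
    proof (rule ennreal_leI)
      have "1 \<le> h (real N)" using assms(1)[of "real N"] N by simp
      then show "sqrt K * real N powr (1 / 4) \<le> sqrt K * real N powr (1 / 4) * h (real N)"
        using mult_left_mono[of 1 "h (real N)" "sqrt K * real N powr (1 / 4)"] K by simp
    qed
    finally show ?thesis .
  qed
  show ?thesis
  proof (intro exI[of _ "sqrt K"] conjI allI impI)
    fix N :: nat and \<Omega> :: "(real^2) set" assume "2 \<le> N" "finite \<Omega> \<and> card \<Omega> = N"
    then show "L2_operator_norm (maximal_Hilbert \<Omega>) \<le> ennreal (sqrt K * real N powr (1 / 4) * h (real N))"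
      unfolding L2_operator_norm_def by (intro SUP_least main) auto
  qed (use K in simp)
qed

end
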